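(* Let $n=2$, $p>1$, $\varepsilon\in(0,1)$, $\Omega=B_5\subset\mathbb{R}^2$, and let $\mathcal D_1,\mathcal D_2$ be the open unit disks centered at $(0,1+\varepsilon/2)$ and $(0,-1-\varepsilon/2)$ respectively. Set $\widetilde\Omega=\Omega\setminus\overline{\mathcal D_1\cup\mathcal D_2}$, and let $u\in W^{1,p}(\widetilde\Omega)$ be the solution of $$-\operatorname{div}(|Du|^{p-2}Du)=0 \text{ in }\widetilde\Omega,\qquad \frac{\partial u}{\partial\nu}=0\text{ on }\partial\mathcal D_1\cup\partial\mathcal D_2,\qquad u=x_1\text{ on }\partial\Omega.$$ Then for any $\delta>0$ there exists a constant $C>0$ depending only on $p$ and $\delta$ such that: if $p\in(1,3]$, $$\|Du\|_{L^\infty(\widetilde\Omega\cap B_{8\sqrt{\varepsilon/\delta}})}\ge \frac1C\varepsilon^{\frac{-1+\delta}{2}},$$ and if $p>3$, $$\|Du\|_{L^\infty(\widetilde\Omega\cap B_{8\sqrt{\varepsilon/\delta}})}\ge \frac1C\varepsilon^{\frac{-1+\delta}{p-1}}.$$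
   Context: $B_r$ denotes the open disk of radius $r$ centered at the origin; $\nu$ is the unit normal on $\partial\mathcal D_1\cup\partial\mathcal D_2$. *)

theory Defs
  imports "HOL-Analysis.Analysis" "HOL-Probability.Essential_Supremum"
begin

definition partial_deriv :: "2 \<Rightarrow> (real^2 \<Rightarrow> real) \<Rightarrow> real^2 \<Rightarrow> real" where
  "partial_deriv i f x = deriv (\<lambda>t. f (x + t *\<^sub>R axis i 1)) 0"

definition grad :: "(real^2 \<Rightarrow> real) \<Rightarrow> real^2 \<Rightarrow> real^2" where
  "grad f x = (\<chi> i. partial_deriv i f x)"

definition smooth2 :: "(real^2 \<Rightarrow> real) \<Rightarrow> bool" where
  "smooth2 f \<longleftrightarrow> (\<exists>D :: 2 list \<Rightarrow> real^2 \<Rightarrow> real. D [] = f \<and>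
     (\<forall>\<alpha> i x. ((\<lambda>t. D \<alpha> (x + t *\<^sub>R axis i 1)) has_real_derivative D (i # \<alpha>) x) (at 0)) \<and>
     (\<forall>\<alpha>. continuous_on UNIV (D \<alpha>)))"

definition tsupport :: "(real^2 \<Rightarrow> real) \<Rightarrow> (real^2) set" where
  "tsupport f = closure {x. f x \<noteq> 0}"

definition test_fun :: "(real^2) set \<Rightarrow> (real^2 \<Rightarrow> real) \<Rightarrow> bool" where
  "test_fun U \<phi> \<longleftrightarrow> smooth2 \<phi> \<and> compact (tsupport \<phi>) \<and> tsupport \<phi> \<subseteq> U"

definition weak_grad :: "(real^2) set \<Rightarrow> (real^2 \<Rightarrow> real) \<Rightarrow> (real^2 \<Rightarrow> real^2) \<Rightarrow> bool" where
  "weak_grad U u g \<longleftrightarrow>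
     (\<forall>K. compact K \<and> K \<subseteq> U \<longrightarrow>
        set_integrable lebesgue K u \<and> (\<forall>i. set_integrable lebesgue K (\<lambda>x. g x $ i))) \<and>
     (\<forall>\<phi> i. test_fun U \<phi> \<longrightarrow>
        (LINT x:U|lebesgue. u x * partial_deriv i \<phi> x) = - (LINT x:U|lebesgue. g x $ i * \<phi> x))"

definition sobolev :: "real \<Rightarrow> (real^2) set \<Rightarrow> (real^2 \<Rightarrow> real) \<Rightarrow> (real^2 \<Rightarrow> real^2) \<Rightarrow> bool" where
  "sobolev p U u g \<longleftrightarrow>
     set_borel_measurable lebesgue U u \<and> set_integrable lebesgue U (\<lambda>x. \<bar>u x\<bar> powr p) \<and>
     set_borel_measurable lebesgue U g \<and> set_integrable lebesgue U (\<lambda>x. norm (g x) powr p) \<and>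
     weak_grad U u g"

definition incl1 :: "real \<Rightarrow> (real^2) set" where
  "incl1 \<epsilon> = ball (vector [0, 1 + \<epsilon>/2]) 1"

definition incl2 :: "real \<Rightarrow> (real^2) set" where
  "incl2 \<epsilon> = ball (vector [0, -1 - \<epsilon>/2]) 1"

definition Omega_t :: "real \<Rightarrow> (real^2) set" where
  "Omega_t \<epsilon> = ball 0 5 - closure (incl1 \<epsilon> \<union> incl2 \<epsilon>)"

text \<open>Weak solution of -div(|Du|^{p-2}Du)=0 in Omega_t, du/dnu = 0 on the inclusion
  boundaries (natural boundary condition: test functions need not vanish there),
  u = x_1 on the outer boundary (u - x_1 is a W^{1,p}(Omega_t)-limit of test functions
  compactly supported in B_5).\<close>
definition is_solution :: "real \<Rightarrow> real \<Rightarrow> (real^2 \<Rightarrow> real) \<Rightarrow> (real^2 \<Rightarrow> real^2) \<Rightarrow> bool" where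
  "is_solution p \<epsilon> u g \<longleftrightarrow>
     sobolev p (Omega_t \<epsilon>) u g \<and>
     (\<forall>\<phi>. test_fun (ball 0 5) \<phi> \<longrightarrow>
        (LINT x:Omega_t \<epsilon>|lebesgue. norm (g x) powr (p - 2) * (g x \<bullet> grad \<phi> x)) = 0) \<and>
     (\<exists>\<psi> :: nat \<Rightarrow> real^2 \<Rightarrow> real. (\<forall>k. test_fun (ball 0 5) (\<psi> k)) \<and>
        (\<lambda>k. LINT x:Omega_t \<epsilon>|lebesgue. \<bar>\<psi> k x - (u x - x $ 1)\<bar> powr p) \<longlonglongrightarrow> 0 \<and>
        (\<lambda>k. LINT x:Omega_t \<epsilon>|lebesgue. norm (grad (\<psi> k) x - (g x - axis 1 1)) powr p) \<longlonglongrightarrow> 0)"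

definition Linf_norm :: "(real^2) set \<Rightarrow> (real^2 \<Rightarrow> real^2) \<Rightarrow> ereal" where
  "Linf_norm S g = esssup (restrict_space lebesgue S) (\<lambda>x. ereal (norm (g x)))"

end

theory Submission
  imports Defs
begin

text \<open>
  Strict monotonicity of \<open>A(\<xi>) = |\<xi>|\<^bsup>p-2\<^esup> \<xi>\<close> forces the gradient of the solution to be equivariant under
  \<open>x\<^sub>1 \<mapsto> - x\<^sub>1\<close>, so one may work with the odd part of the solution, which vanishes on \<open>x\<^sub>1 = 0\<close>.
  Two strict subsolutions are then compared with it. On \<open>x\<^sub>1 > 0\<close> the function \<open>(x\<^sub>1 + x\<^sub>1\<^sup>2/5)/2\<close>
  shows that the odd part is at least \<open>x\<^sub>1/2\<close>. In the neck the function
  \<open>a ((x\<^sub>1\<^sup>2 + k x\<^sub>2\<^sup>2)\<^bsup>\<gamma>/2\<^esup> - const)\<close> with \<open>k = 2 - \<delta>/2\<close> and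
  \<open>\<gamma> = 1 - 2(1-\<delta>)/max(p-1,2)\<close> is a subsolution with favourable conormal derivative as soon as
  \<open>x\<^sub>1\<^sup>2 + k x\<^sub>2\<^sup>2 \<ge> 5\<epsilon>/\<delta>\<close>, and it lies below \<open>x\<^sub>1/2\<close> at the end of the neck. At distance
  \<open>5 (\<epsilon>/\<delta>)\<^bsup>1/2\<^esup>\<close> from the origin the odd part is therefore at least a multiple of
  \<open>(\<epsilon>/\<delta>)\<^bsup>\<gamma>/2\<^esup>\<close>, and the mean value theorem gives a gradient of order \<open>\<epsilon>\<^bsup>(\<gamma>-1)/2\<^esup>\<close>.
\<close>

section \<open>Smooth functions\<close>

text \<open>Two demands pull \<open>k\<close> in opposite directions. Where x_2 is small against
  x_1, the divergence of the barrier's flux has the sign of about (gamma-1)(p-1) + k, so a larger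
  \<open>k\<close> permits a smaller gamma, that is, a larger gradient. On the circles, where |x_2|
  is about (x_1^2 + eps)/2, the conormal derivative has the sign of about (1 - k/2) x_1^2 - k eps/2.
  This forces k < 2 and x_1^2 of order at least eps/delta. The choice k = 2 - delta/2 gives up only
  order delta in the exponent. Also gamma > 0 is required, since the barrier must grow away from the
  origin; this produces the maximum of p-1 and 2, hence the change of regime at p = 3.

  The obstacle is the lack of pointwise information: the odd part and its gradient are known as L^p
  limits of smooth functions, with no traces on the circles. Hence each subsolution is strict, its
  surplus \<open>d\<close> turning vanishing errors into a vanishing test function; the sign of the
  flux at the holes is imposed on a whole region instead of the circles; comparison takes place
  above a level eta > 0 that later tends to 0; and the mean value theorem is applied to integrals
  over squares.\<close>

definition smooth_on :: "(real^2) set \<Rightarrow> (real^2 \<Rightarrow> real) \<Rightarrow> bool" where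
  "smooth_on U f \<longleftrightarrow> (\<exists>D :: 2 list \<Rightarrow> real^2 \<Rightarrow> real. D [] = f \<and>
     (\<forall>\<alpha> i. \<forall>x\<in>U. ((\<lambda>t. D \<alpha> (x + t *\<^sub>R axis i 1)) has_real_derivative D (i # \<alpha>) x) (at 0)) \<and>
     (\<forall>\<alpha>. continuous_on U (D \<alpha>)))"

lemma smooth2_iff_smooth_on: "smooth2 f \<longleftrightarrow> smooth_on UNIV f"
  by (simp add: smooth2_def smooth_on_def)

text \<open>Choosing one derivative per direction inside a class closed under partial
  differentiation produces the whole family of iterated partials, so smoothness reduces to finding
  such a class of continuous functions.\<close>

lemma smooth_onI:
  assumes "f \<in> S"
    and "\<And>h. h \<in> S \<Longrightarrow> continuous_on U h"
    and "\<And>h i. h \<in> S \<Longrightarrow> \<exists>h'\<in>S. \<forall>x\<in>U.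
           ((\<lambda>t. h (x + t *\<^sub>R axis i 1)) has_real_derivative h' x) (at 0)"
  shows "smooth_on U f"
proof -
  define N where "N i h = (SOME h'. h' \<in> S \<and> (\<forall>x\<in>U.
      ((\<lambda>t. h (x + t *\<^sub>R axis i 1)) has_real_derivative h' x) (at 0)))" for i h
  have *: "N i h \<in> S \<and> (\<forall>x\<in>U.
      ((\<lambda>t. h (x + t *\<^sub>R axis i 1)) has_real_derivative N i h x) (at 0))" if "h \<in> S" for i h
    using someI_ex[OF assms(3)[OF that, of i, unfolded Bex_def]] unfolding N_def .
  then have N: "\<And>h i. h \<in> S \<Longrightarrow> N i h \<in> S"
      "\<And>h i x. h \<in> S \<Longrightarrow> x \<in> U \<Longrightarrow>
          ((\<lambda>t. h (x + t *\<^sub>R axis i 1)) has_real_derivative N i h x) (at 0)"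
    by blast+
  define D where "D \<alpha> = foldr N \<alpha> f" for \<alpha>
  have "D \<alpha> \<in> S" for \<alpha>
    by (induction \<alpha>) (use assms(1) N(1) in \<open>auto simp: D_def\<close>)
  then show ?thesis
    unfolding smooth_on_def
    by (intro exI[of _ D]) (use assms(2) N(2) in \<open>auto simp: D_def\<close>)
qed

lemma smooth_on_partial:
  assumes "smooth_on U f"
  obtains f' where "smooth_on U f'"
    "\<And>x. x \<in> U \<Longrightarrow> ((\<lambda>t. f (x + t *\<^sub>R axis i 1)) has_real_derivative f' x) (at 0)"
proof -
  obtain D where D: "D [] = f"
    "\<And>\<alpha> i x. x \<in> U \<Longrightarrow> ((\<lambda>t. D \<alpha> (x + t *\<^sub>R axis i 1)) has_real_derivative D (i # \<alpha>) x) (at 0)"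
    "\<And>\<alpha>. continuous_on U (D \<alpha>)"
    using assms unfolding smooth_on_def by blast
  have "smooth_on U (D [i])"
    unfolding smooth_on_def
    \<comment> \<open>Lists grow at the head, so an \<open>i\<close> appended at the end is the
      direction differentiated first.\<close>
    by (intro exI[of _ "\<lambda>\<alpha>. D (\<alpha> @ [i])"]) (use D in auto)
  with D(1) D(2)[of _ "[]" i] show thesis using that by blast
qed

lemma smooth_on_imp_continuous_on: "smooth_on U f \<Longrightarrow> continuous_on U f"
  unfolding smooth_on_def by blast

section \<open>Closure of smooth functions under sums, products and composition\<close>

inductive_set algebra_hull :: "(real^2 \<Rightarrow> real) set \<Rightarrow> (real^2 \<Rightarrow> real) set" for G where
  base: "h \<in> G \<Longrightarrow> h \<in> algebra_hull G"
| add: "h \<in> algebra_hull G \<Longrightarrow> k \<in> algebra_hull G \<Longrightarrow> (\<lambda>x. h x + k x) \<in> algebra_hull G"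
| mult: "h \<in> algebra_hull G \<Longrightarrow> k \<in> algebra_hull G \<Longrightarrow> (\<lambda>x. h x * k x) \<in> algebra_hull G"

text \<open>By the sum and product rules the hull is closed under differentiation as soon as the
  derivatives of the generators lie in it. This does the work of a Leibniz formula for higher
  derivatives.\<close>

lemma smooth_on_algebra_hull:
  assumes G: "\<And>h. h \<in> G \<Longrightarrow> continuous_on U h"
    "\<And>h i. h \<in> G \<Longrightarrow> \<exists>h'\<in>algebra_hull G. \<forall>x\<in>U.
           ((\<lambda>t. h (x + t *\<^sub>R axis i 1)) has_real_derivative h' x) (at 0)"
    and f: "f \<in> algebra_hull G"
  shows "smooth_on U f"
proof (rule smooth_onI[where S = "algebra_hull G"])
  show "f \<in> algebra_hull G" by fact
next
  fix h assume "h \<in> algebra_hull G"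
  then show "continuous_on U h"
    by induction (auto intro: G continuous_intros)
next
  fix h i assume "h \<in> algebra_hull G"
  then show "\<exists>h'\<in>algebra_hull G. \<forall>x\<in>U.
           ((\<lambda>t. h (x + t *\<^sub>R axis i 1)) has_real_derivative h' x) (at 0)"
  proof induction
    case (base h)
    then show ?case using G(2) by blast
  next
    case (add h k)
    then obtain h' k' where *: "h' \<in> algebra_hull G" "k' \<in> algebra_hull G"
      "\<forall>x\<in>U. ((\<lambda>t. h (x + t *\<^sub>R axis i 1)) has_real_derivative h' x) (at 0)"
      "\<forall>x\<in>U. ((\<lambda>t. k (x + t *\<^sub>R axis i 1)) has_real_derivative k' x) (at 0)" by blast
    show ?case
      by (rule bexI[of _ "\<lambda>x. h' x + k' x"])
         (use * in \<open>auto intro!: derivative_eq_intros algebra_hull.add\<close>)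
  next
    case (mult h k)
    then obtain h' k' where *: "h' \<in> algebra_hull G" "k' \<in> algebra_hull G"
      "\<forall>x\<in>U. ((\<lambda>t. h (x + t *\<^sub>R axis i 1)) has_real_derivative h' x) (at 0)"
      "\<forall>x\<in>U. ((\<lambda>t. k (x + t *\<^sub>R axis i 1)) has_real_derivative k' x) (at 0)" by blast
    have "((\<lambda>t. h (x + t *\<^sub>R axis i 1) * k (x + t *\<^sub>R axis i 1)) has_real_derivative
             (h' x * k x + k' x * h x)) (at 0)" if "x \<in> U" for x
      using DERIV_mult[OF *(3)[rule_format, OF that] *(4)[rule_format, OF that]] by simp
    then show ?case
      by (intro bexI[of _ "\<lambda>x. h' x * k x + k' x * h x"])
         (use * mult.hyps in \<open>auto intro!: algebra_hull.intros(2,3)\<close>)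
  qed
qed

lemma smooth_on_const [intro]: "smooth_on U (\<lambda>x. c)"
proof (rule smooth_onI[where S = "range (\<lambda>c x. c)"], goal_cases)
  case (3 h i)
  then show ?case by (intro bexI[of _ "\<lambda>x. 0"]) auto
qed auto

lemma smooth_on_coord [intro]: "smooth_on U (\<lambda>x. x $ j)"
proof (rule smooth_onI[where S = "insert (\<lambda>x. x $ j) (range (\<lambda>c x. c))"], goal_cases)
  case (3 h i)
  have "((\<lambda>t. (x + t *\<^sub>R axis i 1) $ j) has_real_derivative (axis i 1 :: real^2) $ j) (at 0)"
    for x :: "real^2"
    by (auto intro!: derivative_eq_intros)
  moreover have "((\<lambda>t. c) has_real_derivative 0) (at 0)" for c by auto
  ultimately show ?case using 3 by (elim insertE imageE; simp; metis)
qed (auto intro!: continuous_intros)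

lemma smooth_on_ring_op:
  assumes "smooth_on U f" "smooth_on U g"
  shows smooth_on_add: "smooth_on U (\<lambda>x. f x + g x)"
    and smooth_on_mult: "smooth_on U (\<lambda>x. f x * g x)"
proof -
  obtain D where D: "D [] = f"
    "\<And>\<alpha> i x. x \<in> U \<Longrightarrow> ((\<lambda>t. D \<alpha> (x + t *\<^sub>R axis i 1)) has_real_derivative D (i # \<alpha>) x) (at 0)"
    "\<And>\<alpha>. continuous_on U (D \<alpha>)"
    using assms(1) unfolding smooth_on_def by blast
  obtain E where E: "E [] = g"
    "\<And>\<alpha> i x. x \<in> U \<Longrightarrow> ((\<lambda>t. E \<alpha> (x + t *\<^sub>R axis i 1)) has_real_derivative E (i # \<alpha>) x) (at 0)"
    "\<And>\<alpha>. continuous_on U (E \<alpha>)"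
    using assms(2) unfolding smooth_on_def by blast
  let ?G = "range D \<union> range E"
  have *: "f \<in> algebra_hull ?G" "g \<in> algebra_hull ?G"
    using D(1) E(1) by (auto intro!: algebra_hull.base)
  have G: "\<And>h. h \<in> ?G \<Longrightarrow> continuous_on U h" using D(3) E(3) by auto
  have G': "\<exists>h'\<in>algebra_hull ?G. \<forall>x\<in>U.
           ((\<lambda>t. h (x + t *\<^sub>R axis i 1)) has_real_derivative h' x) (at 0)" if "h \<in> ?G" for h i
    using that D(2) E(2) by (blast intro: algebra_hull.base)
  show "smooth_on U (\<lambda>x. f x + g x)"
    by (rule smooth_on_algebra_hull[OF G G']) (use * in \<open>auto intro: algebra_hull.add\<close>)
  show "smooth_on U (\<lambda>x. f x * g x)"
    by (rule smooth_on_algebra_hull[OF G G']) (use * in \<open>auto intro: algebra_hull.mult\<close>)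
qed

lemma smooth_on_diff:
  assumes "smooth_on U f" "smooth_on U g" shows "smooth_on U (\<lambda>x. f x - g x)"
  using smooth_on_add[OF assms(1) smooth_on_mult[OF smooth_on_const[of U "-1"] assms(2)]] by simp

text \<open>\<open>T n\<close> is the n-th derivative of the outer function. The hull is generated
  by the derivatives of \<open>f\<close> and all \<open>T n\<close> composed with \<open>f\<close>;
  the chain rule sends the latter to a product of two generators.\<close>

lemma smooth_on_compose:
  fixes T :: "nat \<Rightarrow> real \<Rightarrow> real"
  assumes f: "smooth_on U f" and fI: "\<And>x. x \<in> U \<Longrightarrow> f x \<in> I"
    and T: "\<And>n y. y \<in> I \<Longrightarrow> (T n has_real_derivative T (Suc n) y) (at y)"
  shows "smooth_on U (\<lambda>x. T 0 (f x))"
proof -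
  obtain D where D: "D [] = f"
    "\<And>\<alpha> i x. x \<in> U \<Longrightarrow> ((\<lambda>t. D \<alpha> (x + t *\<^sub>R axis i 1)) has_real_derivative D (i # \<alpha>) x) (at 0)"
    "\<And>\<alpha>. continuous_on U (D \<alpha>)"
    using f unfolding smooth_on_def by blast
  let ?G = "range D \<union> range (\<lambda>n x. T n (f x))"
  have cT: "continuous_on I (T n)" for n
    using T by (intro DERIV_atLeastAtMost_imp_continuous_on continuous_at_imp_continuous_on ballI)
      (auto intro: DERIV_isCont)
  have G: "continuous_on U h" if "h \<in> ?G" for h
  proof (cases "h \<in> range D")
    case True
    then show ?thesis using D(3) by blast
  next
    case False
    then obtain n where n: "h = (\<lambda>x. T n (f x))" using \<open>h \<in> ?G\<close> by blast
    show ?thesis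
      unfolding n using cT D(3)[of "[]"] D(1) fI by (metis continuous_on_compose2 image_subsetI)
  qed
  have G': "\<exists>h'\<in>algebra_hull ?G. \<forall>x\<in>U.
           ((\<lambda>t. h (x + t *\<^sub>R axis i 1)) has_real_derivative h' x) (at 0)" if "h \<in> ?G" for h i
  proof (cases "h \<in> range D")
    case True
    then show ?thesis using D(2) by (blast intro: algebra_hull.base)
  next
    case False
    then obtain n where n: "h = (\<lambda>x. T n (f x))" using \<open>h \<in> ?G\<close> by blast
    have "((\<lambda>t. T n (f (x + t *\<^sub>R axis i 1))) has_real_derivative T (Suc n) (f x) * D [i] x) (at 0)"
      if "x \<in> U" for x
      by (rule DERIV_chain2) (use T fI D(2)[of x "[]" i] D(1) that in auto)
    moreover have "(\<lambda>x. T (Suc n) (f x) * D [i] x) \<in> algebra_hull ?G"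
      by (intro algebra_hull.mult algebra_hull.base) auto
    ultimately show ?thesis unfolding n by (intro bexI ballI)
  qed
  show ?thesis
    by (rule smooth_on_algebra_hull[OF G G']) (auto intro: algebra_hull.base)
qed

lemma smooth_on_subset: "smooth_on U f \<Longrightarrow> V \<subseteq> U \<Longrightarrow> smooth_on V f"
  unfolding smooth_on_def by (elim exE, rule_tac x = D in exI) (blast intro: continuous_on_subset)

lemma eventually_line_in_open:
  fixes x :: "real^2"
  assumes "open U" "x \<in> U"
  shows "eventually (\<lambda>t. x + t *\<^sub>R v \<in> U) (at (0::real))"
proof -
  have "((\<lambda>t. x + t *\<^sub>R v) \<longlongrightarrow> x + 0 *\<^sub>R v) (at (0::real))"
    by (intro tendsto_intros)
  then show ?thesis using topological_tendstoD[of _ x "at 0" U] assms by auto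
qed

lemma has_partial_cong_open:
  fixes x :: "real^2"
  assumes "open U" "x \<in> U" "\<And>y. y \<in> U \<Longrightarrow> f y = h y"
    "((\<lambda>t. h (x + t *\<^sub>R v)) has_real_derivative d) (at 0)"
  shows "((\<lambda>t. f (x + t *\<^sub>R v)) has_real_derivative d) (at 0)"
proof -
  have "eventually (\<lambda>t. f (x + t *\<^sub>R v) = h (x + t *\<^sub>R v)) (at (0::real))"
    using eventually_line_in_open[OF assms(1,2)] by eventually_elim (use assms in auto)
  then have "eventually (\<lambda>t. f (x + t *\<^sub>R v) = h (x + t *\<^sub>R v)) (nhds (0::real))"
    using assms by (auto simp: eventually_at_filter elim!: eventually_mono) 
  from DERIV_cong_ev[OF refl this refl] show ?thesis using assms(4) by simp
qed

lemma smooth_on_cong: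
  assumes U: "open U" and f: "smooth_on U f" and e: "\<And>x. x \<in> U \<Longrightarrow> g x = f x"
  shows "smooth_on U g"
proof -
    obtain D where D: "D [] = f"
      "\<And>\<alpha> i x. x \<in> U \<Longrightarrow> ((\<lambda>t. D \<alpha> (x + t *\<^sub>R axis i 1)) has_real_derivative D (i # \<alpha>) x) (at 0)"
      "\<And>\<alpha>. continuous_on U (D \<alpha>)"
      using f unfolding smooth_on_def by blast
    have e: "(D(([]::2 list) := g)) \<alpha> x = D \<alpha> x" if "x \<in> U" for \<alpha> x
      using e that D(1) by auto
    show ?thesis unfolding smooth_on_def
    proof (intro exI[of _ "D(([]::2 list) := g)"] conjI allI ballI)
      fix \<alpha> i x assume "x \<in> U"
      show "((\<lambda>t. (D([] := g)) \<alpha> (x + t *\<^sub>R axis i 1)) has_real_derivative (D([] := g)) (i # \<alpha>) x) (at 0)"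
        by (rule has_partial_cong_open[OF U \<open>x \<in> U\<close> e]) (use D(2) \<open>x \<in> U\<close> in auto)
    next
      fix \<alpha> show "continuous_on U ((D([] := g)) \<alpha>)"
        using e D(3) by (subst continuous_on_cong[OF refl e]) auto
    qed simp
qed

lemma continuous_on_zero_extension:
  fixes h :: "real^2 \<Rightarrow> real"
  assumes "open U" "closed K" "K \<subseteq> U" "continuous_on U h" "\<And>x. x \<notin> K \<Longrightarrow> h x = 0"
  shows "continuous_on UNIV h"
proof -
  have "continuous_on (- K) h" using assms(5) by (subst continuous_on_cong[OF refl, of _ _ "\<lambda>_. 0"]) auto
  then have "continuous_on (U \<union> - K) h"
    using assms by (intro continuous_on_open_Un) auto
  moreover have "U \<union> - K = UNIV" using assms by auto
  ultimately show ?thesis by simp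
qed

text \<open>Every point lies in the open set \<open>U\<close> or in the open complement of
  \<open>K\<close>, where the function is 0; on the overlap the derivatives agree by uniqueness.
  This turns functions that are smooth only on part of the plane into test functions.\<close>

lemma smooth_on_zero_extension:
  assumes U: "open U" and K: "closed K" "K \<subseteq> U" and f: "smooth_on U f"
    and z: "\<And>x. x \<notin> K \<Longrightarrow> f x = 0"
  shows "smooth_on UNIV f"
proof (rule smooth_onI[where S = "{h. smooth_on U h \<and> (\<forall>x. x \<notin> K \<longrightarrow> h x = 0)}"], goal_cases)
  case 1
  then show ?case using f z by auto
next
  case (2 h)
  then show ?case
    using continuous_on_zero_extension[OF U K] smooth_on_imp_continuous_on by auto
next
  case (3 h i)
  then obtain h' where h': "smooth_on U h'"
    "\<And>x. x \<in> U \<Longrightarrow> ((\<lambda>t. h (x + t *\<^sub>R axis i 1)) has_real_derivative h' x) (at 0)"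
    using smooth_on_partial[of U h] by blast
  have z0: "((\<lambda>t. h (x + t *\<^sub>R axis i 1)) has_real_derivative 0) (at 0)" if "x \<notin> K" for x
    by (rule has_partial_cong_open[of "- K" _ _ "\<lambda>_. 0"]) (use 3 that K in auto)
  define k where "k x = (if x \<in> K then h' x else 0)" for x
  have eq: "k x = h' x" if "x \<in> U" for x
    using DERIV_unique[OF z0 h'(2)] that by (auto simp: k_def)
  have "smooth_on U k" by (rule smooth_on_cong[OF U h'(1) eq])
  moreover have "((\<lambda>t. h (x + t *\<^sub>R axis i 1)) has_real_derivative k x) (at 0)" for x
    using z0[of x] h'(2)[of x] K by (auto simp: k_def)
  ultimately show ?case by (intro bexI[of _ k]) (auto simp: k_def)
qed

section \<open>A flat smooth function and a smooth step\<close>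

fun flat_exp_poly :: "nat \<Rightarrow> real poly" where
  "flat_exp_poly 0 = 1"
| "flat_exp_poly (Suc n) = [:0, 0, 1:] * (flat_exp_poly n - pderiv (flat_exp_poly n))"

text \<open>For t > 0 the n-th derivative of exp(-1/t) has the form P_n(1/t) exp(-1/t).
  Differentiating once more gives t^(-2) (P_n - P_n')(1/t) exp(-1/t), which is the recursion of
  \<open>flat_exp_poly\<close>.\<close>

definition flat_exp_deriv :: "nat \<Rightarrow> real \<Rightarrow> real" where
  "flat_exp_deriv n t = (if t > 0 then poly (flat_exp_poly n) (1 / t) * exp (- 1 / t) else 0)"

text \<open>A smooth, nondecreasing and Lipschitz stand-in for the positive part, positive exactly
  on the positive axis. It shapes the test functions of \<open>comparison\<close> and the cutoff
  around the holes.\<close>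

definition flat_exp :: "real \<Rightarrow> real" where
  "flat_exp t = (if t > 0 then exp (- 1 / t) else 0)"

lemma flat_exp_deriv_0: "flat_exp_deriv 0 = flat_exp"
  by (auto simp: flat_exp_def flat_exp_deriv_def)

lemma flat_exp_deriv_1: "flat_exp_deriv (Suc 0) t = (if t > 0 then exp (- 1 / t) / t\<^sup>2 else 0)"
  by (auto simp: flat_exp_deriv_def power2_eq_square)

lemma poly_mult_exp_tendsto_0:
  fixes P :: "real poly"
  shows "((\<lambda>y. poly P y * exp (- y)) \<longlongrightarrow> 0) at_top"
proof -
  have "((\<lambda>y. \<Sum>i\<le>degree P. coeff P i * (y ^ i / exp y)) \<longlongrightarrow> (\<Sum>i\<le>degree P. coeff P i * 0)) at_top"
    by (intro tendsto_intros tendsto_power_div_exp_0)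
  moreover have "(\<Sum>i\<le>degree P. coeff P i * (y ^ i / exp y)) = poly P y * exp (- y)" for y
    by (simp add: poly_altdef sum_distrib_right exp_minus divide_inverse mult.assoc)
  ultimately show ?thesis by simp
qed

lemma flat_exp_deriv_has_derivative:
  "(flat_exp_deriv n has_real_derivative flat_exp_deriv (Suc n) t) (at t)"
proof -
  consider "t > 0" | "t < 0" | "t = 0" by linarith
  then show ?thesis
  proof cases
    case 1
    have d: "((\<lambda>t. poly (flat_exp_poly n) (1 / t) * exp (- 1 / t)) has_real_derivative
            flat_exp_deriv (Suc n) t) (at t)"
      using 1 by (auto intro!: derivative_eq_intros poly_DERIV[THEN DERIV_chain2]
          simp: flat_exp_deriv_def field_simps power2_eq_square)
    have "eventually (\<lambda>s. flat_exp_deriv n s = poly (flat_exp_poly n) (1 / s) * exp (- 1 / s)) (nhds t)"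
      using eventually_nhds_in_open[of "{0<..}" t] 1
      by (auto elim!: eventually_mono simp: flat_exp_deriv_def)
    from DERIV_cong_ev[OF refl this refl] d show ?thesis by simp
  next
    case 2
    have "eventually (\<lambda>s. flat_exp_deriv n s = 0) (nhds t)"
      using eventually_nhds_in_open[of "{..<0}" t] 2
      by (auto elim!: eventually_mono simp: flat_exp_deriv_def)
    from DERIV_cong_ev[OF refl this refl] 2 show ?thesis by (simp add: flat_exp_deriv_def[of "Suc n"])
  next
    case 3
    \<comment> \<open>With y = 1/h the right difference quotient at 0 is y P_n(y) exp(-y), whence
      the extra factor y in \<open>?Q\<close>.\<close>
    let ?Q = "[:0, 1:] * flat_exp_poly n"
    have "((\<lambda>h. poly ?Q (inverse h) * exp (- inverse h)) \<longlongrightarrow> 0) (at_right (0::real))"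
      by (rule filterlim_compose[OF poly_mult_exp_tendsto_0 filterlim_inverse_at_top_right])
    then have r: "((\<lambda>h. (flat_exp_deriv n (0 + h) - flat_exp_deriv n 0) / h) \<longlongrightarrow> 0) (at_right 0)"
      by (rule filterlim_cong[THEN iffD1, rotated -1])
         (auto simp: eventually_at_filter flat_exp_deriv_def field_simps)
    have l: "((\<lambda>h. (flat_exp_deriv n (0 + h) - flat_exp_deriv n 0) / h) \<longlongrightarrow> 0) (at_left 0)"
      by (rule filterlim_cong[THEN iffD1, OF refl refl _ tendsto_const[of 0]])
         (auto simp: eventually_at_filter flat_exp_deriv_def)
    show ?thesis unfolding 3 DERIV_def
      using filterlim_split_at[OF l r] by (simp add: flat_exp_deriv_def)
  qed
qed

lemma flat_exp_has_derivative:
  "(flat_exp has_real_derivative flat_exp_deriv (Suc 0) t) (at t)"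
  using flat_exp_deriv_has_derivative[of 0 t] by (simp only: flat_exp_deriv_0)

lemma flat_exp_nonneg [simp]: "0 \<le> flat_exp t"
  and flat_exp_le_1: "flat_exp t \<le> 1"
  and flat_exp_pos_iff [simp]: "0 < flat_exp t \<longleftrightarrow> 0 < t"
  and flat_exp_eq_0_iff [simp]: "flat_exp t = 0 \<longleftrightarrow> t \<le> 0"
  by (auto simp: flat_exp_def)

lemma flat_exp_deriv_1_nonneg: "0 \<le> flat_exp_deriv (Suc 0) t"
  by (simp add: flat_exp_deriv_1)

lemma flat_exp_deriv_1_le: "flat_exp_deriv (Suc 0) t \<le> 2"
proof (cases "t > 0")
  case True
  \<comment> \<open>The bound 2 comes from exp s >= s^2/2 with s = 1/t.\<close>
  have "1 + 1/t + (1/t)\<^sup>2 / 2 \<le> exp (1/t)"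
    using True by (intro exp_lower_Taylor_quadratic) auto
  then have "(1/t)\<^sup>2 \<le> 2 * exp (1/t)" using True by (smt (verit) divide_pos_pos field_sum_of_halves)
  then have "(1/t)\<^sup>2 / exp (1/t) \<le> 2" by (simp add: divide_le_eq)
  then show ?thesis using True by (simp add: flat_exp_deriv_1 exp_minus field_simps)
qed (simp add: flat_exp_deriv_1)

lemma flat_exp_Lipschitz: "\<bar>flat_exp s - flat_exp t\<bar> \<le> 2 * \<bar>s - t\<bar>"
proof -
  have "\<bar>flat_exp s - flat_exp t\<bar> \<le> 2 * \<bar>s - t\<bar>" if "t < s" for s t
  proof -
    have "\<exists>z. flat_exp s - flat_exp t = (s - t) * flat_exp_deriv (Suc 0) z"
      using MVT2[OF that, of flat_exp "flat_exp_deriv (Suc 0)"] flat_exp_has_derivative by blast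
    then obtain z where "flat_exp s - flat_exp t = (s - t) * flat_exp_deriv (Suc 0) z" ..
    moreover have "(s - t) * flat_exp_deriv (Suc 0) z \<le> (s - t) * 2"
      using that flat_exp_deriv_1_le[of z] by (intro mult_left_mono) auto
    ultimately show ?thesis using that flat_exp_deriv_1_nonneg[of z] by (auto simp: abs_mult)
  qed
  from this[of s t] this[of t s] show ?thesis by (cases s t rule: linorder_cases) auto
qed

lemma continuous_on_flat_exp [continuous_intros]:
  "continuous_on A f \<Longrightarrow> continuous_on A (\<lambda>x. flat_exp (f x))"
  using continuous_on_compose2[of UNIV flat_exp A f] flat_exp_has_derivative
  by (meson DERIV_isCont continuous_at_imp_continuous_on subset_UNIV)

lemma continuous_on_flat_exp_deriv:
  "continuous_on A f \<Longrightarrow> continuous_on A (\<lambda>x. flat_exp_deriv n (f x))"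
  using continuous_on_compose2[of UNIV "flat_exp_deriv n" A f] flat_exp_deriv_has_derivative
  by (meson DERIV_isCont continuous_at_imp_continuous_on subset_UNIV)

lemma smooth_on_flat_exp:
  assumes "smooth_on U f" shows "smooth_on U (\<lambda>x. flat_exp (f x))"
  using smooth_on_compose[OF assms, of UNIV flat_exp_deriv] flat_exp_deriv_has_derivative
  by (simp add: flat_exp_deriv_0)

lemma smooth_on_powr:
  assumes "smooth_on U f" "\<And>x. x \<in> U \<Longrightarrow> f x > 0"
  shows "smooth_on U (\<lambda>x. f x powr a)"
proof -
  define T where "T n y = (\<Prod>i<n. a - real i) * y powr (a - real n)" for n y
  have "(T n has_real_derivative T (Suc n) y) (at y)" if "y \<in> {0<..}" for n y
    using that unfolding T_def
    by (auto intro!: derivative_eq_intros simp: algebra_simps)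
  from smooth_on_compose[OF assms(1), of "{0<..}" T] this assms(2) show ?thesis
    by (auto simp: T_def)
qed

lemma smooth_on_inverse:
  assumes "smooth_on U f" "\<And>x. x \<in> U \<Longrightarrow> f x > 0" "open U"
  shows "smooth_on U (\<lambda>x. inverse (f x))"
  by (rule smooth_on_cong[OF assms(3) smooth_on_powr[OF assms(1,2), of "-1"]])
     (use assms(2) in \<open>auto simp: powr_minus less_imp_le\<close>)

definition smooth_step :: "real \<Rightarrow> real" where
  "smooth_step t = flat_exp t * inverse (flat_exp t + flat_exp (1 - t))"

lemma smooth_step_denom_pos: "flat_exp t + flat_exp (1 - t) > 0"
  by (cases "t > 0") (auto intro: add_pos_nonneg add_nonneg_pos)

lemma smooth_on_smooth_step:
  assumes "smooth_on U f" "open U" shows "smooth_on U (\<lambda>x. smooth_step (f x))"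
  unfolding smooth_step_def
  by (intro smooth_on_mult smooth_on_inverse smooth_on_add smooth_on_flat_exp smooth_on_diff
      smooth_on_const assms smooth_step_denom_pos)

lemma smooth_step_bounds: "0 \<le> smooth_step t" "smooth_step t \<le> 1"
  and smooth_step_eq_1_iff: "smooth_step t = 1 \<longleftrightarrow> t \<ge> 1"
  and smooth_step_eq_0_iff: "smooth_step t = 0 \<longleftrightarrow> t \<le> 0"
proof -
  note d = smooth_step_denom_pos[of t]
  have e: "smooth_step t = flat_exp t / (flat_exp t + flat_exp (1 - t))"
    by (simp add: smooth_step_def field_simps)
  show "0 \<le> smooth_step t" "smooth_step t \<le> 1"
    using d by (auto simp: e divide_le_eq_1)
  show "smooth_step t = 1 \<longleftrightarrow> t \<ge> 1" using d by (auto simp: e divide_eq_eq)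
  show "smooth_step t = 0 \<longleftrightarrow> t \<le> 0" using d by (auto simp: e)
qed

section \<open>Partial derivatives and gradients of smooth functions\<close>

lemma smooth_on_has_partial_deriv:
  assumes "smooth_on U f" "x \<in> U"
  shows "((\<lambda>t. f (x + t *\<^sub>R axis i 1)) has_real_derivative partial_deriv i f x) (at 0)"
proof -
  obtain f' where "\<And>x. x \<in> U \<Longrightarrow> ((\<lambda>t. f (x + t *\<^sub>R axis i 1)) has_real_derivative f' x) (at 0)"
    using smooth_on_partial[OF assms(1)] by blast
  from this[OF assms(2)] DERIV_imp_deriv[OF this[OF assms(2)]] show ?thesis
    unfolding partial_deriv_def by simp
qed

lemma partial_derivI:
  "((\<lambda>t. f (x + t *\<^sub>R axis i 1)) has_real_derivative d) (at 0) \<Longrightarrow> partial_deriv i f x = d"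
  unfolding partial_deriv_def by (rule DERIV_imp_deriv)

lemma smooth_on_partial_deriv:
  assumes "smooth_on U f" "open U" shows "smooth_on U (partial_deriv i f)"
proof -
  obtain f' where f': "smooth_on U f'"
    "\<And>x. x \<in> U \<Longrightarrow> ((\<lambda>t. f (x + t *\<^sub>R axis i 1)) has_real_derivative f' x) (at 0)"
    using smooth_on_partial[OF assms(1)] by blast
  show ?thesis
    by (rule smooth_on_cong[OF assms(2) f'(1)]) (use f'(2) in \<open>auto intro: partial_derivI\<close>)
qed

lemma grad_nth [simp]: "grad f x $ i = partial_deriv i f x"
  by (simp add: grad_def)

lemma continuous_on_grad:
  assumes "smooth_on U f" "open U" shows "continuous_on U (grad f)"
  unfolding grad_def
  by (intro continuous_on_vec_lambda)
     (rule smooth_on_imp_continuous_on, rule smooth_on_partial_deriv, fact+)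

section \<open>Flux through the perforated plane\<close>

lemma integrable_compact_support:
  fixes h :: "real^2 \<Rightarrow> real"
  assumes "continuous_on UNIV h" "compact K" "\<And>x. x \<notin> K \<Longrightarrow> h x = 0"
  shows "integrable lborel h"
proof -
  have "integrable lborel (\<lambda>x. indicator K x *\<^sub>R h x)"
    using assms by (intro borel_integrable_compact) (auto intro: continuous_on_subset)
  moreover have "(\<lambda>x. indicator K x *\<^sub>R h x) = h"
    using assms(3) by (auto simp: indicator_def fun_eq_iff)
  ultimately show ?thesis by simp
qed

lemma lborel_integral_shift:
  fixes f :: "real^2 \<Rightarrow> real"
  assumes "f \<in> borel_measurable borel"
  shows "integral\<^sup>L lborel (\<lambda>x. f (x + c)) = integral\<^sup>L lborel f"
proof -
  have "integral\<^sup>L lborel f = integral\<^sup>L (distr lborel borel ((+) c)) f"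
    by (simp add: lborel_distr_plus)
  also have "\<dots> = integral\<^sup>L lborel (\<lambda>x. f (c + x))"
    by (rule integral_distr) (use assms in auto)
  finally show ?thesis by (simp add: add.commute)
qed

lemma has_derivative_along_line:
  fixes h :: "real^2 \<Rightarrow> real"
  assumes "\<And>x. ((\<lambda>t. h (x + t *\<^sub>R e)) has_real_derivative h' x) (at 0)"
  shows "((\<lambda>t. h (x + t *\<^sub>R e)) has_real_derivative h' (x + s *\<^sub>R e)) (at s)"
proof -
  have "((\<lambda>t. h ((x + s *\<^sub>R e) + (t - s) *\<^sub>R e)) has_real_derivative h' (x + s *\<^sub>R e) * 1) (at s)"
    by (rule DERIV_chain2[where f = "\<lambda>t. h ((x + s *\<^sub>R e) + t *\<^sub>R e)" and g = "\<lambda>t. t - s"])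
       (use assms[of "x + s *\<^sub>R e"] in \<open>auto intro!: derivative_eq_intros\<close>)
  then show ?thesis by (simp add: scaleR_left_diff_distrib)
qed

text \<open>Differentiation under the translation-invariant integral replaces Fubini here.\<close>
lemma integral_partial_eq_0:
  fixes h h' :: "real^2 \<Rightarrow> real"
  assumes d: "\<And>x. ((\<lambda>t. h (x + t *\<^sub>R e)) has_real_derivative h' x) (at 0)"
    and c: "continuous_on UNIV h" "continuous_on UNIV h'"
    and K: "compact K" "\<And>x. x \<notin> K \<Longrightarrow> h x = 0" and e: "norm e = 1"
  shows "integrable lborel h'" "integral\<^sup>L lborel h' = 0"
proof -
  have h'0: "h' x = 0" if "x \<notin> K" for x
  proof -
    have "((\<lambda>t. h (x + t *\<^sub>R e)) has_real_derivative 0) (at 0)"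
      by (rule has_partial_cong_open[of "- K" _ _ "\<lambda>_. 0"])
         (use that K in \<open>auto simp: compact_imp_closed\<close>)
    then show ?thesis using d DERIV_unique by blast
  qed
  show "integrable lborel h'" using c K h'0 integrable_compact_support by blast
  have ih: "integrable lborel h" using c K integrable_compact_support by blast
  obtain B where B: "B \<ge> 0" "\<And>x. \<bar>h' x\<bar> \<le> B"
  proof -
    have "bounded (h' ` K)"
      using c K by (intro compact_imp_bounded compact_continuous_image) (auto intro: continuous_on_subset)
    then obtain B where "\<And>x. x \<in> K \<Longrightarrow> \<bar>h' x\<bar> \<le> B" by (auto simp: bounded_iff)
    then have "\<bar>h' x\<bar> \<le> max B 0" for x using h'0[of x] by (cases "x \<in> K") (fastforce)+
    then show thesis using that[of "max B 0"] by auto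
  qed
  obtain r where r: "K \<subseteq> cball 0 r"
    using compact_imp_bounded[OF K(1)] unfolding bounded_iff subset_iff mem_cball_0 by blast
  have lip: "\<bar>h (x + t *\<^sub>R e) - h x\<bar> \<le> B * t" if "t > 0" for x t
  proof -
    have "\<exists>z. z > 0 \<and> z < t \<and> h (x + t *\<^sub>R e) - h (x + 0 *\<^sub>R e) = (t - 0) * h' (x + z *\<^sub>R e)"
      using MVT2[OF that, of "\<lambda>t. h (x + t *\<^sub>R e)" "\<lambda>z. h' (x + z *\<^sub>R e)"]
        has_derivative_along_line[OF d] by blast
    then obtain z where "h (x + t *\<^sub>R e) - h x = t * h' (x + z *\<^sub>R e)" by auto
    then show ?thesis using B(2)[of "x + z *\<^sub>R e"] that by (simp add: abs_mult mult.commute)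
  qed
  have [measurable]: "h \<in> borel_measurable borel" "h' \<in> borel_measurable borel"
    using c by (auto intro: borel_measurable_continuous_onI)
  define q where "q n x = (h (x + (1 / real (Suc n)) *\<^sub>R e) - h x) / (1 / real (Suc n))" for n x
  have [measurable]: "q n \<in> borel_measurable borel" for n unfolding q_def by measurable
  have "(\<lambda>n. integral\<^sup>L lborel (q n)) \<longlonglongrightarrow> integral\<^sup>L lborel h'"
  \<comment> \<open>The increments have length at most 1, so the difference quotients live in the
    ball of radius r + 1, where the mean value theorem bounds them by \<open>B\<close>.\<close>
  proof (rule integral_dominated_convergence[where w = "\<lambda>x. B * indicator (cball 0 (r + 1)) x"])
    show "integrable lborel (\<lambda>x. B * indicator (cball 0 (r + 1)) x :: real)"
      by (intro integrable_mult_right integrable_real_indicator) (use emeasure_bounded_finite[of "cball 0 (r + 1)"] in auto)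
    show "AE x in lborel. (\<lambda>n. q n x) \<longlonglongrightarrow> h' x"
    proof (intro AE_I2)
      fix x
      have "((\<lambda>t. (h (x + t *\<^sub>R e) - h x) / t) \<longlongrightarrow> h' x) (at 0)"
        using d[of x] by (simp add: DERIV_def)
      moreover have "filterlim (\<lambda>n. 1 / real (Suc n)) (at 0) sequentially"
        using LIMSEQ_Suc[OF lim_1_over_n[where 'a = real]]
        by (auto simp: filterlim_at)
      ultimately show "(\<lambda>n. q n x) \<longlonglongrightarrow> h' x"
        unfolding q_def by (rule filterlim_compose)
    qed
    fix n
    show "AE x in lborel. norm (q n x) \<le> B * indicator (cball 0 (r + 1)) x"
    proof (intro AE_I2)
      fix x :: "real^2"
      show "norm (q n x) \<le> B * indicator (cball 0 (r + 1)) x"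
      proof (cases "x \<in> cball 0 (r + 1)")
        case True
        have "\<bar>q n x\<bar> \<le> B"
          unfolding q_def abs_divide using lip[of "1 / real (Suc n)" x]
          by (subst pos_divide_le_eq) auto
        then show ?thesis using True by simp
      next
        case False
        have "norm x \<le> norm (x + (1 / real (Suc n)) *\<^sub>R e) + norm ((1 / real (Suc n)) *\<^sub>R e)"
          by (metis add_diff_cancel_right' norm_triangle_ineq4)
        also have "norm ((1 / real (Suc n)) *\<^sub>R e) \<le> 1" using e by simp
        finally have "x + (1 / real (Suc n)) *\<^sub>R e \<notin> K" "x \<notin> K" using False r by auto
        then show ?thesis using K(2) False by (simp add: q_def)
      qed
    qed
  qed auto
  moreover have "integral\<^sup>L lborel (q n) = 0" for n
  proof -
    have "integrable lborel (\<lambda>x. h (x + (1 / real (Suc n)) *\<^sub>R e))"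
    proof (rule integrable_compact_support[where K = "(\<lambda>x. x - (1 / real (Suc n)) *\<^sub>R e) ` K"])
      show "continuous_on UNIV (\<lambda>x. h (x + (1 / real (Suc n)) *\<^sub>R e))"
        by (intro continuous_on_compose2[OF c(1)] continuous_intros) auto
      show "compact ((\<lambda>x. x - (1 / real (Suc n)) *\<^sub>R e) ` K)"
        by (intro compact_continuous_image K continuous_intros)
      fix x assume "x \<notin> (\<lambda>x. x - (1 / real (Suc n)) *\<^sub>R e) ` K"
      then have "x + (1 / real (Suc n)) *\<^sub>R e \<notin> K"
        by (metis add_diff_cancel_right' imageI)
      then show "h (x + (1 / real (Suc n)) *\<^sub>R e) = 0" by (rule K(2))
    qed
    then show ?thesis unfolding q_def
      using ih lborel_integral_shift[of h "(1 / real (Suc n)) *\<^sub>R e"]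
      by (simp del: of_nat_Suc)
  qed
  ultimately show "integral\<^sup>L lborel h' = 0" by (simp add: LIMSEQ_const_iff)
qed

definition perforated :: "real^2 \<Rightarrow> real^2 \<Rightarrow> (real^2) set" where
  "perforated c1 c2 = {x. norm (x - c1) > 1 \<and> norm (x - c2) > 1}"

lemma open_perforated: "open (perforated c1 c2)"
  unfolding perforated_def by (intro open_Collect_conj open_Collect_less continuous_intros)

text \<open>Vanishes on both closed discs and tends to 1 off them as j grows. Its gradient is a
  combination of x - c1 and x - c2 with nonnegative coefficients, so only the sign of the flux in
  these two directions matters and no boundary integral appears.\<close>

definition hole_cutoff :: "nat \<Rightarrow> real^2 \<Rightarrow> real^2 \<Rightarrow> real^2 \<Rightarrow> real" where
  "hole_cutoff j c1 c2 x =
     flat_exp (real j * ((norm (x - c1))\<^sup>2 - 1)) * flat_exp (real j * ((norm (x - c2))\<^sup>2 - 1))"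

definition hole_cutoff_deriv :: "nat \<Rightarrow> real^2 \<Rightarrow> real^2 \<Rightarrow> real^2 \<Rightarrow> real^2" where
  "hole_cutoff_deriv j c1 c2 x =
     (flat_exp_deriv 1 (real j * ((norm (x - c1))\<^sup>2 - 1)) *
        flat_exp (real j * ((norm (x - c2))\<^sup>2 - 1)) * (2 * real j)) *\<^sub>R (x - c1) +
     (flat_exp (real j * ((norm (x - c1))\<^sup>2 - 1)) *
        flat_exp_deriv 1 (real j * ((norm (x - c2))\<^sup>2 - 1)) * (2 * real j)) *\<^sub>R (x - c2)"

lemma hole_cutoff_has_partial:
  "((\<lambda>t. hole_cutoff j c1 c2 (x + t *\<^sub>R axis i 1)) has_real_derivative
     hole_cutoff_deriv j c1 c2 x $ i) (at 0)"
proof -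
  have sq: "((\<lambda>t. real j * ((norm (x + t *\<^sub>R axis i 1 - c))\<^sup>2 - 1)) has_real_derivative
          real j * (2 * (x - c) $ i)) (at 0)" for c :: "real^2"
  proof -
    have "(norm (x + t *\<^sub>R axis i 1 - c))\<^sup>2 = (norm (x - c))\<^sup>2 + 2 * t * (x - c) $ i + t\<^sup>2" for t
      unfolding power2_norm_eq_inner
      by (simp add: inner_axis inner_axis' inner_add inner_diff inner_commute algebra_simps power2_eq_square)
    then show ?thesis by (auto intro!: derivative_eq_intros)
  qed
  have f: "((\<lambda>t. flat_exp (real j * ((norm (x + t *\<^sub>R axis i 1 - c))\<^sup>2 - 1))) has_real_derivative
     flat_exp_deriv 1 (real j * ((norm (x - c))\<^sup>2 - 1)) * (real j * (2 * (x - c) $ i))) (at 0)" for c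
    by (rule DERIV_chain2[OF _ sq]) (use flat_exp_has_derivative in auto)
  show ?thesis
    unfolding hole_cutoff_def hole_cutoff_deriv_def
    by (rule DERIV_cong[OF DERIV_mult[OF f f]]) (simp add: algebra_simps)
qed

lemma continuous_on_hole_cutoff: "continuous_on UNIV (hole_cutoff j c1 c2)"
  unfolding hole_cutoff_def by (intro continuous_intros)

lemma continuous_on_hole_cutoff_deriv: "continuous_on UNIV (hole_cutoff_deriv j c1 c2)"
  unfolding hole_cutoff_deriv_def by (intro continuous_intros continuous_on_flat_exp_deriv)

lemma hole_cutoff_outside:
  assumes "x \<notin> perforated c1 c2"
  shows "hole_cutoff j c1 c2 x = 0" "hole_cutoff_deriv j c1 c2 x = 0"
proof -
  have "norm (x - c1) \<le> 1 \<or> norm (x - c2) \<le> 1" using assms by (auto simp: perforated_def)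
  then have "(norm (x - c1))\<^sup>2 - 1 \<le> 0 \<or> (norm (x - c2))\<^sup>2 - 1 \<le> 0"
    by (auto simp: power_le_one)
  then have "real j * ((norm (x - c1))\<^sup>2 - 1) \<le> 0 \<or> real j * ((norm (x - c2))\<^sup>2 - 1) \<le> 0"
    by (auto simp: mult_nonneg_nonpos)
  then show "hole_cutoff j c1 c2 x = 0" "hole_cutoff_deriv j c1 c2 x = 0"
    unfolding hole_cutoff_def hole_cutoff_deriv_def by (auto simp: flat_exp_deriv_1)
qed

lemma hole_cutoff_bounds: "0 \<le> hole_cutoff j c1 c2 x" "hole_cutoff j c1 c2 x \<le> 1"
  unfolding hole_cutoff_def by (auto intro: mult_le_one flat_exp_le_1)

lemma hole_cutoff_tendsto:
  "(\<lambda>j. hole_cutoff j c1 c2 x) \<longlonglongrightarrow> indicator (perforated c1 c2) x"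
proof (cases "x \<in> perforated c1 c2")
  case True
  have *: "(\<lambda>j. flat_exp (real j * a)) \<longlonglongrightarrow> 1" if "a > 0" for a
  proof -
    have "(\<lambda>j. exp (- (1 / real j) / a)) \<longlonglongrightarrow> exp (- 0 / a)"
      using that by (intro tendsto_intros lim_1_over_n) auto
    then have "(\<lambda>j. exp (- (1 / real j) / a)) \<longlonglongrightarrow> 1" by simp
    then show ?thesis
      by (rule Lim_transform_eventually)
         (use that in \<open>auto simp: flat_exp_def zero_less_mult_iff field_simps
            intro!: eventually_sequentiallyI[of 1]\<close>)
  qed
  have "(norm (x - c1))\<^sup>2 - 1 > 0" "(norm (x - c2))\<^sup>2 - 1 > 0"
    using True by (auto simp: perforated_def one_less_power)
  from tendsto_mult[OF this[THEN *]] show ?thesis using True by (simp add: hole_cutoff_def)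
next
  case False
  then show ?thesis by (simp add: hole_cutoff_outside)
qed

text \<open>A one-sided divergence theorem outside the discs. The divergence of
  \<open>\<phi>\<close> times the hole cutoff times \<open>X\<close> integrates to 0; its term with
  the gradient of the cutoff is nonnegative by \<open>out\<close>, and the term with the divergence
  of \<open>X\<close> is bounded below through \<open>d\<close>. Since that gradient lives off the
  discs, \<open>out\<close> is a condition on a region and not on the circles. Letting j tend to
  infinity replaces the cutoff by the indicator.\<close>

lemma integral_flux_le:
  fixes X :: "real^2 \<Rightarrow> real^2" and dX :: "2 \<Rightarrow> real^2 \<Rightarrow> real"
  assumes U: "open U" and \<phi>: "smooth_on UNIV \<phi>" "\<And>x. 0 \<le> \<phi> x"
    and K: "compact K" "K \<subseteq> U" "\<And>x. x \<notin> K \<Longrightarrow> \<phi> x = 0"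
    and X: "continuous_on U X" "\<And>i. continuous_on U (dX i)"
      "\<And>i x. x \<in> U \<Longrightarrow> ((\<lambda>t. X (x + t *\<^sub>R axis i 1) $ i) has_real_derivative dX i x) (at 0)"
    and d: "\<And>x. x \<in> U \<Longrightarrow> x \<in> perforated c1 c2 \<Longrightarrow> d \<le> dX 1 x + dX 2 x"
    and out: "\<And>x. x \<in> U \<Longrightarrow> x \<in> perforated c1 c2 \<Longrightarrow> 0 \<le> X x \<bullet> (x - c1) \<and> 0 \<le> X x \<bullet> (x - c2)"
  shows "continuous_on UNIV (\<lambda>x. X x \<bullet> grad \<phi> x)"
    and "integral\<^sup>L lborel (\<lambda>x. indicator (perforated c1 c2) x * (X x \<bullet> grad \<phi> x + d * \<phi> x)) \<le> 0"
proof -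
  note Kc = compact_imp_closed[OF K(1)]
  have p\<phi>: "((\<lambda>t. \<phi> (x + t *\<^sub>R axis i 1)) has_real_derivative partial_deriv i \<phi> x) (at 0)" for i x
    using smooth_on_has_partial_deriv[OF \<phi>(1)] by auto
  have cp\<phi>: "continuous_on UNIV (partial_deriv i \<phi>)" for i
    using smooth_on_partial_deriv[OF \<phi>(1)] smooth_on_imp_continuous_on by auto
  have c\<phi>: "continuous_on UNIV \<phi>" using \<phi>(1) smooth_on_imp_continuous_on by auto
  have p0: "partial_deriv i \<phi> x = 0" if "x \<notin> K" for i x
    by (rule partial_derivI, rule has_partial_cong_open[of "- K" _ _ "\<lambda>_. 0"]) (use that K Kc in auto)
  have g0: "grad \<phi> x = 0" if "x \<notin> K" for x
    using p0 that by (simp add: vec_eq_iff)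
  have cg: "continuous_on U (grad \<phi>)"
    using continuous_on_grad[OF \<phi>(1)] continuous_on_subset by auto
  show cXg: "continuous_on UNIV (\<lambda>x. X x \<bullet> grad \<phi> x)"
    by (rule continuous_on_zero_extension[OF U Kc K(2)])
       (use X cg g0 in \<open>auto intro!: continuous_intros\<close>)
  define F where "F x = X x \<bullet> grad \<phi> x + d * \<phi> x" for x
  have cF: "continuous_on UNIV F"
    unfolding F_def by (intro continuous_on_add continuous_on_mult continuous_on_const cXg c\<phi>)
  have F0: "F x = 0" if "x \<notin> K" for x using g0 K(3) that by (simp add: F_def)
  have iF: "integrable lborel F" using integrable_compact_support[OF cF K(1) F0] .
  have [measurable]: "F \<in> borel_measurable borel" using cF by (rule borel_measurable_continuous_onI)
  have [measurable]: "hole_cutoff j c1 c2 \<in> borel_measurable borel" for j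
    using continuous_on_hole_cutoff by (rule borel_measurable_continuous_onI)
  have [measurable]: "perforated c1 c2 \<in> sets borel" using open_perforated by auto
  have neg: "integral\<^sup>L lborel (\<lambda>x. hole_cutoff j c1 c2 x * F x) \<le> 0" for j
  proof -
    let ?c = "hole_cutoff j c1 c2" and ?c' = "hole_cutoff_deriv j c1 c2"
    define h where "h i x = \<phi> x * ?c x * X x $ i" for i x
    define h' where "h' i x = (if x \<in> K then partial_deriv i \<phi> x * ?c x * X x $ i +
        \<phi> x * ?c' x $ i * X x $ i + \<phi> x * ?c x * dX i x else 0)" for i x
    have h'U: "h' i x = partial_deriv i \<phi> x * ?c x * X x $ i +
        \<phi> x * ?c' x $ i * X x $ i + \<phi> x * ?c x * dX i x" for i x
      using p0 K(3) by (simp add: h'_def)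
    have cX: "continuous_on U (\<lambda>x. X x $ i)" for i using X(1) by (intro continuous_intros)
    have cc: "continuous_on U ?c" "continuous_on U (\<lambda>x. ?c' x $ i)" for i
      by (intro continuous_intros continuous_on_subset[OF continuous_on_hole_cutoff]
          continuous_on_subset[OF continuous_on_hole_cutoff_deriv] subset_UNIV)+
    have cU: "continuous_on U \<phi>" "continuous_on U (partial_deriv i \<phi>)" for i
      using c\<phi> cp\<phi> by (auto intro: continuous_on_subset)
    have 1: "continuous_on UNIV (h i)" for i
    proof (rule continuous_on_zero_extension[OF U Kc K(2)])
      show "continuous_on U (h i)"
        unfolding h_def[abs_def] by (intro continuous_on_mult cX cc cU)
    qed (use K(3) in \<open>simp add: h_def\<close>)
    have 2: "continuous_on UNIV (h' i)" for i
    proof (rule continuous_on_zero_extension[OF U Kc K(2)])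
      show "continuous_on U (h' i)"
        unfolding h'U[abs_def] by (intro continuous_intros cX cc cU X)
    qed (simp add: h'_def)
    have 3: "((\<lambda>t. h i (x + t *\<^sub>R axis i 1)) has_real_derivative h' i x) (at 0)" for i x
    proof (cases "x \<in> K")
      case True
      then have "x \<in> U" using K by auto
      have "((\<lambda>t. \<phi> (x + t *\<^sub>R axis i 1) * ?c (x + t *\<^sub>R axis i 1) * X (x + t *\<^sub>R axis i 1) $ i)
          has_real_derivative h' i x) (at 0)"
        by (rule DERIV_cong[OF DERIV_mult[OF DERIV_mult[OF p\<phi> hole_cutoff_has_partial] X(3)[OF \<open>x \<in> U\<close>]]])
           (simp add: h'U algebra_simps)
      then show ?thesis by (simp add: h_def)
    next
      case False
      show ?thesis
        by (rule has_partial_cong_open[of "- K" _ _ "\<lambda>_. 0"]) (use False Kc K(3) in \<open>auto simp: h_def h'_def\<close>)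
    qed
    have 4: "h i x = 0" if "x \<notin> K" for i x using K(3) that by (simp add: h_def)
    note I = integral_partial_eq_0[OF 3 1 2 K(1) 4, simplified]
    have "integral\<^sup>L lborel (\<lambda>x. h' 1 x + h' 2 x) = 0" using I[of 1] I[of 2] by simp
    moreover have "integral\<^sup>L lborel (\<lambda>x. ?c x * F x) \<le> integral\<^sup>L lborel (\<lambda>x. h' 1 x + h' 2 x)"
    proof (rule integral_mono)
      show "integrable lborel (\<lambda>x. ?c x * F x)"
        by (rule integrable_compact_support[OF _ K(1)])
           (use cF continuous_on_hole_cutoff F0 in \<open>auto intro!: continuous_intros\<close>)
      show "integrable lborel (\<lambda>x. h' 1 x + h' 2 x)" using I[of 1] I[of 2] by simp
      fix x
      have "h' 1 x + h' 2 x - ?c x * F x = \<phi> x * (X x \<bullet> ?c' x + ?c x * (dX 1 x + dX 2 x - d))"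
        by (simp add: h'U F_def inner_vec_def UNIV_2 algebra_simps)
      moreover have "\<dots> \<ge> 0"
      proof (cases "x \<in> U \<and> x \<in> perforated c1 c2")
        case True
        have "X x \<bullet> ?c' x \<ge> 0"
          using out[of x] True flat_exp_deriv_1_nonneg
          by (auto simp: hole_cutoff_deriv_def inner_add_right)
        moreover have "?c x * (dX 1 x + dX 2 x - d) \<ge> 0"
          using d[of x] True hole_cutoff_bounds by simp
        ultimately show ?thesis using \<phi>(2) by simp
      next
        case False
        then have "\<phi> x = 0 \<or> x \<notin> perforated c1 c2" using K by blast
        then show ?thesis using hole_cutoff_outside by auto
      qed
      ultimately show "?c x * F x \<le> h' 1 x + h' 2 x" by linarith
    qed
    ultimately show ?thesis by simp
  qed
  have "(\<lambda>j. integral\<^sup>L lborel (\<lambda>x. hole_cutoff j c1 c2 x * F x)) \<longlonglongrightarrow>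
      integral\<^sup>L lborel (\<lambda>x. indicator (perforated c1 c2) x * F x)"
  proof (rule integral_dominated_convergence[where w = "\<lambda>x. norm (F x)"])
    show "AE x in lborel. (\<lambda>j. hole_cutoff j c1 c2 x * F x) \<longlonglongrightarrow> indicator (perforated c1 c2) x * F x"
      by (intro AE_I2 tendsto_mult hole_cutoff_tendsto tendsto_const)
    show "AE x in lborel. norm (hole_cutoff j c1 c2 x * F x) \<le> norm (F x)" for j
      using hole_cutoff_bounds by (intro AE_I2) (auto simp: abs_mult intro!: mult_left_le_one_le)
  qed (use iF in auto)
  then show "integral\<^sup>L lborel (\<lambda>x. indicator (perforated c1 c2) x * (X x \<bullet> grad \<phi> x + d * \<phi> x)) \<le> 0"
    unfolding F_def[symmetric] by (rule LIMSEQ_le_const2) (use neg in auto)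
qed

section \<open>The p-Laplacian flux and reflection\<close>

text \<open>As \<open>0 powr a = 0\<close> for every exponent, the flux vanishes at 0 for all p,
  including 1 < p < 2.\<close>

definition pflux :: "real \<Rightarrow> real^2 \<Rightarrow> real^2" where
  "pflux p x = norm x powr (p - 2) *\<^sub>R x"

lemma norm_pflux: "norm (pflux p x) = norm x powr (p - 1)"
  using powr_mult_base[of "norm x" "p - 2"] by (simp add: pflux_def mult.commute)

lemma pflux_inner_self: "pflux p x \<bullet> x = norm x powr p"
  using powr_mult_base[of "norm x" "p - 2"] powr_mult_base[of "norm x" "p - 1"]
  by (simp add: pflux_def dot_square_norm power2_eq_square mult_ac)

text \<open>Cauchy-Schwarz bounds the two mixed terms and the rest factors. The product on the left
  is nonnegative because powers are increasing, so monotonicity and its strict form follow for p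
  below and above 2 at once.\<close>

lemma pflux_diff_inner_ge:
  assumes "p > 1"
  shows "(norm x powr (p - 1) - norm y powr (p - 1)) * (norm x - norm y)
           \<le> (pflux p x - pflux p y) \<bullet> (x - y)"
proof -
  have 1: "pflux p x \<bullet> y \<le> norm x powr (p - 1) * norm y" for x y :: "real^2"
    using norm_cauchy_schwarz[of "pflux p x" y] by (simp add: norm_pflux)
  have 2: "norm x powr p = norm x powr (p - 1) * norm x" for x :: "real^2"
    using powr_mult_base[of "norm x" "p - 1"] by (simp add: mult.commute)
  have "(pflux p x - pflux p y) \<bullet> (x - y) =
      norm x powr p + norm y powr p - pflux p x \<bullet> y - pflux p y \<bullet> x"
    by (simp add: inner_diff pflux_inner_self)
  with 1[of x y] 1[of y x] show ?thesis by (simp add: 2 algebra_simps)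
qed

lemma powr_diff_mult_nonneg:
  assumes "a > 0" "x \<ge> 0" "y \<ge> (0::real)"
  shows "(x powr a - y powr a) * (x - y) \<ge> 0" "(x powr a - y powr a) * (x - y) = 0 \<Longrightarrow> x = y"
  using assms powr_less_mono2[of a x y] powr_less_mono2[of a y x]
  by (cases x y rule: linorder_cases; auto simp: mult_nonpos_nonpos)+

lemma pflux_monotone:
  assumes "p > 1" shows "0 \<le> (pflux p x - pflux p y) \<bullet> (x - y)"
  using pflux_diff_inner_ge[OF assms, of x y] powr_diff_mult_nonneg(1)[of "p - 1" "norm x" "norm y"] assms
  by auto

lemma pflux_strictly_monotone:
  assumes "p > 1" "(pflux p x - pflux p y) \<bullet> (x - y) = 0"
  shows "x = y"
proof -
  have "(norm x powr (p - 1) - norm y powr (p - 1)) * (norm x - norm y) = 0"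
    using pflux_diff_inner_ge[OF assms(1), of x y]
      powr_diff_mult_nonneg(1)[of "p - 1" "norm x" "norm y"] assms by auto
  then have n: "norm x = norm y"
    using powr_diff_mult_nonneg(2)[of "p - 1" "norm x" "norm y"] assms by auto
  \<comment> \<open>With equal norms the pairing is |x|^(p-2) |x-y|^2; if the first factor is 0,
    both vectors are 0.\<close>
  then have "pflux p x - pflux p y = norm x powr (p - 2) *\<^sub>R (x - y)"
    by (simp add: pflux_def scaleR_diff_right)
  then have "norm x powr (p - 2) * (norm (x - y))\<^sup>2 = 0"
    using assms(2) by (simp add: power2_norm_eq_inner)
  then show ?thesis using n by auto
qed

lemma pflux_measurable [measurable (raw)]:
  "f \<in> borel_measurable M \<Longrightarrow> (\<lambda>x. pflux p (f x)) \<in> borel_measurable M"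
  unfolding pflux_def by measurable

text \<open>Young's inequality with a free weight and crude constants: depending on whether b <= eta
  a, one of the two terms alone dominates the product.\<close>

lemma powr_mult_le_scaled:
  fixes a b :: real
  assumes "p > 1" "a \<ge> 0" "b \<ge> 0" "\<eta> > 0"
  shows "a powr (p - 1) * b \<le> \<eta> * a powr p + \<eta> powr (1 - p) * b powr p"
proof (cases "b \<le> \<eta> * a")
  case True
  then have "a powr (p - 1) * b \<le> a powr (p - 1) * (\<eta> * a)" by (intro mult_left_mono) auto
  also have "\<dots> = \<eta> * a powr p"
    using powr_mult_base[of a "p - 1"] assms by (simp add: mult_ac)
  finally show ?thesis by (smt (verit) mult_nonneg_nonneg powr_ge_zero)
next
  case False
  then have "a powr (p - 1) * b \<le> (b / \<eta>) powr (p - 1) * b"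
    using assms by (intro mult_right_mono powr_mono2) (auto simp: field_simps)
  also have "\<dots> = \<eta> powr (1 - p) * b powr p"
    using powr_mult_base[of b "p - 1"] assms powr_minus_divide[of \<eta> "p - 1"]
    by (simp add: powr_divide mult_ac)
  finally show ?thesis using assms by (smt (verit) mult_nonneg_nonneg powr_ge_zero)
qed

text \<open>This plays the role of Hoelder's inequality.\<close>
lemma integral_powr_mult_tendsto_0:
  fixes a :: "'a \<Rightarrow> real" and b :: "nat \<Rightarrow> 'a \<Rightarrow> real"
  assumes p: "p > 1" and a: "a \<in> borel_measurable M" "\<And>x. a x \<ge> 0" "integrable M (\<lambda>x. a x powr p)"
    and b: "\<And>k. b k \<in> borel_measurable M" "\<And>k x. b k x \<ge> 0" "\<And>k. integrable M (\<lambda>x. b k x powr p)"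
  shows "\<And>k. integrable M (\<lambda>x. a x powr (p - 1) * b k x)"
    and "(\<lambda>k. integral\<^sup>L M (\<lambda>x. b k x powr p)) \<longlonglongrightarrow> 0 \<Longrightarrow>
         (\<lambda>k. integral\<^sup>L M (\<lambda>x. a x powr (p - 1) * b k x)) \<longlonglongrightarrow> 0"
proof -
  note [measurable] = a(1) b(1)
  show i: "integrable M (\<lambda>x. a x powr (p - 1) * b k x)" for k
  proof (rule Bochner_Integration.integrable_bound)
    show "integrable M (\<lambda>x. 1 * a x powr p + 1 powr (1 - p) * b k x powr p)"
      using a(3) b(3)[of k] by auto
    show "AE x in M. norm (a x powr (p - 1) * b k x) \<le> norm (1 * a x powr p + 1 powr (1 - p) * b k x powr p)"
      using powr_mult_le_scaled[OF p a(2) b(2), of 1] b(2) by (intro AE_I2) (simp add: abs_mult)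
  qed measurable
  assume lim: "(\<lambda>k. integral\<^sup>L M (\<lambda>x. b k x powr p)) \<longlonglongrightarrow> 0"
  define A where "A = integral\<^sup>L M (\<lambda>x. a x powr p)"
  have A0: "A \<ge> 0" unfolding A_def by (rule Bochner_Integration.integral_nonneg) auto
  show "(\<lambda>k. integral\<^sup>L M (\<lambda>x. a x powr (p - 1) * b k x)) \<longlonglongrightarrow> 0"
  proof (rule LIMSEQ_I)
    fix r :: real assume r: "r > 0"
    \<comment> \<open>Keeps the first Young term below r/2 whatever k is; A + 1 guards against A =
      0. The second term then tends to 0 for this fixed weight.\<close>
    define \<eta> where "\<eta> = r / (2 * (A + 1))"
    have \<eta>: "\<eta> > 0" "\<eta> * A < r / 2" using r A0 by (auto simp: \<eta>_def field_simps)
    have "(\<lambda>k. \<eta> * A + \<eta> powr (1 - p) * integral\<^sup>L M (\<lambda>x. b k x powr p)) \<longlonglongrightarrow> \<eta> * A + \<eta> powr (1 - p) * 0"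
      by (intro tendsto_intros lim)
    then have "eventually (\<lambda>k. \<eta> * A + \<eta> powr (1 - p) * integral\<^sup>L M (\<lambda>x. b k x powr p) < r) sequentially"
      by (rule order_tendstoD(2)) (use \<eta> r in auto)
    then have "eventually (\<lambda>k. norm (integral\<^sup>L M (\<lambda>x. a x powr (p - 1) * b k x) - 0) < r) sequentially"
    proof eventually_elim
      case (elim k)
      have "integral\<^sup>L M (\<lambda>x. a x powr (p - 1) * b k x)
          \<le> integral\<^sup>L M (\<lambda>x. \<eta> * a x powr p + \<eta> powr (1 - p) * b k x powr p)"
        by (rule integral_mono[OF i]) (use a b \<eta> powr_mult_le_scaled[OF p] in auto)
      also have "\<dots> = \<eta> * A + \<eta> powr (1 - p) * integral\<^sup>L M (\<lambda>x. b k x powr p)"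
        unfolding A_def using a(3) b(3) by simp
      finally show ?case
        using elim Bochner_Integration.integral_nonneg[of M "\<lambda>x. a x powr (p - 1) * b k x"] b(2) by simp
    qed
    then show "\<exists>no. \<forall>n\<ge>no. norm (integral\<^sup>L M (\<lambda>x. a x powr (p - 1) * b n x) - 0) < r"
      by (simp add: eventually_sequentially)
  qed
qed

text \<open>Half the difference is no longer than the longer of the two vectors, which gives
  constant 1 for every p > 0.\<close>

lemma norm_half_diff_powr_le:
  fixes a b :: "'a::real_normed_vector"
  assumes "p > 0"
  shows "norm ((1/2) *\<^sub>R (a - b)) powr p \<le> norm a powr p + norm b powr p"
proof -
  have "norm ((1/2) *\<^sub>R (a - b)) \<le> max (norm a) (norm b)"
    using norm_triangle_ineq4[of a b] by simp
  then have "norm ((1/2) *\<^sub>R (a - b)) powr p \<le> max (norm a) (norm b) powr p"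
    using assms by (intro powr_mono2) auto
  also have "\<dots> \<le> norm a powr p + norm b powr p" by (auto simp: max_def)
  finally show ?thesis .
qed

lemma integrable_norm_half_diff_powr:
  fixes f h :: "'a \<Rightarrow> 'b::{real_normed_vector, second_countable_topology}"
  assumes "p > 0" "f \<in> borel_measurable M" "h \<in> borel_measurable M"
    "integrable M (\<lambda>x. norm (f x) powr p)" "integrable M (\<lambda>x. norm (h x) powr p)"
  shows "integrable M (\<lambda>x. norm ((1/2) *\<^sub>R (f x - h x)) powr p)"
proof (rule Bochner_Integration.integrable_bound)
  show "integrable M (\<lambda>x. norm (f x) powr p + norm (h x) powr p)" using assms by auto
  show "AE x in M. norm (norm ((1/2) *\<^sub>R (f x - h x)) powr p) \<le> norm (norm (f x) powr p + norm (h x) powr p)"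
    using norm_half_diff_powr_le[OF assms(1)] by (intro AE_I2) (auto simp del: norm_scaleR)
qed (use assms(2,3) in measurable)

lemma integrable_norm_diff_powr:
  fixes f h :: "'a \<Rightarrow> 'b::{real_normed_vector, second_countable_topology}"
  assumes "p > 0" "f \<in> borel_measurable M" "h \<in> borel_measurable M"
    "integrable M (\<lambda>x. norm (f x) powr p)" "integrable M (\<lambda>x. norm (h x) powr p)"
  shows "integrable M (\<lambda>x. norm (f x - h x) powr p)"
proof -
  have "norm (f x - h x) powr p = 2 powr p * norm ((1/2) *\<^sub>R (f x - h x)) powr p" for x
    by (subst powr_mult[symmetric]) auto
  then show ?thesis using integrable_norm_half_diff_powr[OF assms] by simp
qed

section \<open>Reflection in the line x_1 = 0\<close>

definition mirror :: "real^2 \<Rightarrow> real^2" where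
  "mirror x = (\<chi> i. if i = 1 then - x $ i else x $ i)"

lemma mirror_nth: "mirror x $ 1 = - x $ 1" "mirror x $ 2 = x $ 2"
  by (auto simp: mirror_def)

lemma mirror_mirror [simp]: "mirror (mirror x) = x"
  by (simp add: vec_eq_iff forall_2 mirror_nth)

lemma mirror_linear_simps:
  "mirror (x + y) = mirror x + mirror y" "mirror (x - y) = mirror x - mirror y"
  "mirror (c *\<^sub>R x) = c *\<^sub>R mirror x" "mirror (- x) = - mirror x"
  by (auto simp: vec_eq_iff forall_2 mirror_nth)

lemma inner_mirror: "mirror x \<bullet> y = x \<bullet> mirror y"
  by (simp add: inner_vec_def UNIV_2 mirror_nth)

lemma norm_mirror [simp]: "norm (mirror x) = norm x"
  by (simp add: norm_eq_sqrt_inner inner_mirror)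

lemma mirror_axis: "mirror (axis i 1) = (if i = 1 then - axis i 1 else axis i 1)"
  by (auto simp: vec_eq_iff mirror_def axis_def)

lemma pflux_mirror: "pflux p (mirror x) = mirror (pflux p x)" "pflux p (- x) = - pflux p x"
  by (auto simp: pflux_def mirror_linear_simps)

lemma continuous_on_mirror [continuous_intros]:
  "continuous_on A f \<Longrightarrow> continuous_on A (\<lambda>x. mirror (f x))"
  unfolding mirror_def
  by (intro continuous_on_vec_lambda, rename_tac i, case_tac "i = 1") (auto intro!: continuous_intros)

lemma mirror_measurable [measurable (raw)]:
  assumes "f \<in> borel_measurable M" shows "(\<lambda>x. mirror (f x)) \<in> borel_measurable M"
proof -
  have "mirror \<in> borel_measurable borel"
    by (rule borel_measurable_continuous_onI) (intro continuous_intros)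
  from measurable_compose[OF assms this] show ?thesis .
qed

lemma smooth_on_mirror:
  assumes "smooth_on UNIV f" shows "smooth_on UNIV (\<lambda>x. f (mirror x))"
proof -
  obtain D where D: "D [] = f"
    "\<And>\<alpha> i x. ((\<lambda>t. D \<alpha> (x + t *\<^sub>R axis i 1)) has_real_derivative D (i # \<alpha>) x) (at 0)"
    "\<And>\<alpha>. continuous_on UNIV (D \<alpha>)"
    using assms unfolding smooth_on_def by blast
  show ?thesis
  proof (rule smooth_onI[where S = "{h. \<exists>c \<alpha>. h = (\<lambda>x. c * D \<alpha> (mirror x))}"], goal_cases)
    case 1
    then show ?case using D(1) by (auto intro!: exI[of _ 1] exI[of _ "[]"])
  next
    case (2 h)
    then show ?case
      by (auto intro!: continuous_intros continuous_on_compose2[OF D(3)])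
  next
    case (3 h i)
    then obtain c \<alpha> where h: "h = (\<lambda>x. c * D \<alpha> (mirror x))" by blast
    define s where "s = (if i = 1 then -1 else 1::real)"
    have "((\<lambda>t. h (x + t *\<^sub>R axis i 1)) has_real_derivative (c * s) * D (i # \<alpha>) (mirror x)) (at 0)" for x
    proof -
      have "((\<lambda>t. D \<alpha> (mirror x + (s * t) *\<^sub>R axis i 1)) has_real_derivative D (i # \<alpha>) (mirror x) * s) (at 0)"
        by (rule DERIV_chain2[where f = "\<lambda>t. D \<alpha> (mirror x + t *\<^sub>R axis i 1)" and g = "\<lambda>t. s * t"])
           (use D(2)[of \<alpha> "mirror x" i] in \<open>auto intro!: derivative_eq_intros\<close>)
      from DERIV_cmult[OF this, of c] show ?thesis
        by (auto simp: h mirror_linear_simps mirror_axis s_def mult_ac)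
    qed
    then show ?case
      by (intro bexI[of _ "\<lambda>x. (c * s) * D (i # \<alpha>) (mirror x)"]) auto
  qed
qed

lemma grad_mirror:
  assumes "smooth_on UNIV f"
  shows "grad (\<lambda>x. f (mirror x)) x = mirror (grad f (mirror x))"
proof -
  have "partial_deriv i (\<lambda>x. f (mirror x)) x = (if i = 1 then -1 else 1) * partial_deriv i f (mirror x)" for i
  proof (rule partial_derivI)
    define s where "s = (if i = 1 then -1 else 1::real)"
    have "((\<lambda>t. f (mirror x + (s * t) *\<^sub>R axis i 1)) has_real_derivative partial_deriv i f (mirror x) * s) (at 0)"
      by (rule DERIV_chain2[where f = "\<lambda>t. f (mirror x + t *\<^sub>R axis i 1)" and g = "\<lambda>t. s * t"])
         (use smooth_on_has_partial_deriv[OF assms, of "mirror x" i] in \<open>auto intro!: derivative_eq_intros\<close>)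
    then show "((\<lambda>t. f (mirror (x + t *\<^sub>R axis i 1))) has_real_derivative
       (if i = 1 then -1 else 1) * partial_deriv i f (mirror x)) (at 0)"
      by (auto simp: mirror_linear_simps mirror_axis s_def mult_ac)
  qed
  then show ?thesis by (simp add: vec_eq_iff mirror_def)
qed

text \<open>The reflection is diagonal in the standard basis with entries -1 and 1, so the Jacobian
  factor of the affine change of variables is 1.\<close>

lemma mirror_measure_preserving:
  shows mirror_lebesgue_measurable: "mirror \<in> lebesgue \<rightarrow>\<^sub>M lebesgue"
    and distr_lebesgue_mirror: "distr lebesgue lebesgue mirror = lebesgue"
proof -
  define c :: "real^2 \<Rightarrow> real" where "c j = (if j = axis 1 1 then -1 else 1)" for j
  have eq: "mirror = (\<lambda>x. 0 + (\<Sum>j\<in>Basis. (c j * (x \<bullet> j)) *\<^sub>R j))"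
  proof
    fix x :: "real^2"
    have B: "Basis = {axis 1 1, axis 2 1 :: real^2}"
      unfolding Basis_vec_def by (auto simp: UNIV_2)
    have ne: "axis 1 1 \<noteq> (axis 2 1 :: real^2)" by (simp add: axis_eq_axis)
    have "(\<Sum>j\<in>Basis. (c j * (x \<bullet> j)) *\<^sub>R j) = (- x $ 1) *\<^sub>R axis 1 1 + (x $ 2) *\<^sub>R axis 2 1"
      using ne by (simp add: B c_def inner_axis)
    then show "mirror x = 0 + (\<Sum>j\<in>Basis. (c j * (x \<bullet> j)) *\<^sub>R j)"
      by (simp add: vec_eq_iff forall_2 mirror_nth axis_def)
  qed
  have c0: "c j \<noteq> 0" "\<bar>c j\<bar> = 1" for j by (auto simp: c_def)
  have "lebesgue = density (distr lebesgue lebesgue mirror) (\<lambda>_. ennreal (\<Prod>j\<in>(Basis::(real^2) set). \<bar>c j\<bar>))"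
    unfolding eq using lebesgue_affine_euclidean[of c 0] c0 by simp
  then show "distr lebesgue lebesgue mirror = lebesgue" by (simp add: c0 density_1)
  show "mirror \<in> lebesgue \<rightarrow>\<^sub>M lebesgue"
    unfolding eq using lebesgue_affine_measurable[of c 0] c0 by simp
qed

section \<open>Reduction to odd solutions\<close>

abbreviation upper_center :: "real \<Rightarrow> real^2" where "upper_center \<epsilon> \<equiv> vector [0, 1 + \<epsilon>/2]"
abbreviation lower_center :: "real \<Rightarrow> real^2" where "lower_center \<epsilon> \<equiv> vector [0, -1 - \<epsilon>/2]"

section \<open>The domain, its symmetry and test functions\<close>

lemma Omega_t_eq: "Omega_t \<epsilon> = ball 0 5 \<inter> perforated (upper_center \<epsilon>) (lower_center \<epsilon>)"
  unfolding Omega_t_def incl1_def incl2_def closure_Un perforated_def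
  by (auto simp: dist_norm norm_minus_commute)

lemma open_Omega_t: "open (Omega_t \<epsilon>)"
  unfolding Omega_t_eq using open_perforated by auto

lemma lmeasurable_Omega_t: "Omega_t \<epsilon> \<in> lmeasurable"
  using open_Omega_t by (intro bounded_set_imp_lmeasurable) (auto simp: Omega_t_eq intro: bounded_subset)

lemma mirror_in_Omega_t_iff [simp]: "mirror x \<in> Omega_t \<epsilon> \<longleftrightarrow> x \<in> Omega_t \<epsilon>"
proof -
  have "mirror (upper_center \<epsilon>) = upper_center \<epsilon>" "mirror (lower_center \<epsilon>) = lower_center \<epsilon>"
    by (simp_all add: vec_eq_iff forall_2 mirror_nth)
  then have "norm (mirror x - upper_center \<epsilon>) = norm (x - upper_center \<epsilon>)"
    "norm (mirror x - lower_center \<epsilon>) = norm (x - lower_center \<epsilon>)"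
    by (metis mirror_linear_simps(2) norm_mirror)+
  then show ?thesis by (simp add: Omega_t_eq perforated_def)
qed

lemma distr_lebesgue_on_mirror:
  "distr (lebesgue_on (Omega_t \<epsilon>)) (lebesgue_on (Omega_t \<epsilon>)) mirror = lebesgue_on (Omega_t \<epsilon>)"
  and mirror_measurable_lebesgue_on: "mirror \<in> lebesgue_on (Omega_t \<epsilon>) \<rightarrow>\<^sub>M lebesgue_on (Omega_t \<epsilon>)"
proof -
  let ?O = "Omega_t \<epsilon>"
  have O: "?O \<in> sets lebesgue" using lmeasurable_Omega_t by (rule fmeasurableD)
  show m: "mirror \<in> lebesgue_on ?O \<rightarrow>\<^sub>M lebesgue_on ?O"
    by (rule measurable_restrict_space2)
       (auto intro: measurable_restrict_space1 mirror_lebesgue_measurable)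
  show "distr (lebesgue_on ?O) (lebesgue_on ?O) mirror = lebesgue_on ?O"
  proof (rule measure_eqI)
    fix A assume "A \<in> sets (distr (lebesgue_on ?O) (lebesgue_on ?O) mirror)"
    then have A: "A \<in> sets lebesgue" "A \<subseteq> ?O"
      using O by (auto simp: sets_restrict_space_iff)
    have e: "mirror -` A \<inter> ?O = mirror -` A" using A(2) mirror_in_Omega_t_iff by auto
    have "emeasure (distr (lebesgue_on ?O) (lebesgue_on ?O) mirror) A = emeasure (lebesgue_on ?O) (mirror -` A)"
      using A O m by (subst emeasure_distr) (auto simp: sets_restrict_space_iff e)
    also have "\<dots> = emeasure lebesgue (mirror -` A)"
      using A(2) O by (subst emeasure_restrict_space) (auto dest: mirror_in_Omega_t_iff[THEN iffD1, OF subsetD[OF A(2)]])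
    also have "\<dots> = emeasure (distr lebesgue lebesgue mirror) A"
      using A by (subst emeasure_distr) (auto intro: mirror_lebesgue_measurable)
    also have "\<dots> = emeasure (lebesgue_on ?O) A"
      using A O by (simp add: distr_lebesgue_mirror emeasure_restrict_space)
    finally show "emeasure (distr (lebesgue_on ?O) (lebesgue_on ?O) mirror) A = emeasure (lebesgue_on ?O) A" .
  qed simp
qed

lemma integral_mirror:
  fixes f :: "real^2 \<Rightarrow> real"
  assumes "f \<in> borel_measurable (lebesgue_on (Omega_t \<epsilon>))"
  shows "integral\<^sup>L (lebesgue_on (Omega_t \<epsilon>)) (\<lambda>x. f (mirror x)) = integral\<^sup>L (lebesgue_on (Omega_t \<epsilon>)) f"
    and "integrable (lebesgue_on (Omega_t \<epsilon>)) (\<lambda>x. f (mirror x)) = integrable (lebesgue_on (Omega_t \<epsilon>)) f"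
  using integral_distr[OF mirror_measurable_lebesgue_on assms]
    integrable_distr_eq[OF mirror_measurable_lebesgue_on assms]
  by (simp_all add: distr_lebesgue_on_mirror)

lemma measurable_mirror_comp:
  assumes "f \<in> borel_measurable (lebesgue_on (Omega_t \<epsilon>))"
  shows "(\<lambda>x. f (mirror x)) \<in> borel_measurable (lebesgue_on (Omega_t \<epsilon>))"
  by (rule measurable_compose[OF mirror_measurable_lebesgue_on assms])

lemma measurable_lebesgue_on_Omega:
  fixes f :: "real^2 \<Rightarrow> 'b::{second_countable_topology, metric_space}"
  assumes "continuous_on UNIV f"
  shows "f \<in> borel_measurable (lebesgue_on S)"
  using borel_measurable_continuous_onI[OF assms]
  by (auto intro!: measurable_restrict_space1 measurable_completion)

lemma test_fun_smooth: "test_fun U \<phi> \<Longrightarrow> smooth_on UNIV \<phi>"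
  by (simp add: test_fun_def smooth2_iff_smooth_on)

lemma test_funI:
  assumes "smooth_on UNIV \<phi>" "compact K" "K \<subseteq> U" "\<And>x. x \<notin> K \<Longrightarrow> \<phi> x = 0"
  shows "test_fun U \<phi>"
proof -
  have "tsupport \<phi> \<subseteq> K"
    unfolding tsupport_def using assms by (intro closure_minimal) (auto simp: compact_imp_closed)
  moreover have "compact (tsupport \<phi>)"
    using compact_Int_closed[OF assms(2), of "tsupport \<phi>"] calculation
    by (simp add: tsupport_def Int_absorb1)
  ultimately show ?thesis
    using assms unfolding test_fun_def smooth2_iff_smooth_on by auto
qed

lemma test_fun_support:
  assumes "test_fun U \<phi>"
  obtains K where "compact K" "K \<subseteq> U" "\<And>x. x \<notin> K \<Longrightarrow> \<phi> x = 0"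
proof
  show "compact (tsupport \<phi>)" "tsupport \<phi> \<subseteq> U" using assms by (auto simp: test_fun_def)
  show "\<phi> x = 0" if "x \<notin> tsupport \<phi>" for x
    using that closure_subset[of "{x. \<phi> x \<noteq> 0}"] by (auto simp: tsupport_def)
qed

lemma test_fun_linear:
  assumes "test_fun U \<phi>" "test_fun U \<psi>"
  shows "test_fun U (\<lambda>x. a * \<phi> x + b * \<psi> x)"
proof -
  obtain K where K: "compact K" "K \<subseteq> U" "\<And>x. x \<notin> K \<Longrightarrow> \<phi> x = 0"
    using test_fun_support[OF assms(1)] by blast
  obtain L where L: "compact L" "L \<subseteq> U" "\<And>x. x \<notin> L \<Longrightarrow> \<psi> x = 0"
    using test_fun_support[OF assms(2)] by blast
  show ?thesis
    by (rule test_funI[where K = "K \<union> L"])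
       (use K L in \<open>auto intro!: smooth_on_add smooth_on_mult smooth_on_const assms[THEN test_fun_smooth]\<close>)
qed

lemma grad_linear:
  assumes "smooth_on U \<phi>" "smooth_on U \<psi>" "x \<in> U"
  shows "grad (\<lambda>x. a * \<phi> x + b * \<psi> x) x = a *\<^sub>R grad \<phi> x + b *\<^sub>R grad \<psi> x"
  using smooth_on_has_partial_deriv[OF assms(1,3)] smooth_on_has_partial_deriv[OF assms(2,3)]
  by (auto simp: vec_eq_iff intro!: partial_derivI DERIV_add DERIV_cmult)

lemma test_fun_mirror:
  assumes "test_fun (ball 0 r) \<phi>"
  shows "test_fun (ball 0 r) (\<lambda>x. \<phi> (mirror x))"
proof -
  obtain K where K: "compact K" "K \<subseteq> ball 0 r" "\<And>x. x \<notin> K \<Longrightarrow> \<phi> x = 0"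
    using test_fun_support[OF assms] by blast
  show ?thesis
  proof (rule test_funI[where K = "mirror ` K"])
    show "compact (mirror ` K)"
      by (intro compact_continuous_image K continuous_intros)
    show "mirror ` K \<subseteq> ball 0 r" using K(2) by auto
    show "\<phi> (mirror x) = 0" if "x \<notin> mirror ` K" for x
      using that K(3) by (metis imageI mirror_mirror)
  qed (rule smooth_on_mirror[OF test_fun_smooth[OF assms]])
qed

lemma integrable_test_fun_powr:
  fixes f :: "real^2 \<Rightarrow> 'b::{second_countable_topology, real_normed_vector}"
  assumes "continuous_on UNIV f" "p > 0"
  shows "integrable (lebesgue_on (Omega_t \<epsilon>)) (\<lambda>x. norm (f x) powr p)"
proof -
  interpret finite_measure "lebesgue_on (Omega_t \<epsilon>)"
    using lmeasurable_Omega_t by (rule finite_measure_lebesgue_on)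
  have "bounded (f ` cball 0 5)"
    using assms by (intro compact_imp_bounded compact_continuous_image) (auto intro: continuous_on_subset)
  then obtain B where B: "\<And>x. x \<in> cball 0 5 \<Longrightarrow> norm (f x) \<le> B"
    unfolding bounded_iff by blast
  note [measurable] = measurable_lebesgue_on_Omega[OF assms(1)]
  show ?thesis
  proof (rule integrable_const_bound[where B = "B powr p"])
    show "AE x in lebesgue_on (Omega_t \<epsilon>). norm (norm (f x) powr p) \<le> B powr p"
      using B assms(2) by (intro AE_I2) (auto simp: Omega_t_eq intro!: powr_mono2)
  qed measurable
qed

text \<open>Uniqueness makes the gradient of a solution equivariant under \<open>x\<^sub>1 \<mapsto> - x\<^sub>1\<close>, so the solution
  may be replaced by its odd part \<open>h\<close> and the approximating sequence \<open>w\<close> by odd functions.\<close>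
locale odd_solution =
  fixes p \<epsilon> :: real and g :: "real^2 \<Rightarrow> real^2" and h :: "real^2 \<Rightarrow> real" and w :: "nat \<Rightarrow> real^2 \<Rightarrow> real"
  assumes p_gt_1: "p > 1" and eps: "0 < \<epsilon>" "\<epsilon> < 1"
    and g_meas [measurable]: "g \<in> borel_measurable (lebesgue_on (Omega_t \<epsilon>))"
    and h_meas [measurable]: "h \<in> borel_measurable (lebesgue_on (Omega_t \<epsilon>))"
    and g_int: "integrable (lebesgue_on (Omega_t \<epsilon>)) (\<lambda>x. norm (g x) powr p)"
    and weak: "\<And>\<phi>. test_fun (ball 0 5) \<phi> \<Longrightarrow>
        integral\<^sup>L (lebesgue_on (Omega_t \<epsilon>)) (\<lambda>x. pflux p (g x) \<bullet> grad \<phi> x) = 0"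
    and w_test: "\<And>k. test_fun (ball 0 5) (\<lambda>x. w k x - x $ 1)"
    and w_odd: "\<And>k x. w k (mirror x) = - w k x"
    and w_int: "\<And>k. integrable (lebesgue_on (Omega_t \<epsilon>)) (\<lambda>x. \<bar>w k x - h x\<bar> powr p)"
    and w_lim: "(\<lambda>k. integral\<^sup>L (lebesgue_on (Omega_t \<epsilon>)) (\<lambda>x. \<bar>w k x - h x\<bar> powr p)) \<longlonglongrightarrow> 0"
    and gw_int: "\<And>k. integrable (lebesgue_on (Omega_t \<epsilon>)) (\<lambda>x. norm (grad (w k) x - g x) powr p)"
    and gw_lim: "(\<lambda>k. integral\<^sup>L (lebesgue_on (Omega_t \<epsilon>)) (\<lambda>x. norm (grad (w k) x - g x) powr p)) \<longlonglongrightarrow> 0"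

lemma grad_coord: "grad (\<lambda>x. x $ 1) x = axis 1 1"
proof -
  have "((\<lambda>t. (x + t *\<^sub>R axis i 1) $ 1) has_real_derivative (axis i 1 :: real^2) $ 1) (at 0)" for i :: 2
    by (auto intro!: derivative_eq_intros)
  from partial_derivI[OF this] show ?thesis by (auto simp: vec_eq_iff axis_def)
qed

text \<open>Applied with \<open>T\<close> the identity for functions and with
  \<open>T = mirror\<close> for gradients, which gives the convergence of both kinds of odd
  parts.\<close>

lemma half_diff_powr_limit:
  fixes a :: "nat \<Rightarrow> real^2 \<Rightarrow> 'b::{real_normed_vector, second_countable_topology}"
    and T :: "'b \<Rightarrow> 'b" and \<epsilon> :: real
  defines "M \<equiv> lebesgue_on (Omega_t \<epsilon>)"
  assumes p: "p > 0" and T: "\<And>k. (\<lambda>x. T (a k (mirror x))) \<in> borel_measurable M" "\<And>x. norm (T x) = norm x"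
    and a: "\<And>k. a k \<in> borel_measurable M" "\<And>k. integrable M (\<lambda>x. norm (a k x) powr p)"
      "(\<lambda>k. integral\<^sup>L M (\<lambda>x. norm (a k x) powr p)) \<longlonglongrightarrow> 0"
  shows "integrable M (\<lambda>x. norm ((1/2) *\<^sub>R (a k x - T (a k (mirror x)))) powr p)"
    and "(\<lambda>k. integral\<^sup>L M (\<lambda>x. norm ((1/2) *\<^sub>R (a k x - T (a k (mirror x)))) powr p)) \<longlonglongrightarrow> 0"
proof -
  note [measurable] = a(1) T(1)
  have m: "(\<lambda>x. norm (a k x) powr p) \<in> borel_measurable M" for k by measurable
  have R: "integrable M (\<lambda>x. norm (T (a k (mirror x))) powr p)"
      "integral\<^sup>L M (\<lambda>x. norm (T (a k (mirror x))) powr p) = integral\<^sup>L M (\<lambda>x. norm (a k x) powr p)" for k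
    using integral_mirror[OF m[unfolded M_def], of k] a(2)[of k] by (simp_all add: T(2) M_def)
  show i: "integrable M (\<lambda>x. norm ((1/2) *\<^sub>R (a k x - T (a k (mirror x)))) powr p)" for k
    by (rule integrable_norm_half_diff_powr[OF p a(1) T(1) a(2) R(1)])
  have le: "integral\<^sup>L M (\<lambda>x. norm ((1/2) *\<^sub>R (a k x - T (a k (mirror x)))) powr p)
      \<le> 2 * integral\<^sup>L M (\<lambda>x. norm (a k x) powr p)" for k
  proof -
    have "integral\<^sup>L M (\<lambda>x. norm ((1/2) *\<^sub>R (a k x - T (a k (mirror x)))) powr p)
      \<le> integral\<^sup>L M (\<lambda>x. norm (a k x) powr p + norm (T (a k (mirror x))) powr p)"
      by (intro integral_mono i Bochner_Integration.integrable_add a R norm_half_diff_powr_le p)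
    also have "\<dots> = 2 * integral\<^sup>L M (\<lambda>x. norm (a k x) powr p)"
      using a(2) R by simp
    finally show ?thesis .
  qed
  show "(\<lambda>k. integral\<^sup>L M (\<lambda>x. norm ((1/2) *\<^sub>R (a k x - T (a k (mirror x)))) powr p)) \<longlonglongrightarrow> 0"
  proof (rule tendsto_sandwich[OF _ _ tendsto_const])
    show "(\<lambda>k. 2 * integral\<^sup>L M (\<lambda>x. norm (a k x) powr p)) \<longlonglongrightarrow> 0"
      using tendsto_mult_right_zero[OF a(3), of 2] by simp
  qed (use le in \<open>auto intro!: always_eventually\<close>)
qed

lemma set_integral_Omega_t:
  fixes f :: "real^2 \<Rightarrow> real"
  shows "(LINT x:Omega_t \<epsilon>|lebesgue. f x) = integral\<^sup>L (lebesgue_on (Omega_t \<epsilon>)) f"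
    and "set_integrable lebesgue (Omega_t \<epsilon>) f = integrable (lebesgue_on (Omega_t \<epsilon>)) f"
  using fmeasurableD[OF lmeasurable_Omega_t[of \<epsilon>]]
  by (simp_all add: set_lebesgue_integral_def set_integrable_def
      integral_restrict_space[of "Omega_t \<epsilon>" lebesgue] integrable_restrict_space[of "Omega_t \<epsilon>" lebesgue])

lemma set_measurable_Omega_t:
  fixes f :: "real^2 \<Rightarrow> 'b::real_normed_vector"
  shows "set_borel_measurable lebesgue (Omega_t \<epsilon>) f = (f \<in> borel_measurable (lebesgue_on (Omega_t \<epsilon>)))"
  using fmeasurableD[OF lmeasurable_Omega_t[of \<epsilon>]]
  by (simp add: set_borel_measurable_def borel_measurable_restrict_space_iff)

text \<open>The right side is the gradient of -u(mirror x), which solves the same problem because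
  the domain is symmetric and the datum x_1 is odd. Testing both equations with approximations of
  the difference of the two solutions shows that the integral of the monotonicity expression
  \<open>S\<close> is 0; strict monotonicity then identifies the gradients almost
  everywhere.\<close>

lemma solution_gradient_mirror:
  assumes p: "p > 1" and sol: "is_solution p \<epsilon> u g"
  shows "AE x in lebesgue_on (Omega_t \<epsilon>). g x = - mirror (g (mirror x))"
proof -
  define M where "M = lebesgue_on (Omega_t \<epsilon>)"
  have g [measurable]: "g \<in> borel_measurable M" and gi: "integrable M (\<lambda>x. norm (g x) powr p)"
    using sol unfolding is_solution_def sobolev_def M_def set_measurable_Omega_t set_integral_Omega_t
    by auto
  have weak: "integral\<^sup>L M (\<lambda>x. pflux p (g x) \<bullet> grad \<phi> x) = 0" if "test_fun (ball 0 5) \<phi>" for \<phi>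
    using sol that unfolding is_solution_def set_integral_Omega_t M_def pflux_def by simp
  obtain \<psi> where \<psi>: "\<And>k. test_fun (ball 0 5) (\<psi> k)"
    "(\<lambda>k. integral\<^sup>L M (\<lambda>x. norm (grad (\<psi> k) x - (g x - axis 1 1)) powr p)) \<longlonglongrightarrow> 0"
    using sol unfolding is_solution_def set_integral_Omega_t M_def by blast
  note \<psi>s = \<psi>(1)[THEN test_fun_smooth]
  define gh where "gh x = - mirror (g (mirror x))" for x
  have [measurable]: "(\<lambda>x. g (mirror x)) \<in> borel_measurable M"
    using g measurable_mirror_comp unfolding M_def by blast
  have gh [measurable]: "gh \<in> borel_measurable M" unfolding gh_def by measurable
  have ghi: "integrable M (\<lambda>x. norm (gh x) powr p)"
  proof -
    have "(\<lambda>x. norm (g x) powr p) \<in> borel_measurable M" by measurable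
    from integral_mirror(2)[OF this[unfolded M_def]] gi show ?thesis
      by (simp add: gh_def M_def)
  qed
  have cg: "continuous_on UNIV (grad (\<psi> k))" for k using continuous_on_grad[OF \<psi>s] by simp
  have [measurable]: "grad (\<psi> k) \<in> borel_measurable M" for k
    unfolding M_def by (rule measurable_lebesgue_on_Omega[OF cg])
  define a where "a k x = grad (\<psi> k) x - (g x - axis 1 1)" for k x
  have a_meas [measurable]: "a k \<in> borel_measurable M" for k unfolding a_def by measurable
  have ai: "integrable M (\<lambda>x. norm (a k x) powr p)" for k
  proof -
    have eq: "a k x = (grad (\<psi> k) x + axis 1 1) - g x" for x by (simp add: a_def)
    have "integrable M (\<lambda>x. norm (grad (\<psi> k) x + axis 1 1) powr p)"
      unfolding M_def using p cg by (intro integrable_test_fun_powr continuous_intros) auto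
    then show ?thesis unfolding eq using p gi
      by (intro integrable_norm_diff_powr) auto
  qed
  have alim: "(\<lambda>k. integral\<^sup>L M (\<lambda>x. norm (a k x) powr p)) \<longlonglongrightarrow> 0" using \<psi>(2) by (simp add: a_def)
  have am [measurable]: "(\<lambda>x. a k (mirror x)) \<in> borel_measurable M" for k
    using a_meas measurable_mirror_comp unfolding M_def by blast
  have m: "(\<lambda>x. norm (a k x) powr p) \<in> borel_measurable M" for k by measurable
  have ami: "integrable M (\<lambda>x. norm (a k (mirror x)) powr p)" for k
    using integral_mirror(2)[OF m[unfolded M_def], of k] ai[of k] by (simp add: M_def)
  have amlim: "(\<lambda>k. integral\<^sup>L M (\<lambda>x. norm (a k (mirror x)) powr p)) \<longlonglongrightarrow> 0"
    using integral_mirror(1)[OF m[unfolded M_def]] alim by (simp add: M_def)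
  \<comment> \<open>Approximates u + u(mirror x), the difference of the two solutions. The data x_1
    and -x_1 cancel, so the sum of two test functions suffices.\<close>
  define \<phi> where "\<phi> k x = 1 * \<psi> k x + 1 * \<psi> k (mirror x)" for k x
  have \<phi>t: "test_fun (ball 0 5) (\<phi> k)" for k
    unfolding \<phi>_def by (intro test_fun_linear test_fun_mirror \<psi>)
  have \<phi>g: "grad (\<phi> k) x = grad (\<psi> k) x + mirror (grad (\<psi> k) (mirror x))" for k x
    unfolding \<phi>_def using grad_linear[OF \<psi>s[of k] smooth_on_mirror[OF \<psi>s[of k]], of x 1 1] grad_mirror[OF \<psi>s] by simp
  have \<phi>a: "grad (\<phi> k) x = (g x - gh x) + (a k x + mirror (a k (mirror x)))" for k x
    unfolding \<phi>g a_def gh_def by (simp add: mirror_linear_simps mirror_axis)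
  have weak1: "integral\<^sup>L M (\<lambda>x. pflux p (g x) \<bullet> grad (\<phi> k) x) = 0" for k
    using weak[OF \<phi>t] .
  \<comment> \<open>The equation for \<open>gh\<close> is the equation for \<open>g\<close> tested
    with the reflected function.\<close>
  have weak2: "integral\<^sup>L M (\<lambda>x. pflux p (gh x) \<bullet> grad (\<phi> k) x) = 0" for k
  proof -
    let ?f = "\<lambda>x. pflux p (g x) \<bullet> grad (\<lambda>x. \<phi> k (mirror x)) x"
    have c: "continuous_on UNIV (grad (\<lambda>x. \<phi> k (mirror x)))"
      by (rule continuous_on_grad[OF smooth_on_mirror[OF test_fun_smooth[OF \<phi>t]]]) auto
    have [measurable]: "grad (\<lambda>x. \<phi> k (mirror x)) \<in> borel_measurable M"
      unfolding M_def by (rule measurable_lebesgue_on_Omega[OF c])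
    have fm: "?f \<in> borel_measurable M" by measurable
    have "integral\<^sup>L M (\<lambda>x. ?f (mirror x)) = integral\<^sup>L M ?f"
      using integral_mirror(1)[OF fm[unfolded M_def]] by (simp add: M_def)
    also have "\<dots> = 0" by (rule weak[OF test_fun_mirror[OF \<phi>t]])
    finally have "integral\<^sup>L M (\<lambda>x. ?f (mirror x)) = 0" .
    moreover have "?f (mirror x) = - (pflux p (gh x) \<bullet> grad (\<phi> k) x)" for x
      by (simp add: grad_mirror[OF test_fun_smooth[OF \<phi>t]] gh_def pflux_mirror inner_mirror)
    ultimately show ?thesis by simp
  qed
  define S where "S x = (pflux p (g x) - pflux p (gh x)) \<bullet> (g x - gh x)" for x
  have [measurable]: "S \<in> borel_measurable M" unfolding S_def by measurable
  have S0: "S x \<ge> 0" for x unfolding S_def by (rule pflux_monotone[OF p])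
  note pair = integral_powr_mult_tendsto_0[OF p, of _ M]
  \<comment> \<open>Cauchy-Schwarz bound for the flux difference paired with the approximation error
    \<open>a k x + mirror (a k (mirror x))\<close>; all four products tend to 0 in mean.\<close>
  define E where "E k x = norm (g x) powr (p-1) * norm (a k x) + norm (g x) powr (p-1) * norm (a k (mirror x))
     + norm (gh x) powr (p-1) * norm (a k x) + norm (gh x) powr (p-1) * norm (a k (mirror x))" for k x
  have pi: "integrable M (\<lambda>x. norm (f1 x) powr (p-1) * norm (f2 x))"
    if "f1 \<in> borel_measurable M" "f2 \<in> borel_measurable M" "integrable M (\<lambda>x. norm (f1 x) powr p)"
       "integrable M (\<lambda>x. norm (f2 x) powr p)" for f1 f2 :: "real^2 \<Rightarrow> real^2"
    using pair(1)[of "\<lambda>x. norm (f1 x)" "\<lambda>k x. norm (f2 x)"] that by simp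
  have Ei: "integrable M (E k)" for k
    unfolding E_def by (intro Bochner_Integration.integrable_add pi g gh a_meas am gi ghi ai ami)
  have El: "(\<lambda>k. integral\<^sup>L M (E k)) \<longlonglongrightarrow> 0"
  proof -
    have l: "(\<lambda>k. integral\<^sup>L M (\<lambda>x. norm (f1 x) powr (p-1) * norm (b k x))) \<longlonglongrightarrow> 0"
      if "f1 \<in> borel_measurable M" "\<And>k. b k \<in> borel_measurable M" "integrable M (\<lambda>x. norm (f1 x) powr p)"
       "\<And>k. integrable M (\<lambda>x. norm (b k x) powr p)" "(\<lambda>k. integral\<^sup>L M (\<lambda>x. norm (b k x) powr p)) \<longlonglongrightarrow> 0"
     for f1 :: "real^2 \<Rightarrow> real^2" and b :: "nat \<Rightarrow> real^2 \<Rightarrow> real^2"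
      using pair(2)[of "\<lambda>x. norm (f1 x)" "\<lambda>k x. norm (b k x)"] that by simp
    have "integral\<^sup>L M (E k) = integral\<^sup>L M (\<lambda>x. norm (g x) powr (p-1) * norm (a k x))
       + integral\<^sup>L M (\<lambda>x. norm (g x) powr (p-1) * norm (a k (mirror x)))
       + integral\<^sup>L M (\<lambda>x. norm (gh x) powr (p-1) * norm (a k x))
       + integral\<^sup>L M (\<lambda>x. norm (gh x) powr (p-1) * norm (a k (mirror x)))" for k
      unfolding E_def
      by (simp add: pi g gh a_meas am gi ghi ai ami)
    moreover have "(\<lambda>k. integral\<^sup>L M (\<lambda>x. norm (g x) powr (p-1) * norm (a k x))
       + integral\<^sup>L M (\<lambda>x. norm (g x) powr (p-1) * norm (a k (mirror x)))
       + integral\<^sup>L M (\<lambda>x. norm (gh x) powr (p-1) * norm (a k x))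
       + integral\<^sup>L M (\<lambda>x. norm (gh x) powr (p-1) * norm (a k (mirror x)))) \<longlonglongrightarrow> 0 + 0 + 0 + 0"
      by (intro tendsto_add l g gh a_meas am gi ghi ai ami alim amlim)
    ultimately show ?thesis by simp
  qed
  have Si: "integrable M S"
  proof (rule Bochner_Integration.integrable_bound)
    show "integrable M (\<lambda>x. norm (g x) powr (p-1) * norm (g x) + norm (g x) powr (p-1) * norm (gh x)
       + norm (gh x) powr (p-1) * norm (g x) + norm (gh x) powr (p-1) * norm (gh x))"
      by (intro Bochner_Integration.integrable_add pi g gh gi ghi)
    show "AE x in M. norm (S x) \<le> norm (norm (g x) powr (p-1) * norm (g x) + norm (g x) powr (p-1) * norm (gh x)
       + norm (gh x) powr (p-1) * norm (g x) + norm (gh x) powr (p-1) * norm (gh x))"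
    proof (intro AE_I2)
      fix x
      have "\<bar>S x\<bar> \<le> norm (pflux p (g x) - pflux p (gh x)) * norm (g x - gh x)"
        unfolding S_def by (rule Cauchy_Schwarz_ineq2)
      also have "\<dots> \<le> (norm (g x) powr (p-1) + norm (gh x) powr (p-1)) * (norm (g x) + norm (gh x))"
        using norm_triangle_ineq4[of "pflux p (g x)" "pflux p (gh x)"]
        by (intro mult_mono norm_triangle_ineq4) (auto simp: norm_pflux)
      finally show "norm (S x) \<le> norm (norm (g x) powr (p-1) * norm (g x) + norm (g x) powr (p-1) * norm (gh x)
       + norm (gh x) powr (p-1) * norm (g x) + norm (gh x) powr (p-1) * norm (gh x))"
        by (simp add: algebra_simps)
    qed
  qed measurable
  have le: "integral\<^sup>L M S \<le> integral\<^sup>L M (E k)" for k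
  proof -
    define F where "F x = (pflux p (g x) - pflux p (gh x)) \<bullet> grad (\<phi> k) x" for x
    have [measurable]: "grad (\<phi> k) \<in> borel_measurable M"
      unfolding M_def
      by (rule measurable_lebesgue_on_Omega, rule continuous_on_grad[OF test_fun_smooth[OF \<phi>t]]) auto
    have gp: "integrable M (\<lambda>x. norm (grad (\<phi> k) x) powr p)"
      unfolding M_def using p continuous_on_grad[OF test_fun_smooth[OF \<phi>t]]
      by (intro integrable_test_fun_powr) auto
    have Fi: "integrable M (\<lambda>x. pflux p (f x) \<bullet> grad (\<phi> k) x)"
      if "f \<in> borel_measurable M" "integrable M (\<lambda>x. norm (f x) powr p)" for f
    proof (rule Bochner_Integration.integrable_bound)
      show "integrable M (\<lambda>x. norm (f x) powr (p-1) * norm (grad (\<phi> k) x))"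
        using that gp by (intro pi) auto
      show "AE x in M. norm (pflux p (f x) \<bullet> grad (\<phi> k) x) \<le> norm (norm (f x) powr (p-1) * norm (grad (\<phi> k) x))"
        using Cauchy_Schwarz_ineq2[of "pflux p (f x)" "grad (\<phi> k) x" for x]
        by (intro AE_I2) (simp add: norm_pflux)
      note [measurable] = that(1)
      show "(\<lambda>x. pflux p (f x) \<bullet> grad (\<phi> k) x) \<in> borel_measurable M" by measurable
    qed
    have iF: "integrable M F" "integral\<^sup>L M F = 0"
      unfolding F_def inner_diff_left using Fi[OF g gi] Fi[OF gh ghi] weak1 weak2 by auto
    have "integral\<^sup>L M S = integral\<^sup>L M (\<lambda>x. S x - F x)" using iF Si by simp
    also have "\<dots> \<le> integral\<^sup>L M (E k)"
    proof (rule integral_mono)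
      fix x
      have "S x - F x = - ((pflux p (g x) - pflux p (gh x)) \<bullet> (a k x + mirror (a k (mirror x))))"
        unfolding S_def F_def \<phi>a by (simp add: inner_add_right)
      also have "\<dots> \<le> norm (pflux p (g x) - pflux p (gh x)) * norm (a k x + mirror (a k (mirror x)))"
        using Cauchy_Schwarz_ineq2[of "pflux p (g x) - pflux p (gh x)" "a k x + mirror (a k (mirror x))"] by linarith
      also have "\<dots> \<le> (norm (g x) powr (p-1) + norm (gh x) powr (p-1)) * (norm (a k x) + norm (a k (mirror x)))"
        using norm_triangle_ineq4[of "pflux p (g x)" "pflux p (gh x)"]
          norm_triangle_ineq[of "a k x" "mirror (a k (mirror x))"]
        by (intro mult_mono) (auto simp: norm_pflux)
      also have "\<dots> = E k x" by (simp add: E_def algebra_simps)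
      finally show "S x - F x \<le> E k x" .
    qed (use Si iF Ei in auto)
    finally show ?thesis .
  qed
  have "integral\<^sup>L M S \<le> 0" by (rule LIMSEQ_le_const[OF El]) (use le in auto)
  moreover have "integral\<^sup>L M S \<ge> 0" using S0 by (rule Bochner_Integration.integral_nonneg)
  ultimately have "integral\<^sup>L M S = 0" by simp
  then have "AE x in M. S x = 0"
    using integral_nonneg_eq_0_iff_AE[OF Si] S0 by simp
  then show ?thesis
    unfolding M_def[symmetric]
    by eventually_elim (use pflux_strictly_monotone[OF p] in \<open>auto simp: S_def gh_def\<close>)
qed

text \<open>Here \<open>h\<close> is the odd part of \<open>u\<close> and \<open>w k\<close> that of
  \<open>\<psi> k\<close> plus x_1. Because \<open>g\<close> is already equivariant, passing to odd
  parts leaves it unchanged: almost everywhere the new gradient error is half the difference of the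
  old one and its reflection.\<close>

lemma odd_solution_exists:
  assumes p: "p > 1" and eps: "0 < \<epsilon>" "\<epsilon> < 1" and sol: "is_solution p \<epsilon> u g"
  shows "\<exists>h w. odd_solution p \<epsilon> g h w"
proof -
  define M where "M = lebesgue_on (Omega_t \<epsilon>)"
  have g [measurable]: "g \<in> borel_measurable M" and gi: "integrable M (\<lambda>x. norm (g x) powr p)"
    and u [measurable]: "u \<in> borel_measurable M" and ui: "integrable M (\<lambda>x. norm (u x) powr p)"
    using sol unfolding is_solution_def sobolev_def M_def set_measurable_Omega_t set_integral_Omega_t
    by auto
  have weak: "integral\<^sup>L M (\<lambda>x. pflux p (g x) \<bullet> grad \<phi> x) = 0" if "test_fun (ball 0 5) \<phi>" for \<phi>
    using sol that unfolding is_solution_def set_integral_Omega_t M_def pflux_def by simp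
  obtain \<psi> where \<psi>: "\<And>k. test_fun (ball 0 5) (\<psi> k)"
    "(\<lambda>k. integral\<^sup>L M (\<lambda>x. \<bar>\<psi> k x - (u x - x $ 1)\<bar> powr p)) \<longlonglongrightarrow> 0"
    "(\<lambda>k. integral\<^sup>L M (\<lambda>x. norm (grad (\<psi> k) x - (g x - axis 1 1)) powr p)) \<longlonglongrightarrow> 0"
    using sol unfolding is_solution_def set_integral_Omega_t M_def by blast
  note \<psi>s = \<psi>(1)[THEN test_fun_smooth]
  have cg: "continuous_on UNIV (grad (\<psi> k))" for k using continuous_on_grad[OF \<psi>s] by simp
  have c\<psi>: "continuous_on UNIV (\<psi> k)" for k using smooth_on_imp_continuous_on[OF \<psi>s] .
  have [measurable]: "grad (\<psi> k) \<in> borel_measurable M" "\<psi> k \<in> borel_measurable M"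
      "(\<lambda>x. x $ 1) \<in> borel_measurable M" for k
    unfolding M_def by (rule measurable_lebesgue_on_Omega, intro cg c\<psi> continuous_intros)+
  define a where "a k x = grad (\<psi> k) x - (g x - axis 1 1)" for k x
  have a_meas [measurable]: "a k \<in> borel_measurable M" for k unfolding a_def by measurable
  have ai: "integrable M (\<lambda>x. norm (a k x) powr p)" for k
  proof -
    have eq: "a k x = (grad (\<psi> k) x + axis 1 1) - g x" for x by (simp add: a_def)
    have "integrable M (\<lambda>x. norm (grad (\<psi> k) x + axis 1 1) powr p)"
      unfolding M_def using p cg by (intro integrable_test_fun_powr continuous_intros) auto
    then show ?thesis unfolding eq using p gi
      by (intro integrable_norm_diff_powr) auto
  qed
  have alim: "(\<lambda>k. integral\<^sup>L M (\<lambda>x. norm (a k x) powr p)) \<longlonglongrightarrow> 0" using \<psi>(3) by (simp add: a_def)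
  define b where "b k x = \<psi> k x - (u x - x $ 1)" for k x
  have b_meas [measurable]: "b k \<in> borel_measurable M" for k unfolding b_def by measurable
  have bi: "integrable M (\<lambda>x. norm (b k x) powr p)" for k
  proof -
    have eq: "b k x = (\<psi> k x + x $ 1) - u x" for x by (simp add: b_def)
    have "integrable M (\<lambda>x. norm (\<psi> k x + x $ 1) powr p)"
      unfolding M_def using p c\<psi> by (intro integrable_test_fun_powr continuous_intros) auto
    then show ?thesis unfolding eq using p ui
      by (intro integrable_norm_diff_powr) auto
  qed
  have blim: "(\<lambda>k. integral\<^sup>L M (\<lambda>x. norm (b k x) powr p)) \<longlonglongrightarrow> 0" using \<psi>(2) by (simp add: b_def)
  have am [measurable]: "(\<lambda>x. a k (mirror x)) \<in> borel_measurable M" "(\<lambda>x. b k (mirror x)) \<in> borel_measurable M"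
    "(\<lambda>x. u (mirror x)) \<in> borel_measurable M" for k
    using a_meas b_meas u measurable_mirror_comp unfolding M_def by blast+
  have "(\<lambda>x. mirror (a k (mirror x))) \<in> borel_measurable M" for k by measurable
  note A = half_diff_powr_limit[where T = mirror and p = p, OF _ this[unfolded M_def] norm_mirror
      a_meas[unfolded M_def] ai[unfolded M_def] alim[unfolded M_def], folded M_def]
  note B = half_diff_powr_limit[where T = "\<lambda>x. x" and p = p, OF _ am(2)[unfolded M_def] refl
      b_meas[unfolded M_def] bi[unfolded M_def] blim[unfolded M_def], folded M_def]
  define h where "h x = (u x - u (mirror x)) / 2" for x
  define v where "v k x = (1/2) * \<psi> k x + (-1/2) * \<psi> k (mirror x)" for k x
  define w where "w k x = 1 * v k x + 1 * x $ 1" for k x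
  have vt: "test_fun (ball 0 5) (v k)" for k
    unfolding v_def by (intro test_fun_linear test_fun_mirror \<psi>)
  have gw: "grad (w k) x = (1/2) *\<^sub>R (grad (\<psi> k) x - mirror (grad (\<psi> k) (mirror x))) + axis 1 1" for k x
  proof -
    have "grad (w k) x = grad (v k) x + axis 1 1"
      unfolding w_def using grad_linear[OF test_fun_smooth[OF vt[of k]] smooth_on_coord, of x 1 1 1] grad_coord by simp
    also have "grad (v k) x = (1/2) *\<^sub>R (grad (\<psi> k) x - mirror (grad (\<psi> k) (mirror x)))"
      unfolding v_def using grad_linear[OF \<psi>s[of k] smooth_on_mirror[OF \<psi>s[of k]], of x "1/2" "-1/2"] grad_mirror[OF \<psi>s]
      by (simp add: scaleR_diff_right)
    finally show ?thesis .
  qed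
  have wh: "w k x - h x = (1/2) *\<^sub>R (b k x - b k (mirror x))" for k x
    by (simp add: w_def v_def h_def b_def mirror_nth field_simps)
  have gmeas [measurable]: "grad (w k) \<in> borel_measurable M" for k
  proof -
    have "smooth_on UNIV (w k)"
      unfolding w_def by (intro smooth_on_add smooth_on_mult smooth_on_const smooth_on_coord test_fun_smooth[OF vt])
    from continuous_on_grad[OF this] show ?thesis
      unfolding M_def by (intro measurable_lebesgue_on_Omega) auto
  qed
  have eqA: "AE x in M. norm (grad (w k) x - g x) powr p = norm ((1/2) *\<^sub>R (a k x - mirror (a k (mirror x)))) powr p" for k
  proof -
    have "AE x in M. g x = - mirror (g (mirror x))"
      unfolding M_def by (rule solution_gradient_mirror[OF p sol])
    then show ?thesis
    proof eventually_elim
      case (elim x)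
      have "a k x - mirror (a k (mirror x)) =
          (grad (\<psi> k) x - mirror (grad (\<psi> k) (mirror x))) + 2 *\<^sub>R axis 1 1 - (g x - mirror (g (mirror x)))"
        by (simp add: a_def mirror_linear_simps mirror_axis scaleR_2)
      also have "g x - mirror (g (mirror x)) = 2 *\<^sub>R g x" using elim by (simp add: scaleR_2)
      finally have "(1/2) *\<^sub>R (a k x - mirror (a k (mirror x))) = grad (w k) x - g x"
        unfolding gw by (simp only: scaleR_diff_right scaleR_add_right) simp
      then show ?case by simp
    qed
  qed
  have "odd_solution p \<epsilon> g h w"
  proof (unfold_locales, fold M_def)
    show "h \<in> borel_measurable M" unfolding h_def by measurable
    show "test_fun (ball 0 5) (\<lambda>x. w k x - x $ 1)" for k using vt by (simp add: w_def)
    show "w k (mirror x) = - w k x" for k x by (simp add: w_def v_def mirror_nth)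
    show "integrable M (\<lambda>x. \<bar>w k x - h x\<bar> powr p)" for k
      unfolding wh real_norm_def[symmetric] using B(1) p by simp
    show "(\<lambda>k. integral\<^sup>L M (\<lambda>x. \<bar>w k x - h x\<bar> powr p)) \<longlonglongrightarrow> 0"
      unfolding wh real_norm_def[symmetric] using B(2) p by simp
    show "integrable M (\<lambda>x. norm (grad (w k) x - g x) powr p)" for k
      using integrable_cong_AE[OF _ _ eqA] A(1) p by simp
    have "integral\<^sup>L M (\<lambda>x. norm (grad (w k) x - g x) powr p) =
        integral\<^sup>L M (\<lambda>x. norm ((1/2) *\<^sub>R (a k x - mirror (a k (mirror x)))) powr p)" for k
      by (rule integral_cong_AE[OF _ _ eqA]) measurable
    then show "(\<lambda>k. integral\<^sup>L M (\<lambda>x. norm (grad (w k) x - g x) powr p)) \<longlonglongrightarrow> 0"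
      using A(2) p by simp
  qed (use assms g gi weak in auto)
  then show ?thesis by blast
qed

section \<open>Comparison with strict subsolutions\<close>

lemma integral_lebesgue_on_Omega_t:
  fixes f :: "real^2 \<Rightarrow> real"
  assumes "f \<in> borel_measurable borel"
  shows "integral\<^sup>L (lebesgue_on (Omega_t \<epsilon>)) f = integral\<^sup>L lborel (\<lambda>x. indicator (Omega_t \<epsilon>) x * f x)"
proof -
  have "Omega_t \<epsilon> \<in> sets borel" using open_Omega_t by auto
  then have "(\<lambda>x. indicator (Omega_t \<epsilon>) x * f x) \<in> borel_measurable borel" using assms by measurable
  then show ?thesis
    using fmeasurableD[OF lmeasurable_Omega_t[of \<epsilon>]] integral_completion[of "\<lambda>x. indicator (Omega_t \<epsilon>) x * f x" lborel]
    by (simp add: integral_restrict_space[of "Omega_t \<epsilon>" lebesgue])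
qed

context odd_solution
begin

abbreviation "M \<equiv> lebesgue_on (Omega_t \<epsilon>)"

lemma w_smooth: "smooth_on UNIV (w k)"
proof -
  have "smooth_on UNIV (\<lambda>x. (w k x - x $ 1) + x $ 1)"
    by (intro smooth_on_add smooth_on_coord test_fun_smooth[OF w_test])
  then show ?thesis by simp
qed

lemma w_meas [measurable]: "w k \<in> borel_measurable M" "grad (w k) \<in> borel_measurable M"
  using measurable_lebesgue_on_Omega continuous_on_grad[OF w_smooth] smooth_on_imp_continuous_on[OF w_smooth]
  by auto

sublocale M: finite_measure M
  using lmeasurable_Omega_t by (rule finite_measure_lebesgue_on)

lemma w_L1: "integrable M (\<lambda>x. \<bar>w k x - h x\<bar>)"
    "(\<lambda>k. integral\<^sup>L M (\<lambda>x. \<bar>w k x - h x\<bar>)) \<longlonglongrightarrow> 0"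
  using integral_powr_mult_tendsto_0[OF p_gt_1, of "\<lambda>_. 1" M "\<lambda>k x. \<bar>w k x - h x\<bar>"] w_int w_lim
  by auto

lemma gw_L1: "integrable M (\<lambda>x. norm (grad (w k) x - g x))"
    "(\<lambda>k. integral\<^sup>L M (\<lambda>x. norm (grad (w k) x - g x))) \<longlonglongrightarrow> 0"
  using integral_powr_mult_tendsto_0[OF p_gt_1, of "\<lambda>_. 1" M "\<lambda>k x. norm (grad (w k) x - g x)"] gw_int gw_lim
  by auto

text \<open>The price of using \<open>w k\<close> in place of its limit in
  \<open>comparison\<close>. The first factor bounds the difference of the two fluxes; the factors 2
  are the slope bound and the Lipschitz constant of \<open>flat_exp\<close>, and the inner
  \<open>B\<close> bounds the gradient of the cutoff.\<close>

lemma error_tendsto_0: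
  fixes B :: real
  defines "E k x \<equiv> (B + norm (g x) powr (p - 1)) * (2 * norm (grad (w k) x - g x) + 2 * B * \<bar>w k x - h x\<bar>)"
  shows "integrable M (E k)" "(\<lambda>k. integral\<^sup>L M (E k)) \<longlonglongrightarrow> 0"
proof -
  note 1 = integral_powr_mult_tendsto_0[OF p_gt_1, of "\<lambda>x. norm (g x)" M "\<lambda>k x. \<bar>w k x - h x\<bar>"]
  note 2 = integral_powr_mult_tendsto_0[OF p_gt_1, of "\<lambda>x. norm (g x)" M "\<lambda>k x. norm (grad (w k) x - g x)"]
  have i1: "integrable M (\<lambda>x. norm (g x) powr (p - 1) * \<bar>w k x - h x\<bar>)"
    and i2: "integrable M (\<lambda>x. norm (g x) powr (p - 1) * norm (grad (w k) x - g x))" for k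
    using 1(1) 2(1) g_int w_int gw_int by auto
  have l1: "(\<lambda>k. integral\<^sup>L M (\<lambda>x. norm (g x) powr (p - 1) * \<bar>w k x - h x\<bar>)) \<longlonglongrightarrow> 0"
    and l2: "(\<lambda>k. integral\<^sup>L M (\<lambda>x. norm (g x) powr (p - 1) * norm (grad (w k) x - g x))) \<longlonglongrightarrow> 0"
    using 1(2) 2(2) g_int w_int gw_int w_lim gw_lim by auto
  have eq: "E k x = (2 * B) * norm (grad (w k) x - g x) + (2 * B * B) * \<bar>w k x - h x\<bar>
     + 2 * (norm (g x) powr (p - 1) * norm (grad (w k) x - g x))
     + (2 * B) * (norm (g x) powr (p - 1) * \<bar>w k x - h x\<bar>)" for k x
    by (simp add: E_def algebra_simps)
  show "integrable M (E k)" for k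
    unfolding eq by (intro Bochner_Integration.integrable_add integrable_mult_right w_L1 gw_L1 i1 i2)
  have "integral\<^sup>L M (E k) = (2 * B) * integral\<^sup>L M (\<lambda>x. norm (grad (w k) x - g x))
     + (2 * B * B) * integral\<^sup>L M (\<lambda>x. \<bar>w k x - h x\<bar>)
     + 2 * integral\<^sup>L M (\<lambda>x. norm (g x) powr (p - 1) * norm (grad (w k) x - g x))
     + (2 * B) * integral\<^sup>L M (\<lambda>x. norm (g x) powr (p - 1) * \<bar>w k x - h x\<bar>)" for k
    unfolding eq by (simp add: w_L1 gw_L1 i1 i2)
  moreover have "(\<lambda>k. (2 * B) * integral\<^sup>L M (\<lambda>x. norm (grad (w k) x - g x))
     + (2 * B * B) * integral\<^sup>L M (\<lambda>x. \<bar>w k x - h x\<bar>)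
     + 2 * integral\<^sup>L M (\<lambda>x. norm (g x) powr (p - 1) * norm (grad (w k) x - g x))
     + (2 * B) * integral\<^sup>L M (\<lambda>x. norm (g x) powr (p - 1) * \<bar>w k x - h x\<bar>)) \<longlonglongrightarrow>
      2 * B * 0 + 2 * B * B * 0 + 2 * 0 + 2 * B * 0"
    by (intro tendsto_add tendsto_mult tendsto_const w_L1 gw_L1 l1 l2)
  ultimately show "(\<lambda>k. integral\<^sup>L M (E k)) \<longlonglongrightarrow> 0" by simp
qed

text \<open>Formally one tests with the cutoff times (v - h - eta)^+. Monotonicity gives the main
  term a sign, the weak equation removes the flux of \<open>g\<close>, and the flux inequality for
  \<open>X\<close> leaves \<open>d\<close> times the integral of the test function below an error
  tending to 0. By \<open>sep\<close> the cutoff is 1 wherever v - h > eta, so its gradient meets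
  only points where the limiting test function is 0. The form of \<open>supp\<close> lets the
  support be compact either through the cutoff or through the values of \<open>w k\<close> near the
  boundary of \<open>U\<close>.\<close>

lemma comparison:
  fixes v \<zeta> :: "real^2 \<Rightarrow> real" and X :: "real^2 \<Rightarrow> real^2" and dX :: "2 \<Rightarrow> real^2 \<Rightarrow> real"
  assumes U: "open U" "U \<subseteq> ball 0 5" and v: "smooth_on U v"
    and \<zeta>: "smooth_on UNIV \<zeta>" "\<And>x. 0 \<le> \<zeta> x" "\<And>x. \<zeta> x \<le> 1" "\<And>x. norm (grad \<zeta> x) \<le> B"
    and X: "\<And>x. x \<in> U \<Longrightarrow> X x = pflux p (grad v x)" "\<And>x. x \<in> U \<Longrightarrow> norm (X x) \<le> B"
      "continuous_on U X" "\<And>i. continuous_on U (dX i)"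
      "\<And>i x. x \<in> U \<Longrightarrow> ((\<lambda>t. X (x + t *\<^sub>R axis i 1) $ i) has_real_derivative dX i x) (at 0)"
    and d: "d > 0" "\<And>x. x \<in> U \<inter> Omega_t \<epsilon> \<Longrightarrow> d \<le> dX 1 x + dX 2 x"
    and out: "\<And>x. x \<in> U \<inter> Omega_t \<epsilon> \<Longrightarrow>
        0 \<le> X x \<bullet> (x - upper_center \<epsilon>) \<and> 0 \<le> X x \<bullet> (x - lower_center \<epsilon>)"
    and supp: "\<And>k. \<exists>K. compact K \<and> K \<subseteq> U \<and> (\<forall>x\<in>U - K. \<zeta> x * flat_exp (v x - w k x - \<eta>) = 0)"
    and sep: "AE x in M. x \<in> U \<longrightarrow> v x - h x > \<eta> \<longrightarrow> \<zeta> x = 1"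
  shows "AE x in M. x \<in> U \<longrightarrow> \<zeta> x = 1 \<longrightarrow> v x - h x \<le> \<eta>"
proof -
  \<comment> \<open>A smooth substitute for the test function \<open>\<zeta> (v - w - \<eta>)\<^sup>+\<close>.\<close>
  define \<phi> where "\<phi> k x = (if x \<in> U then \<zeta> x * flat_exp (v x - w k x - \<eta>) else 0)" for k x
  have sU: "smooth_on U (\<lambda>x. \<zeta> x * flat_exp (v x - w k x - \<eta>))" for k
    by (intro smooth_on_mult smooth_on_flat_exp smooth_on_diff smooth_on_const v
        smooth_on_subset[OF \<zeta>(1)] smooth_on_subset[OF w_smooth]) auto
  have sU': "smooth_on U (\<phi> k)" for k
    by (rule smooth_on_cong[OF U(1) sU[of k]]) (simp add: \<phi>_def)
  have \<phi>nn: "\<phi> k x \<ge> 0" for k x using \<zeta>(2) by (simp add: \<phi>_def)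
  define E where "E k x = (B + norm (g x) powr (p - 1)) *
      (2 * norm (grad (w k) x - g x) + 2 * B * \<bar>w k x - h x\<bar>)" for k x
  note E = error_tendsto_0[of B, folded E_def]
  have main: "d * integral\<^sup>L M (\<phi> k) \<le> integral\<^sup>L M (E k)" and \<phi>i: "integrable M (\<phi> k)" for k
  proof -
    obtain K where K: "compact K" "K \<subseteq> U" "\<forall>x\<in>U - K. \<zeta> x * flat_exp (v x - w k x - \<eta>) = 0"
      using supp[of k] by blast
    note Kc = compact_imp_closed[OF K(1)]
    have K0: "\<phi> k x = 0" if "x \<notin> K" for x using K that by (auto simp: \<phi>_def)
    have s: "smooth_on UNIV (\<phi> k)" by (rule smooth_on_zero_extension[OF U(1) Kc K(2) sU' K0])
    have t: "test_fun (ball 0 5) (\<phi> k)" by (rule test_funI[OF s K(1) _ K0]) (use K U in auto)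
    have g0: "grad (\<phi> k) x = 0" if "x \<notin> U" for x
    proof -
      have "partial_deriv i (\<phi> k) x = 0" for i
        by (rule partial_derivI, rule has_partial_cong_open[of "- K" _ _ "\<lambda>_. 0"])
           (use that K K0 Kc in auto)
      then show ?thesis by (simp add: vec_eq_iff)
    qed
    have gU: "grad (\<phi> k) x = (\<zeta> x * flat_exp_deriv (Suc 0) (v x - w k x - \<eta>)) *\<^sub>R (grad v x - grad (w k) x)
        + flat_exp (v x - w k x - \<eta>) *\<^sub>R grad \<zeta> x" if x: "x \<in> U" for x
    proof -
      have "partial_deriv i (\<phi> k) x = \<zeta> x * flat_exp_deriv (Suc 0) (v x - w k x - \<eta>) * (partial_deriv i v x - partial_deriv i (w k) x)
        + flat_exp (v x - w k x - \<eta>) * partial_deriv i \<zeta> x" for i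
      proof (rule partial_derivI, rule has_partial_cong_open[OF U(1) x])
        show "\<phi> k y = \<zeta> y * flat_exp (v y - w k y - \<eta>)" if "y \<in> U" for y using that by (simp add: \<phi>_def)
        have a: "((\<lambda>t. v (x + t *\<^sub>R axis i 1) - w k (x + t *\<^sub>R axis i 1) - \<eta>) has_real_derivative
            (partial_deriv i v x - partial_deriv i (w k) x)) (at 0)"
          using DERIV_diff[OF DERIV_diff[OF smooth_on_has_partial_deriv[OF v x] smooth_on_has_partial_deriv[OF w_smooth UNIV_I]] DERIV_const]
          by simp
        have b: "((\<lambda>t. flat_exp (v (x + t *\<^sub>R axis i 1) - w k (x + t *\<^sub>R axis i 1) - \<eta>)) has_real_derivative
            flat_exp_deriv (Suc 0) (v x - w k x - \<eta>) * (partial_deriv i v x - partial_deriv i (w k) x)) (at 0)"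
          by (rule DERIV_chain2[OF _ a]) (use flat_exp_has_derivative in auto)
        show "((\<lambda>t. \<zeta> (x + t *\<^sub>R axis i 1) * flat_exp (v (x + t *\<^sub>R axis i 1) - w k (x + t *\<^sub>R axis i 1) - \<eta>)) has_real_derivative
          \<zeta> x * flat_exp_deriv (Suc 0) (v x - w k x - \<eta>) * (partial_deriv i v x - partial_deriv i (w k) x)
        + flat_exp (v x - w k x - \<eta>) * partial_deriv i \<zeta> x) (at 0)"
          by (rule DERIV_cong[OF DERIV_mult[OF smooth_on_has_partial_deriv[OF \<zeta>(1) UNIV_I] b]])
             (simp add: algebra_simps)
      qed
      then show ?thesis by (simp add: vec_eq_iff)
    qed
    define F where "F x = X x \<bullet> grad (\<phi> k) x + d * \<phi> k x" for x
    have inO: "x \<in> Omega_t \<epsilon>" if "x \<in> U" "x \<in> perforated (upper_center \<epsilon>) (lower_center \<epsilon>)" for x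
      using that U(2) by (auto simp: Omega_t_eq)
    have cX: "continuous_on UNIV (\<lambda>x. X x \<bullet> grad (\<phi> k) x)"
      and neg: "integral\<^sup>L lborel (\<lambda>x. indicator (perforated (upper_center \<epsilon>) (lower_center \<epsilon>)) x * F x) \<le> 0"
      unfolding F_def
      using integral_flux_le[where \<phi> = "\<phi> k" and K = K and X = X and dX = dX and d = d
          and ?c1.0 = "upper_center \<epsilon>" and ?c2.0 = "lower_center \<epsilon>", OF U(1) s \<phi>nn K(1,2) K0 X(3-5)]
        d(2) out inO by auto
    have c\<phi>: "continuous_on UNIV (\<phi> k)" using smooth_on_imp_continuous_on[OF s] .
    have cF: "continuous_on UNIV F" unfolding F_def
      by (intro continuous_on_add continuous_on_mult continuous_on_const cX c\<phi>)
    have bm: "bounded (f ` cball 0 5)" if "continuous_on UNIV f" for f :: "real^2 \<Rightarrow> real"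
      using that by (intro compact_imp_bounded compact_continuous_image) (auto intro: continuous_on_subset)
    have iM: "integrable M f" if c: "continuous_on UNIV f" for f :: "real^2 \<Rightarrow> real"
    proof -
      from bm[OF c] obtain b where "\<And>x. x \<in> cball 0 5 \<Longrightarrow> norm (f x) \<le> b"
        unfolding bounded_iff by blast
      then show ?thesis
        by (intro M.integrable_const_bound[where B = b] measurable_lebesgue_on_Omega c AE_I2)
           (auto simp: Omega_t_eq)
    qed
    show \<phi>i: "integrable M (\<phi> k)" by (rule iM[OF c\<phi>])
    have "integral\<^sup>L M F = integral\<^sup>L lborel (\<lambda>x. indicator (perforated (upper_center \<epsilon>) (lower_center \<epsilon>)) x * F x)"
    proof -
      \<comment> \<open>\<open>F\<close> vanishes outside \<open>U\<close>, which lies in the ball,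
        so the outer boundary does not enter.\<close>
      have "indicator (Omega_t \<epsilon>) x * F x = indicator (perforated (upper_center \<epsilon>) (lower_center \<epsilon>)) x * F x" for x
        using U(2) g0[of x] by (auto simp: Omega_t_eq indicator_def F_def \<phi>_def)
      then show ?thesis
        using integral_lebesgue_on_Omega_t[OF borel_measurable_continuous_onI[OF cF], of \<epsilon>] by (simp only:)
    qed
    with neg have neg': "integral\<^sup>L M F \<le> 0" by simp
    have gm [measurable]: "grad (\<phi> k) \<in> borel_measurable M"
      by (rule measurable_lebesgue_on_Omega, rule continuous_on_grad[OF s]) auto
    have gi: "integrable M (\<lambda>x. pflux p (g x) \<bullet> grad (\<phi> k) x)"
    proof (rule Bochner_Integration.integrable_bound)
      show "integrable M (\<lambda>x. norm (g x) powr (p-1) * norm (grad (\<phi> k) x))"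
        using integral_powr_mult_tendsto_0(1)[OF p_gt_1, of "\<lambda>x. norm (g x)" M "\<lambda>k' x. norm (grad (\<phi> k) x)"]
          g_int integrable_test_fun_powr[OF continuous_on_grad[OF s], of p \<epsilon>] p_gt_1 by simp
      show "AE x in M. norm (pflux p (g x) \<bullet> grad (\<phi> k) x) \<le> norm (norm (g x) powr (p-1) * norm (grad (\<phi> k) x))"
        using Cauchy_Schwarz_ineq2[of "pflux p (g x)" "grad (\<phi> k) x" for x]
        by (intro AE_I2) (simp add: norm_pflux)
    qed measurable
    have iF: "integrable M (\<lambda>x. X x \<bullet> grad (\<phi> k) x)" by (rule iM[OF cX])
    have "- integral\<^sup>L M (E k) = integral\<^sup>L M (\<lambda>x. - E k x)" by simp
    also have "\<dots> \<le> integral\<^sup>L M (\<lambda>x. X x \<bullet> grad (\<phi> k) x - pflux p (g x) \<bullet> grad (\<phi> k) x)"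
    proof (rule integral_mono_AE)
      show "AE x in M. - E k x \<le> X x \<bullet> grad (\<phi> k) x - pflux p (g x) \<bullet> grad (\<phi> k) x"
        using sep
      proof eventually_elim
        case (elim x)
        have B0: "B \<ge> 0" using \<zeta>(4)[of 0] norm_ge_zero order_trans by blast
        show ?case
        proof (cases "x \<in> U")
          case False
          then show ?thesis using g0 B0 by (simp add: E_def)
        next
          case True
          define D where "D = X x - pflux p (g x)"
          define T where "T = flat_exp (v x - w k x - \<eta>)"
          define T' where "T' = flat_exp_deriv (Suc 0) (v x - w k x - \<eta>)"
          have T': "0 \<le> T'" "T' \<le> 2"
            unfolding T'_def by (rule flat_exp_deriv_1_nonneg, rule flat_exp_deriv_1_le)
          have nD: "norm D \<le> B + norm (g x) powr (p - 1)"
            using norm_triangle_ineq4[of "X x" "pflux p (g x)"] X(2)[OF True] by (simp add: D_def norm_pflux)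
          have "X x \<bullet> grad (\<phi> k) x - pflux p (g x) \<bullet> grad (\<phi> k) x = D \<bullet> grad (\<phi> k) x"
            by (simp add: D_def inner_diff_left)
          \<comment> \<open>Inserting \<open>g\<close> isolates the monotone term; the other two
            carry the gradient error and the gradient of the cutoff.\<close>
          also have "\<dots> = \<zeta> x * T' * (D \<bullet> (grad v x - g x)) + \<zeta> x * T' * (D \<bullet> (g x - grad (w k) x))
              + T * (D \<bullet> grad \<zeta> x)"
            by (simp add: gU[OF True] T_def T'_def inner_add_right inner_diff_right algebra_simps)
          finally have split: "X x \<bullet> grad (\<phi> k) x - pflux p (g x) \<bullet> grad (\<phi> k) x = \<dots>" .
          have 1: "\<zeta> x * T' * (D \<bullet> (grad v x - g x)) \<ge> 0"
            using pflux_monotone[OF p_gt_1, of "grad v x" "g x"] \<zeta>(2)[of x] T'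
            by (simp add: D_def X(1)[OF True])
          have zT: "0 \<le> \<zeta> x * T'" "\<zeta> x * T' \<le> 2"
            using \<zeta>(2,3)[of x] T' mult_mono[of "\<zeta> x" 1 T' 2] by auto
          have 2: "\<zeta> x * T' * (D \<bullet> (g x - grad (w k) x)) \<ge> - (2 * (norm D * norm (grad (w k) x - g x)))"
          proof -
            have "\<bar>\<zeta> x * T' * (D \<bullet> (g x - grad (w k) x))\<bar> \<le> 2 * (norm D * norm (g x - grad (w k) x))"
              unfolding abs_mult[of "\<zeta> x * T'"]
              using zT Cauchy_Schwarz_ineq2 by (intro mult_mono) auto
            then show ?thesis by (simp add: norm_minus_commute abs_le_iff)
          qed
          have 3: "T * (D \<bullet> grad \<zeta> x) \<ge> - ((2 * \<bar>w k x - h x\<bar>) * (norm D * B))"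
          proof (cases "v x - h x > \<eta>")
            case gt: True
            \<comment> \<open>The cutoff attains its maximum 1 at \<open>x\<close>, so its gradient
              vanishes there.\<close>
            have z1: "\<zeta> x = 1" using elim True gt by blast
            have "partial_deriv i \<zeta> x = 0" for i
            proof (rule DERIV_local_max[OF smooth_on_has_partial_deriv[OF \<zeta>(1) UNIV_I], of 1])
              show "\<forall>y. \<bar>0 - y\<bar> < 1 \<longrightarrow> \<zeta> (x + y *\<^sub>R axis i 1) \<le> \<zeta> (x + 0 *\<^sub>R axis i 1)"
                using z1 \<zeta>(3) by simp
            qed simp
            then have "grad \<zeta> x = 0" by (simp add: vec_eq_iff)
            then show ?thesis using B0 by simp
          next
            case False
            \<comment> \<open>With \<open>h\<close> in place of \<open>w k\<close> the factor would
              be 0, so \<open>T\<close> is pure approximation error.\<close>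
            have z: "flat_exp (v x - h x - \<eta>) = 0" using False by simp
            have "T = \<bar>T - flat_exp (v x - h x - \<eta>)\<bar>" unfolding z T_def by simp
            also have "\<dots> \<le> 2 * \<bar>(v x - w k x - \<eta>) - (v x - h x - \<eta>)\<bar>"
              unfolding T_def by (rule flat_exp_Lipschitz)
            finally have T2: "T \<le> 2 * \<bar>w k x - h x\<bar>" by (simp add: abs_minus_commute)
            have "\<bar>D \<bullet> grad \<zeta> x\<bar> \<le> norm D * B"
              using Cauchy_Schwarz_ineq2[of D "grad \<zeta> x"] \<zeta>(4)[of x] by (smt (verit) mult_left_mono norm_ge_zero)
            then have "T * \<bar>D \<bullet> grad \<zeta> x\<bar> \<le> (2 * \<bar>w k x - h x\<bar>) * (norm D * B)"
              using T2 by (intro mult_mono) (auto simp: T_def)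
            moreover have "T * (D \<bullet> grad \<zeta> x) \<ge> - (T * \<bar>D \<bullet> grad \<zeta> x\<bar>)"
              using abs_ge_minus_self[of "T * (D \<bullet> grad \<zeta> x)"] by (simp add: abs_mult T_def)
            ultimately show ?thesis by linarith
          qed
          have "norm D * (2 * norm (grad (w k) x - g x) + 2 * B * \<bar>w k x - h x\<bar>) \<le> E k x"
            unfolding E_def using nD B0 by (intro mult_right_mono) auto
          with 1 2 3 show ?thesis unfolding split by (simp add: algebra_simps)
        qed
      qed
    qed (use E(1) iF gi in auto)
    also have "\<dots> = integral\<^sup>L M (\<lambda>x. X x \<bullet> grad (\<phi> k) x)"
      using iF gi weak[OF t] by simp
    finally have "- integral\<^sup>L M (E k) \<le> integral\<^sup>L M (\<lambda>x. X x \<bullet> grad (\<phi> k) x)" .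
    moreover have "integral\<^sup>L M F = integral\<^sup>L M (\<lambda>x. X x \<bullet> grad (\<phi> k) x) + d * integral\<^sup>L M (\<phi> k)"
      unfolding F_def using iF \<phi>i by simp
    ultimately show "d * integral\<^sup>L M (\<phi> k) \<le> integral\<^sup>L M (E k)" using neg' by linarith
  qed
  \<comment> \<open>The limiting test function. The inner indicator makes \<open>v\<close>,
    controlled only on \<open>U\<close>, measurable.\<close>
  define \<Phi> where "\<Phi> x = indicator U x * (\<zeta> x * flat_exp (indicator U x *\<^sub>R v x - h x - \<eta>))" for x
  have vm: "(\<lambda>x. indicator U x *\<^sub>R v x) \<in> borel_measurable borel"
    by (rule borel_measurable_continuous_on_indicator)
       (use U smooth_on_imp_continuous_on[OF v] in auto)
  have [measurable]: "(\<lambda>x. indicator U x *\<^sub>R v x) \<in> borel_measurable M"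
    using vm by (auto intro!: measurable_restrict_space1 measurable_completion)
  have [measurable]: "\<zeta> \<in> borel_measurable M"
    by (rule measurable_lebesgue_on_Omega[OF smooth_on_imp_continuous_on[OF \<zeta>(1)]])
  have [measurable]: "flat_exp \<in> borel_measurable borel"
    by (rule borel_measurable_continuous_onI) (intro continuous_intros)
  have [measurable]: "indicator U \<in> borel_measurable M"
    using U(1) by (intro measurable_restrict_space1 borel_measurable_indicator) auto
  have \<Phi>m [measurable]: "\<Phi> \<in> borel_measurable M" unfolding \<Phi>_def by measurable
  have \<Phi>0: "\<Phi> x \<ge> 0" and \<Phi>1: "\<Phi> x \<le> 1" for x
    unfolding \<Phi>_def using \<zeta>(2,3) flat_exp_le_1 by (auto simp: indicator_def intro: mult_le_one)
  have \<Phi>i: "integrable M \<Phi>"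
    by (rule M.integrable_const_bound[where B = 1]) (use \<Phi>0 \<Phi>1 in auto)
  have le: "integral\<^sup>L M \<Phi> \<le> integral\<^sup>L M (E k) / d + 2 * integral\<^sup>L M (\<lambda>x. \<bar>w k x - h x\<bar>)" for k
  proof -
    have "integral\<^sup>L M \<Phi> \<le> integral\<^sup>L M (\<lambda>x. \<phi> k x + 2 * \<bar>w k x - h x\<bar>)"
    proof (rule integral_mono[OF \<Phi>i])
      show "integrable M (\<lambda>x. \<phi> k x + 2 * \<bar>w k x - h x\<bar>)"
        using \<phi>i w_L1(1) by (intro Bochner_Integration.integrable_add integrable_mult_right)
      fix x
      show "\<Phi> x \<le> \<phi> k x + 2 * \<bar>w k x - h x\<bar>"
      proof (cases "x \<in> U")
        case True
        have a: "flat_exp (v x - h x - \<eta>) \<le> flat_exp (v x - w k x - \<eta>) + 2 * \<bar>w k x - h x\<bar>"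
          using flat_exp_Lipschitz[of "v x - h x - \<eta>" "v x - w k x - \<eta>"] by simp
        have "\<zeta> x * flat_exp (v x - h x - \<eta>) \<le> \<zeta> x * flat_exp (v x - w k x - \<eta>) + \<zeta> x * (2 * \<bar>w k x - h x\<bar>)"
          using mult_left_mono[OF a \<zeta>(2)[of x]] by (simp add: distrib_left)
        also have "\<zeta> x * (2 * \<bar>w k x - h x\<bar>) \<le> 2 * \<bar>w k x - h x\<bar>"
          using \<zeta>(2,3)[of x] by (intro mult_left_le_one_le) auto
        finally show ?thesis using True by (simp add: \<Phi>_def \<phi>_def)
      qed (simp add: \<Phi>_def \<phi>_def)
    qed
    also have "\<dots> = integral\<^sup>L M (\<phi> k) + 2 * integral\<^sup>L M (\<lambda>x. \<bar>w k x - h x\<bar>)"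
      using \<phi>i w_L1(1) by simp
    also have "integral\<^sup>L M (\<phi> k) \<le> integral\<^sup>L M (E k) / d"
      using main[of k] d(1) by (simp add: field_simps)
    finally show ?thesis by simp
  qed
  have "(\<lambda>k. integral\<^sup>L M (E k) / d + 2 * integral\<^sup>L M (\<lambda>x. \<bar>w k x - h x\<bar>)) \<longlonglongrightarrow> 0 / d + 2 * 0"
    using d(1) by (intro tendsto_intros E w_L1) auto
  then have "integral\<^sup>L M \<Phi> \<le> 0 / d + 2 * 0"
    by (rule LIMSEQ_le_const) (use le in auto)
  moreover have "integral\<^sup>L M \<Phi> \<ge> 0" using \<Phi>0 by (rule Bochner_Integration.integral_nonneg)
  ultimately have "integral\<^sup>L M \<Phi> = 0" by simp
  then have "AE x in M. \<Phi> x = 0"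
    using integral_nonneg_eq_0_iff_AE[OF \<Phi>i] \<Phi>0 by simp
  then show ?thesis
    by eventually_elim (auto simp: \<Phi>_def indicator_def)
qed

end

section \<open>The linear lower bound on x_1 > 0\<close>

lemma powr_between:
  fixes t :: real
  assumes "0 < l" "l \<le> t" "t \<le> u"
  shows "min (l powr a) (u powr a) \<le> t powr a" "t powr a \<le> max (l powr a) (u powr a)"
proof -
  have "l powr a \<le> t powr a \<and> t powr a \<le> u powr a" if "a \<ge> 0"
    using assms that by (auto intro!: powr_mono2)
  moreover have "u powr a \<le> t powr a \<and> t powr a \<le> l powr a" if "a \<le> 0"
    using assms that by (auto intro!: powr_mono2')
  ultimately show "min (l powr a) (u powr a) \<le> t powr a" "t powr a \<le> max (l powr a) (u powr a)"
    by (cases "a \<ge> 0"; force)+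
qed

lemma pflux_scaleR:
  assumes "c > 0" shows "pflux p (c *\<^sub>R x) = c powr (p - 1) *\<^sub>R pflux p x"
proof -
  have "pflux p (c *\<^sub>R x) = ((c * c powr (p - 2)) * norm x powr (p - 2)) *\<^sub>R x"
    using assms by (simp add: pflux_def powr_mult mult_ac)
  also have "c * c powr (p - 2) = c powr (p - 1)" using powr_mult_base[of c "p - 2"] assms by simp
  finally show ?thesis by (simp add: pflux_def)
qed

context odd_solution
begin

text \<open>The constant cutoff 1 suffices. On the line x_1 = 0 both \<open>v\<close> and the odd
  function \<open>w k\<close> vanish, and near the outer circle \<open>w k\<close> equals x_1, while
  0 < x_1 < 5 gives v <= x_1; so v - w k - eta is negative near the whole boundary of the half disc.
  The flux is parallel to the x_1-axis and both centres have x_1 = 0, so its sign at the holes is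
  that of x_1.\<close>

lemma linear_lower_bound_approx:
  assumes \<eta>: "\<eta> > 0"
  shows "AE x in M. x $ 1 > 0 \<longrightarrow> (x $ 1 + (x $ 1)\<^sup>2 / 5) / 2 - h x \<le> \<eta>"
proof -
  define U where "U = {x :: real^2. x $ 1 > 0} \<inter> ball 0 5"
  \<comment> \<open>The quadratic term only serves to make the subsolution strict.\<close>
  define v where "v x = (x $ 1 + (x $ 1)\<^sup>2 / 5) / 2" for x :: "real^2"
  define f where "f t = (1 + 2 * t / 5) / 2" for t :: real
  define X where "X x = f (x $ 1) powr (p - 1) *\<^sub>R (axis 1 1 :: real^2)" for x :: "real^2"
  define dX where "dX i x = (if i = 1 then (p - 1) * f (x $ 1) powr (p - 2) / 5 else 0)" for i :: 2 and x :: "real^2"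
  \<comment> \<open>The divergence is (p-1) f^(p-2) f' with f' = 1/5 and f between 1/2 and 3/2; the
    minimum covers both signs of p - 2.\<close>
  define d where "d = (p - 1) / 5 * min ((1/2) powr (p - 2)) ((3/2) powr (p - 2))"
  have x5: "0 < x $ 1" "x $ 1 < 5" if "x \<in> U" for x
    using that component_le_norm_cart[of x 1] by (auto simp: U_def)
  have f: "1/2 \<le> f (x $ 1)" "f (x $ 1) \<le> 3/2" if "x \<in> U" for x
    using x5[OF that] by (auto simp: f_def)
  have open_U: "open U"
    unfolding U_def by (intro open_Int open_ball open_Collect_less continuous_intros)
  have vs: "smooth_on A v" for A
  proof -
    have "smooth_on A (\<lambda>x. (1/2) * (x $ 1 + (1/5) * (x $ 1 * x $ 1)))"
      by (intro smooth_on_mult smooth_on_add smooth_on_const smooth_on_coord)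
    then show ?thesis by (simp add: v_def[abs_def] power2_eq_square)
  qed
  have gv: "grad v x = f (x $ 1) *\<^sub>R axis 1 1" for x
  proof -
    have "((\<lambda>t. v (x + t *\<^sub>R axis i 1)) has_real_derivative f (x $ 1) * (axis i 1 :: real^2) $ 1) (at 0)" for i
      unfolding v_def f_def by (auto intro!: derivative_eq_intros simp: field_simps)
    from partial_derivI[OF this] show ?thesis by (auto simp: vec_eq_iff axis_def)
  qed
  have "AE x in M. x \<in> U \<longrightarrow> (1::real) = 1 \<longrightarrow> v x - h x \<le> \<eta>"
  proof (rule comparison[where \<zeta> = "\<lambda>_. 1" and X = X and dX = dX and d = d and B = "(3/2) powr (p - 1)"])
    show "open U" "U \<subseteq> ball 0 5" "smooth_on U v" using open_U vs by (auto simp: U_def)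
    show "smooth_on UNIV (\<lambda>x. 1)" by auto
    show "norm (grad (\<lambda>x. 1) x) \<le> (3/2) powr (p - 1)" for x
    proof -
      have "partial_deriv i (\<lambda>x. 1) x = 0" for i by (rule partial_derivI) auto
      then have "grad (\<lambda>x. 1) x = 0" by (simp add: vec_eq_iff)
      then show ?thesis by simp
    qed
    fix x assume x: "x \<in> U"
    show "X x = pflux p (grad v x)"
      using f[OF x] by (simp add: gv X_def pflux_scaleR) (simp add: pflux_def)
    show "norm (X x) \<le> (3/2) powr (p - 1)"
      using f[OF x] p_gt_1 by (auto simp: X_def intro!: powr_mono2)
    fix i
    have "((\<lambda>t. f ((x + t *\<^sub>R axis i 1) $ 1) powr (p - 1)) has_real_derivative
        (p - 1) * f (x $ 1) powr (p - 2) * ((axis i 1 :: real^2) $ 1 / 5)) (at 0)"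
      using f[OF x] unfolding f_def by (auto intro!: derivative_eq_intros simp: field_simps)
    then show "((\<lambda>t. X (x + t *\<^sub>R axis i 1) $ i) has_real_derivative dX i x) (at 0)"
      by (cases "i = 1") (auto simp: X_def dX_def axis_def)
  next
    have f0: "f (x $ 1) \<noteq> 0" if "x \<in> U" for x using f[OF that] by auto
    have cf: "continuous_on U (\<lambda>x. f (x $ 1))" unfolding f_def by (intro continuous_intros) auto
    show "continuous_on U X" unfolding X_def by (intro continuous_intros cf) (use f0 in auto)
    show "continuous_on U (dX i)" for i
      by (cases "i = 1") (auto simp: dX_def[abs_def] f0 intro!: continuous_intros cf)
    show "d > 0" using p_gt_1 by (simp add: d_def)
    fix x assume "x \<in> U \<inter> Omega_t \<epsilon>"
    then have x: "x \<in> U" by simp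
    show "d \<le> dX 1 x + dX 2 x"
      using powr_between(1)[OF _ f[OF x], of "p - 2"] p_gt_1 mult_left_mono[of _ _ "(p - 1) / 5"]
      by (simp add: d_def dX_def)
    show "0 \<le> X x \<bullet> (x - upper_center \<epsilon>) \<and> 0 \<le> X x \<bullet> (x - lower_center \<epsilon>)"
      using x5[OF x] by (simp add: X_def inner_axis')
  next
    fix k
    obtain S where S: "compact S" "S \<subseteq> ball 0 5" "\<And>x. x \<notin> S \<Longrightarrow> w k x - x $ 1 = 0"
      using test_fun_support[OF w_test[of k]] by blast
    \<comment> \<open>The closed half plane makes \<open>K\<close> compact; the positive level eta
      keeps it off the line x_1 = 0.\<close>
    define K where "K = S \<inter> {x. 0 \<le> x $ 1} \<inter> {x. \<eta> \<le> v x - w k x}"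
    have "closed {x. \<eta> \<le> v x - w k x}"
      using smooth_on_imp_continuous_on[OF vs] smooth_on_imp_continuous_on[OF w_smooth]
      by (intro closed_Collect_le continuous_intros) auto
    moreover have "closed {x :: real^2. 0 \<le> x $ 1}" by (intro closed_Collect_le continuous_intros)
    ultimately have "compact K" unfolding K_def using S(1) by (intro compact_Int_closed)
    moreover have "K \<subseteq> U"
    proof
      fix x assume x: "x \<in> K"
      have "x $ 1 \<noteq> 0"
      proof
        assume 0: "x $ 1 = 0"
        then have "mirror x = x" by (simp add: vec_eq_iff forall_2 mirror_nth)
        then have "w k x = 0" using w_odd[of k x] by simp
        then show False using x \<eta> 0 by (simp add: K_def v_def)
      qed
      then show "x \<in> U" using x S(2) by (auto simp: K_def U_def)
    qed
    moreover have "1 * flat_exp (v x - w k x - \<eta>) = 0" if x: "x \<in> U - K" for x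
    proof (cases "x \<in> S")
      case True
      then show ?thesis using x x5[of x] by (auto simp: K_def)
    next
      case False
      have "(x $ 1)\<^sup>2 \<le> 5 * x $ 1" using x5[of x] x by (simp add: power2_eq_square)
      then show ?thesis using S(3)[OF False] \<eta> by (simp add: v_def)
    qed
    ultimately show "\<exists>K. compact K \<and> K \<subseteq> U \<and> (\<forall>x\<in>U - K. 1 * flat_exp (v x - w k x - \<eta>) = 0)" by blast
  qed auto
  moreover have "AE x in M. x \<in> Omega_t \<epsilon>" by (rule AE_I2) simp
  ultimately show ?thesis
    by eventually_elim (auto simp: U_def v_def Omega_t_eq)
qed

lemma AE_le_of_all_pos:
  assumes "\<And>\<eta>. \<eta> > 0 \<Longrightarrow> AE x in M. P x \<longrightarrow> f x - h x \<le> \<eta>"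
  shows "AE x in M. P x \<longrightarrow> f x \<le> h x"
proof -
  have "AE x in M. \<forall>n. P x \<longrightarrow> f x - h x \<le> 1 / real (Suc n)"
    by (subst AE_all_countable) (use assms in auto)
  then show ?thesis
  proof eventually_elim
    case (elim x)
    show ?case
    proof
      assume "P x"
      then have "f x - h x \<le> 1 / real (Suc n)" for n using elim by blast
      then have "f x - h x \<le> 0"
        by (intro LIMSEQ_le_const[OF LIMSEQ_Suc[OF lim_1_over_n]]) auto
      then show "f x \<le> h x" by simp
    qed
  qed
qed

lemma linear_lower_bound: "AE x in M. x $ 1 > 0 \<longrightarrow> x $ 1 / 2 \<le> h x"
proof -
  have "AE x in M. x $ 1 > 0 \<longrightarrow> (x $ 1 + (x $ 1)\<^sup>2 / 5) / 2 \<le> h x"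
    by (rule AE_le_of_all_pos[OF linear_lower_bound_approx])
  then show ?thesis
  proof eventually_elim
    case (elim x)
    show ?case
    proof
      assume "x $ 1 > 0"
      then have "(x $ 1 + (x $ 1)\<^sup>2 / 5) / 2 \<le> h x" using elim by blast
      moreover have "a / 2 \<le> (a + a\<^sup>2 / 5) / 2" for a :: real by (simp add: field_simps)
      ultimately show "x $ 1 / 2 \<le> h x" by (rule order_trans[rotated])
    qed
  qed
qed

end

section \<open>Gradient bounds from a height difference\<close>

lemma strip_in_Omega_t:
  assumes "0 < \<epsilon>" "\<bar>x $ 2\<bar> < \<epsilon> / 2" "\<bar>x $ 1\<bar> + \<bar>x $ 2\<bar> < 5"
  shows "x \<in> Omega_t \<epsilon>"
proof -
  have "norm x < 5"
    using norm_le_l1_cart[of x] assms(3) by (simp add: sum_2)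
  moreover have "1 < norm (x - upper_center \<epsilon>)" "1 < norm (x - lower_center \<epsilon>)"
    using component_le_norm_cart[of "x - upper_center \<epsilon>" 2] component_le_norm_cart[of "x - lower_center \<epsilon>" 2]
      assms by auto
  ultimately show ?thesis by (simp add: Omega_t_eq perforated_def)
qed

context odd_solution
begin

text \<open>The bound on \<open>g\<close> holds only almost everywhere, so a small square rather
  than a point is moved along the x_1-axis, inside the strip between the discs. The integral of
  \<open>w k\<close> over the square is 0 at the origin by oddness, so its value at distance
  \<open>X\<close> is at most \<open>X\<close> times a bound for its derivative. Letting k tend to
  infinity removes both errors.\<close>

lemma gradient_ge_slope:
  assumes r: "0 < r" "r < \<epsilon> / 2" and X: "0 < X" "X + 2 * r < 5" "X + 2 * r < R"
    and h_ge: "AE x in M. \<bar>x $ 1 - X\<bar> \<le> r \<and> \<bar>x $ 2\<bar> \<le> r \<longrightarrow> m \<le> h x"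
    and g_le: "AE x in M. x \<in> ball 0 R \<longrightarrow> norm (g x) \<le> N"
  shows "m \<le> N * X"
proof -
  define e where "e = (axis 1 1 :: real^2)"
  define Q where "Q = cbox (vector [-r, -r]) (vector [r, r] :: real^2)"
  define Qt where "Qt t = {y. y - t *\<^sub>R e \<in> Q}" for t
  define \<mu> where "\<mu> = measure lborel Q"
  have Q: "x \<in> Q \<longleftrightarrow> \<bar>x $ 1\<bar> \<le> r \<and> \<bar>x $ 2\<bar> \<le> r" for x
    unfolding Q_def mem_box_cart by (auto simp: forall_2)
  have Qt: "x \<in> Qt t \<longleftrightarrow> \<bar>x $ 1 - t\<bar> \<le> r \<and> \<bar>x $ 2\<bar> \<le> r" for x t
    unfolding Qt_def by (simp add: Q e_def axis_def)
  have Qsets [measurable]: "Q \<in> sets borel" unfolding Q_def by simp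
  have Qtsets [measurable]: "Qt t \<in> sets borel" for t unfolding Qt_def by measurable
  have Qt_Omega: "x \<in> Omega_t \<epsilon>" "x \<in> ball 0 R" if "x \<in> Qt t" "0 \<le> t" "t \<le> X" for x t
  proof -
    have "\<bar>x $ 1\<bar> + \<bar>x $ 2\<bar> \<le> X + 2 * r" "\<bar>x $ 2\<bar> \<le> r" using that by (auto simp: Qt)
    then show "x \<in> Omega_t \<epsilon>" "x \<in> ball 0 R"
      using strip_in_Omega_t[OF eps(1), of x] r X norm_le_l1_cart[of x] by (auto simp: sum_2)
  qed
  have shift: "integral\<^sup>L lborel (\<lambda>x. indicator Q x * f (x + t *\<^sub>R e)) = integral\<^sup>L M (\<lambda>x. indicator (Qt t) x * f x)"
    if f: "f \<in> borel_measurable borel" and t: "0 \<le> t" "t \<le> X" for f :: "real^2 \<Rightarrow> real" and t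
  proof -
    have m: "(\<lambda>x. indicator (Qt t) x * f x) \<in> borel_measurable borel" using f by measurable
    have "integral\<^sup>L lborel (\<lambda>x. indicator Q x * f (x + t *\<^sub>R e))
        = integral\<^sup>L lborel (\<lambda>x. indicator (Qt t) (x + t *\<^sub>R e) * f (x + t *\<^sub>R e))"
      by (rule Bochner_Integration.integral_cong) (auto simp: indicator_def Qt_def)
    also have "\<dots> = integral\<^sup>L lborel (\<lambda>x. indicator (Qt t) x * f x)"
      by (rule lborel_integral_shift[OF m])
    also have "\<dots> = integral\<^sup>L lborel (\<lambda>x. indicator (Omega_t \<epsilon>) x * (indicator (Qt t) x * f x))"
      by (rule Bochner_Integration.integral_cong) (use Qt_Omega t in \<open>auto simp: indicator_def\<close>)
    also have "\<dots> = integral\<^sup>L M (\<lambda>x. indicator (Qt t) x * f x)"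
      by (rule integral_lebesgue_on_Omega_t[OF m, symmetric])
    finally show ?thesis .
  qed
  have mu: "integral\<^sup>L M (indicator (Qt t)) = \<mu>" if "0 \<le> t" "t \<le> X" for t
    using shift[OF _ that, of "\<lambda>_. 1"] by (simp add: \<mu>_def)
  have mu_pos: "\<mu> > 0"
  proof -
    have "\<mu> = (\<Prod>b\<in>Basis. (vector [r, r] - vector [-r, -r] :: real^2) \<bullet> b)"
      unfolding \<mu>_def Q_def
      using r by (subst measure_lborel_cbox) (auto simp: Basis_vec_def inner_axis vector_def)
    also have "\<dots> > 0"
    proof (rule prod_pos)
      fix b :: "real^2" assume "b \<in> Basis"
      then obtain i where "b = axis i 1" by (auto simp: Basis_vec_def)
      then show "(vector [r, r] - vector [-r, -r]) \<bullet> b > 0"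
        using r exhaust_2[of i] by (auto simp: inner_axis)
    qed
    finally show ?thesis .
  qed
  have key: "m * \<mu> - integral\<^sup>L M (\<lambda>x. \<bar>w k x - h x\<bar>) \<le>
      X * (N * \<mu> + integral\<^sup>L M (\<lambda>x. norm (grad (w k) x - g x)))" for k
  proof -
    define w1 where "w1 = partial_deriv 1 (w k)"
    have wc: "continuous_on UNIV (w k)" by (rule smooth_on_imp_continuous_on[OF w_smooth])
    have w1c: "continuous_on UNIV w1"
      unfolding w1_def by (rule smooth_on_imp_continuous_on[OF smooth_on_partial_deriv[OF w_smooth]]) auto
    have [measurable]: "w k \<in> borel_measurable borel" "w1 \<in> borel_measurable borel"
      using wc w1c by (auto intro: borel_measurable_continuous_onI)
    \<comment> \<open>Differentiation in the translation parameter is done for the gauge integral;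
      this identity links it to the Lebesgue integral.\<close>
    have HK: "integral Q f = integral\<^sup>L lborel (\<lambda>x. indicator Q x * f x)" if "continuous_on UNIV f" for f :: "real^2 \<Rightarrow> real"
    proof -
      have "set_integrable lborel Q f"
        unfolding set_integrable_def Q_def
        by (rule borel_integrable_compact) (use that continuous_on_subset in auto)
      from set_borel_integral_eq_integral(2)[OF this] show ?thesis
        by (simp add: set_lebesgue_integral_def)
    qed
    have csh: "continuous_on UNIV (\<lambda>x. f (x + t *\<^sub>R e))" if "continuous_on UNIV f" for f :: "real^2 \<Rightarrow> real" and t
      by (intro continuous_on_compose2[OF that] continuous_intros) auto
    define \<Theta> where "\<Theta> t = integral Q (\<lambda>x. w k (x + t *\<^sub>R e))" for t
    define \<Theta>' where "\<Theta>' t = integral Q (\<lambda>x. w1 (x + t *\<^sub>R e))" for t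
    have \<Theta>: "\<Theta> t = integral\<^sup>L M (\<lambda>x. indicator (Qt t) x * w k x)"
      "\<Theta>' t = integral\<^sup>L M (\<lambda>x. indicator (Qt t) x * w1 x)" if "0 \<le> t" "t \<le> X" for t
      unfolding \<Theta>_def \<Theta>'_def HK[OF csh[OF wc]] HK[OF csh[OF w1c]] using shift[OF _ that] by auto
    have "(\<Theta> has_real_derivative \<Theta>' t) (at t)" for t
      unfolding \<Theta>_def \<Theta>'_def Q_def
    proof (rule leibniz_rule_field_derivative[where U = UNIV and fx = "\<lambda>t x. w1 (x + t *\<^sub>R e)", simplified])
      show "((\<lambda>t. w k (x + t *\<^sub>R e)) has_real_derivative w1 (x + t *\<^sub>R e)) (at t)" for t x
        by (rule has_derivative_along_line)
           (use smooth_on_has_partial_deriv[OF w_smooth] in \<open>auto simp: e_def w1_def\<close>)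
      show "(\<lambda>x. w k (x + t *\<^sub>R e)) integrable_on cbox (vector [- r, - r]) (vector [r, r])" for t
        by (intro integrable_continuous continuous_on_subset[OF csh[OF wc]]) simp
      show "continuous_on (UNIV \<times> cbox (vector [- r, - r]) (vector [r, r])) (\<lambda>(t, x). w1 (x + t *\<^sub>R e))"
        unfolding case_prod_beta by (intro continuous_on_compose2[OF w1c] continuous_intros) auto
    qed
    then have "\<exists>z>0. z < X \<and> \<Theta> X - \<Theta> 0 = (X - 0) * \<Theta>' z"
      by (intro MVT2[OF X(1)]) auto
    \<comment> \<open>The point \<open>z\<close> depends on k; this is harmless, as the bound on
      \<open>\<Theta>'\<close> below holds at every position.\<close>
    then obtain z where z: "0 < z" "z < X" "\<Theta> X - \<Theta> 0 = X * \<Theta>' z" by auto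
    have "\<Theta> 0 = 0"
    proof -
      define F where "F x = indicator Q x * w k x" for x
      have Fm: "F \<in> borel_measurable lebesgue"
        unfolding F_def by (intro measurable_completion) measurable
      have "integral\<^sup>L lebesgue F = integral\<^sup>L (distr lebesgue lebesgue mirror) F"
        by (simp add: distr_lebesgue_mirror)
      also have "\<dots> = integral\<^sup>L lebesgue (\<lambda>x. F (mirror x))"
        by (rule integral_distr[OF mirror_lebesgue_measurable Fm])
      also have "(\<lambda>x. F (mirror x)) = (\<lambda>x. - F x)"
        by (auto simp: F_def w_odd indicator_def Q mirror_nth)
      finally have "integral\<^sup>L lebesgue F = 0" by simp
      moreover have "integral\<^sup>L lebesgue F = integral\<^sup>L lborel F"
        by (rule integral_completion) (simp add: F_def[abs_def])
      ultimately show ?thesis using HK[OF wc] by (simp add: \<Theta>_def F_def[abs_def])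
    qed
    have ind [measurable]: "indicator (Qt t) \<in> borel_measurable M" for t
      by (intro measurable_restrict_space1 measurable_completion) measurable
    have im: "integrable M (\<lambda>x. indicator (Qt t) x * f x)" if c: "continuous_on UNIV f" for f :: "real^2 \<Rightarrow> real" and t
    proof -
      have "bounded (f ` cball 0 5)"
        using c by (intro compact_imp_bounded compact_continuous_image) (auto intro: continuous_on_subset)
      then obtain b where b: "\<And>x. x \<in> cball 0 5 \<Longrightarrow> norm (f x) \<le> b" unfolding bounded_iff by blast
      have b0: "b \<ge> 0" using b[of 0] by simp
      note [measurable] = measurable_lebesgue_on_Omega[OF c, of "Omega_t \<epsilon>"]
      show ?thesis
      proof (rule M.integrable_const_bound[where B = b])
        show "AE x in M. norm (indicator (Qt t) x * f x) \<le> b"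
          using b b0 by (intro AE_I2) (auto simp: Omega_t_eq indicator_def)
      qed measurable
    qed
    have ii: "integrable M (indicator (Qt t) :: _ \<Rightarrow> real)" for t using im[of "\<lambda>_. 1"] by simp
    have "m * \<mu> - integral\<^sup>L M (\<lambda>x. \<bar>w k x - h x\<bar>) =
        integral\<^sup>L M (\<lambda>x. m * indicator (Qt X) x - \<bar>w k x - h x\<bar>)"
      using mu[of X] X(1) ii w_L1(1) by simp
    also have "\<dots> \<le> \<Theta> X"
      unfolding \<Theta>(1)[OF less_imp_le[OF X(1)] order_refl]
    proof (rule integral_mono_AE)
      show "integrable M (\<lambda>x. m * indicator (Qt X) x - \<bar>w k x - h x\<bar>)"
        using ii w_L1(1) by simp
      show "AE x in M. m * indicator (Qt X) x - \<bar>w k x - h x\<bar> \<le> indicator (Qt X) x * w k x"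
        using h_ge by eventually_elim (auto simp: indicator_def Qt)
    qed (rule im[OF wc])
    also have "\<Theta> X = X * \<Theta>' z" using z \<open>\<Theta> 0 = 0\<close> by simp
    also have "\<Theta>' z \<le> N * \<mu> + integral\<^sup>L M (\<lambda>x. norm (grad (w k) x - g x))"
    proof -
      have "\<Theta>' z \<le> integral\<^sup>L M (\<lambda>x. N * indicator (Qt z) x + norm (grad (w k) x - g x))"
        unfolding \<Theta>(2)[OF less_imp_le[OF z(1)] less_imp_le[OF z(2)]]
      proof (rule integral_mono_AE)
        show "integrable M (\<lambda>x. N * indicator (Qt z) x + norm (grad (w k) x - g x))"
          using ii gw_L1(1) by simp
        show "AE x in M. indicator (Qt z) x * w1 x \<le> N * indicator (Qt z) x + norm (grad (w k) x - g x)"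
          using g_le
        proof eventually_elim
          case (elim x)
          show ?case
          proof (cases "x \<in> Qt z")
            case True
            then have "norm (g x) \<le> N" using elim Qt_Omega(2)[OF True] z by auto
            moreover have "w1 x \<le> norm (grad (w k) x)"
              using component_le_norm_cart[of "grad (w k) x" 1] by (simp add: w1_def)
            moreover have "norm (grad (w k) x) \<le> norm (g x) + norm (grad (w k) x - g x)"
              by (rule norm_triangle_sub)
            ultimately show ?thesis using True by simp
          qed simp
        qed
      qed (rule im[OF w1c])
      also have "\<dots> = N * \<mu> + integral\<^sup>L M (\<lambda>x. norm (grad (w k) x - g x))"
        using mu[of z] z ii gw_L1(1) by simp
      finally show ?thesis .
    qed
    finally show ?thesis using X(1) by simp
  qed
  have "(\<lambda>k. m * \<mu> - integral\<^sup>L M (\<lambda>x. \<bar>w k x - h x\<bar>)) \<longlonglongrightarrow> m * \<mu> - 0"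
    by (intro tendsto_intros w_L1)
  moreover have "(\<lambda>k. X * (N * \<mu> + integral\<^sup>L M (\<lambda>x. norm (grad (w k) x - g x)))) \<longlonglongrightarrow> X * (N * \<mu> + 0)"
    by (intro tendsto_intros gw_L1)
  ultimately have "m * \<mu> - 0 \<le> X * (N * \<mu> + 0)"
    by (rule LIMSEQ_le) (use key in auto)
  then have "m * \<mu> \<le> (N * X) * \<mu>" by (simp add: mult_ac)
  then show ?thesis using mu_pos by simp
qed

end

section \<open>The barrier in the neck\<close>

lemma Omega_t_coords:
  assumes "x \<in> Omega_t \<epsilon>" "\<epsilon> > 0"
  shows "2 * \<bar>x $ 2\<bar> * (1 + \<epsilon> / 2) < (x $ 1)\<^sup>2 + (x $ 2)\<^sup>2 + \<epsilon> + \<epsilon>\<^sup>2 / 4"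
proof -
  have n: "(norm y)\<^sup>2 = (y $ 1)\<^sup>2 + (y $ 2)\<^sup>2" for y :: "real^2"
    by (simp add: norm_eq_sqrt_inner inner_vec_def sum_2 power2_eq_square)
  have "1 < (norm (x - upper_center \<epsilon>))\<^sup>2" "1 < (norm (x - lower_center \<epsilon>))\<^sup>2"
    using assms(1) by (auto simp: Omega_t_eq perforated_def one_less_power)
  then have "1 < (x $ 1)\<^sup>2 + (x $ 2 - (1 + \<epsilon> / 2))\<^sup>2" "1 < (x $ 1)\<^sup>2 + (x $ 2 - (- 1 - \<epsilon> / 2))\<^sup>2"
    unfolding n by auto
  moreover have "(a - (1 + \<epsilon> / 2))\<^sup>2 = a\<^sup>2 - 2 * a * (1 + \<epsilon> / 2) + 1 + \<epsilon> + \<epsilon>\<^sup>2 / 4"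
    "(a - (- 1 - \<epsilon> / 2))\<^sup>2 = a\<^sup>2 + 2 * a * (1 + \<epsilon> / 2) + 1 + \<epsilon> + \<epsilon>\<^sup>2 / 4" for a
    by (simp_all add: power2_eq_square field_simps)
  ultimately show ?thesis by (cases "x $ 2 \<ge> 0") auto
qed

text \<open>The terms in eps amount to at most (5/4) eps, which the threshold turns into x^2/4 +
  y^2/2. As y^2 <= |y|/2, this gives 2|y| <= (5/4) x^2 + (3/4)|y|.\<close>

lemma neck_width:
  fixes x y \<epsilon> k :: real
  assumes "0 < \<epsilon>" "\<epsilon> < 1" "2 * \<bar>y\<bar> * (1 + \<epsilon> / 2) < x\<^sup>2 + y\<^sup>2 + \<epsilon> + \<epsilon>\<^sup>2 / 4" "\<bar>y\<bar> < 1/2"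
    "5 * \<epsilon> \<le> x\<^sup>2 + k * y\<^sup>2" "k \<le> 2"
  shows "\<bar>y\<bar> \<le> x\<^sup>2"
proof -
  have y2: "y\<^sup>2 \<le> \<bar>y\<bar> / 2"
    using mult_left_mono[of "\<bar>y\<bar>" "1/2" "\<bar>y\<bar>"] assms(4) by (simp add: power2_eq_square)
  have "k * y\<^sup>2 \<le> 2 * y\<^sup>2" using assms(6) by (intro mult_right_mono) auto
  moreover have "\<epsilon>\<^sup>2 \<le> \<epsilon>" using assms(1,2) by (simp add: power2_eq_square)
  moreover have "2 * \<bar>y\<bar> \<le> 2 * \<bar>y\<bar> * (1 + \<epsilon> / 2)" using assms(1) by (simp add: algebra_simps)
  ultimately show ?thesis using assms(3,5) y2 by linarith
qed

text \<open>The sign of the barrier's conormal derivative at the holes. Since k/2 = 1 - delta/4,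
  replacing \<open>k\<close> by 2 on the left would use up everything; the gap leaves room for
  (delta/4)(x^2 + k y^2), which by the threshold absorbs (5/4) eps.\<close>

lemma neck_outward:
  fixes x y \<epsilon> \<delta> k :: real
  assumes "0 < \<epsilon>" "\<epsilon> < 1" "0 < \<delta>" "\<delta> < 1" "k = 2 - \<delta> / 2"
    "2 * \<bar>y\<bar> * (1 + \<epsilon> / 2) < x\<^sup>2 + y\<^sup>2 + \<epsilon> + \<epsilon>\<^sup>2 / 4" "5 * \<epsilon> \<le> \<delta> * (x\<^sup>2 + k * y\<^sup>2)"
  shows "k * \<bar>y\<bar> * (1 + \<epsilon> / 2) \<le> x\<^sup>2 + k * y\<^sup>2"
proof -
  have e2: "\<epsilon>\<^sup>2 \<le> \<epsilon>" using assms(1,2) by (simp add: power2_eq_square)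
  have k: "1 \<le> k" "k \<le> 2" using assms by auto
  have "k * \<bar>y\<bar> * (1 + \<epsilon> / 2) = (k / 2) * (2 * \<bar>y\<bar> * (1 + \<epsilon> / 2))" by simp
  also have "\<dots> \<le> (k / 2) * (x\<^sup>2 + y\<^sup>2 + 5/4 * \<epsilon>)"
    using assms(6) e2 k by (intro mult_left_mono) auto
  also have "\<dots> = (k / 2) * (x\<^sup>2 + y\<^sup>2) + (k / 2) * (5/4 * \<epsilon>)" by (simp add: distrib_left)
  also have "(k / 2) * (5/4 * \<epsilon>) \<le> 1 * (5/4 * \<epsilon>)" using k assms(1) by (intro mult_right_mono) auto
  also have "1 * (5/4 * \<epsilon>) \<le> (\<delta> / 4) * (x\<^sup>2 + k * y\<^sup>2)" using assms(7) by simp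
  finally have "k * \<bar>y\<bar> * (1 + \<epsilon> / 2) \<le> (k / 2) * (x\<^sup>2 + y\<^sup>2) + (\<delta> / 4) * (x\<^sup>2 + k * y\<^sup>2)" by simp
  also have "\<dots> = x\<^sup>2 + k * y\<^sup>2 - (k / 2) * (1 - \<delta> / 2) * y\<^sup>2"
    by (simp add: assms(5) field_simps)
  also have "\<dots> \<le> x\<^sup>2 + k * y\<^sup>2" using k assms(4) by simp
  finally show ?thesis .
qed

text \<open>With A = x_1^2 and B = x_2^2 the right side is the divergence of the barrier's flux up
  to a positive factor. For B = 0 it equals (gamma-1)(p-1) + k >= 3 delta/2. Nonzero B costs at most
  4 p B/A <= delta/2, which explains the bound delta/(8p) and hence the length rho of the
  neck.\<close>

lemma barrier_divergence_factor:
  fixes A B k \<gamma> \<delta> p :: real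
  assumes p: "p > 1" and d: "0 < \<delta>" "\<delta> < 1" and k: "k = 2 - \<delta> / 2"
    and A: "0 < A" "0 \<le> B" "B \<le> \<delta> / (8 * p) * A"
    and \<gamma>: "0 \<le> \<gamma>" "\<gamma> \<le> 1" "(1 - \<gamma>) * (p - 1) \<le> 2 * (1 - \<delta>)"
  shows "\<delta> \<le> (\<gamma> - 2) * (p - 1) * ((A + k\<^sup>2 * B) / (A + k * B)) +
     (p - 2) * ((A + k ^ 3 * B) / (A + k\<^sup>2 * B)) + 1 + k"
proof -
  have k12: "1 \<le> k" "k \<le> 2" using d k by auto
  define y where "y = B / A"
  have y: "0 \<le> y" "y \<le> \<delta> / (8 * p)" using A by (auto simp: y_def field_simps)
  have pos: "A + k * B > 0" "A + k\<^sup>2 * B > 0" using A k12 by (auto intro: add_pos_nonneg)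
  have k2: "k\<^sup>2 - k \<le> 2" "0 \<le> k\<^sup>2 - k"
  proof -
    have "k\<^sup>2 - k = k * (k - 1)" by (simp add: power2_eq_square algebra_simps)
    moreover have "k * (k - 1) \<le> 2 * 1" using k12 by (intro mult_mono) auto
    ultimately show "k\<^sup>2 - k \<le> 2" "0 \<le> k\<^sup>2 - k" using k12 by auto
  qed
  have k3: "k ^ 3 - k\<^sup>2 \<le> 4" "0 \<le> k ^ 3 - k\<^sup>2"
  proof -
    have "k ^ 3 - k\<^sup>2 = k * (k\<^sup>2 - k)" by (simp add: power2_eq_square power3_eq_cube algebra_simps)
    moreover have "k * (k\<^sup>2 - k) \<le> 2 * 2" using k12 k2 by (intro mult_mono) auto
    ultimately show "k ^ 3 - k\<^sup>2 \<le> 4" "0 \<le> k ^ 3 - k\<^sup>2" using k12 k2 by auto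
  qed
  have r1: "(A + k\<^sup>2 * B) / (A + k * B) \<le> 1 + 2 * y"
  proof -
    have "(A + k\<^sup>2 * B) / (A + k * B) = 1 + (k\<^sup>2 - k) * B / (A + k * B)"
      using pos by (simp add: field_simps)
    also have "(k\<^sup>2 - k) * B / (A + k * B) \<le> 2 * B / A"
      using A k12 k2 by (intro frac_le mult_right_mono) auto
    finally show ?thesis by (simp add: y_def)
  qed
  have r2: "1 \<le> (A + k ^ 3 * B) / (A + k\<^sup>2 * B)" "(A + k ^ 3 * B) / (A + k\<^sup>2 * B) \<le> 1 + 4 * y"
  proof -
    have e: "(A + k ^ 3 * B) / (A + k\<^sup>2 * B) = 1 + (k ^ 3 - k\<^sup>2) * B / (A + k\<^sup>2 * B)"
      using pos by (simp add: field_simps)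
    have "(k ^ 3 - k\<^sup>2) * B / (A + k\<^sup>2 * B) \<le> 4 * B / A"
      using A k12 k3 by (intro frac_le mult_right_mono) auto
    then show "(A + k ^ 3 * B) / (A + k\<^sup>2 * B) \<le> 1 + 4 * y" unfolding e by (simp add: y_def)
    show "1 \<le> (A + k ^ 3 * B) / (A + k\<^sup>2 * B)"
      unfolding e using A(2) k3(2) pos by simp
  qed
  have 1: "(\<gamma> - 2) * (p - 1) - 4 * (p - 1) * y \<le> (\<gamma> - 2) * (p - 1) * ((A + k\<^sup>2 * B) / (A + k * B))"
  proof -
    have c: "(\<gamma> - 2) * (p - 1) \<le> 0" using p \<gamma> by (intro mult_nonpos_nonneg) auto
    have "(\<gamma> - 2) * (p - 1) * (1 + 2 * y) \<le> (\<gamma> - 2) * (p - 1) * ((A + k\<^sup>2 * B) / (A + k * B))"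
      using r1 c by (intro mult_left_mono_neg)
    moreover have "- 2 * ((p - 1) * (2 * y)) \<le> (\<gamma> - 2) * ((p - 1) * (2 * y))"
      using \<gamma> p y by (intro mult_right_mono) auto
    ultimately show ?thesis by (simp add: algebra_simps)
  qed
  have 2: "(p - 2) - 4 * y \<le> (p - 2) * ((A + k ^ 3 * B) / (A + k\<^sup>2 * B))"
  proof (cases "p \<ge> 2")
    case True
    then have "(p - 2) * 1 \<le> (p - 2) * ((A + k ^ 3 * B) / (A + k\<^sup>2 * B))"
      using r2 by (intro mult_left_mono) auto
    then show ?thesis using y by simp
  next
    case False
    then have "(p - 2) * (1 + 4 * y) \<le> (p - 2) * ((A + k ^ 3 * B) / (A + k\<^sup>2 * B))"
      using r2 by (intro mult_left_mono_neg) auto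
    moreover have "(- 1) * (4 * y) \<le> (p - 2) * (4 * y)" using p y by (intro mult_right_mono) auto
    ultimately show ?thesis by (simp add: algebra_simps)
  qed
  have 3: "4 * p * y \<le> \<delta> / 2"
    using mult_left_mono[OF y(2), of "4 * p"] p by (simp add: field_simps)
  have "\<delta> \<le> (\<gamma> - 1) * (p - 1) + k - 4 * p * y"
    using \<gamma>(3) 3 by (simp add: k algebra_simps)
  also have "\<dots> = ((\<gamma> - 2) * (p - 1) - 4 * (p - 1) * y) + ((p - 2) - 4 * y) + 1 + k"
    by (simp add: algebra_simps)
  finally show ?thesis using 1 2 by linarith
qed

lemma grad_bounded_of_compact_support:
  assumes "smooth_on UNIV f" "compact K" "\<And>x. x \<notin> K \<Longrightarrow> f x = 0"
  obtains B where "\<And>x. norm (grad f x) \<le> B"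
proof -
  have g0: "grad f x = 0" if "x \<notin> K" for x
  proof -
    have "partial_deriv i f x = 0" for i
      by (rule partial_derivI, rule has_partial_cong_open[of "- K" _ _ "\<lambda>_. 0"])
         (use that assms compact_imp_closed in auto)
    then show ?thesis by (simp add: vec_eq_iff)
  qed
  have "bounded (grad f ` K)"
    using assms(2) continuous_on_grad[OF assms(1)]
    by (intro compact_imp_bounded compact_continuous_image) (auto intro: continuous_on_subset)
  then obtain b where b: "\<And>x. x \<in> K \<Longrightarrow> norm (grad f x) \<le> b" unfolding bounded_iff by blast
  have "norm (grad f x) \<le> max b 0" for x
    using b[of x] g0[of x] by (cases "x \<in> K") auto
  then show thesis by (rule that)
qed

context odd_solution
begin

text \<open>The thresholds 5, 6 and 7 times L^2 belong to the region of the subsolution, the support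
  of the cutoff and the set where the cutoff is 1. To apply \<open>comparison\<close>, v > h + eta
  must force the cutoff to be 1. By the linear bound such a point has v > x_1/2 > 0. Positivity
  gives s > 7 L^2; with s <= 2 x_1^2 this gives x_1 >= L; and v <= rho/4 gives x_1 <= rho/2.\<close>

lemma neck_lower_bound_approx:
  fixes L k \<gamma> \<rho> \<delta> \<eta> :: real
  assumes \<delta>: "0 < \<delta>" "\<delta> < 1" and L: "L = sqrt (\<epsilon> / \<delta>)" and k: "k = 2 - \<delta> / 2"
    and \<gamma>: "\<gamma> = 1 - 2 * (1 - \<delta>) / max (p - 1) 2" and \<rho>: "\<rho> = sqrt (\<delta> / (8 * p))"
    and \<eta>: "\<eta> > 0"
  shows "AE x in M. 7 * L\<^sup>2 \<le> (x $ 1)\<^sup>2 + k * (x $ 2)\<^sup>2 \<and> L \<le> x $ 1 \<and> x $ 1 \<le> \<rho> / 2 \<and> (x $ 2)\<^sup>2 \<le> 1 / 16 \<longrightarrow>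
     \<rho> / 4 * ((x $ 1)\<^sup>2 + k * (x $ 2)\<^sup>2) powr (\<gamma> / 2) - \<rho> / 4 * (7 * L\<^sup>2) powr (\<gamma> / 2) - h x \<le> \<eta>"
proof -
  note p1 = p_gt_1
  have L0: "L > 0" and L2: "L\<^sup>2 = \<epsilon> / \<delta>" using \<delta> eps by (auto simp: L)
  have k12: "1 \<le> k" "k \<le> 2" using \<delta> k by auto
  have \<rho>2: "\<rho>\<^sup>2 = \<delta> / (8 * p)" using \<delta> p1 by (simp add: \<rho>)
  have \<rho>0: "\<rho> > 0" using \<delta> p1 by (simp add: \<rho>)
  have "\<rho>\<^sup>2 < (1/2)\<^sup>2"
  proof -
    have "\<delta> / (8 * p) < 1 / 8" using \<delta> p1 by (simp add: field_simps)
    then show ?thesis unfolding \<rho>2 by (simp add: power2_eq_square)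
  qed
  then have \<rho>12: "\<rho> < 1/2" by (rule power_less_imp_less_base) simp
  have \<gamma>01: "0 < \<gamma>" "\<gamma> \<le> 1" "(1 - \<gamma>) * (p - 1) \<le> 2 * (1 - \<delta>)"
  proof -
    have Q: "max (p - 1) 2 \<ge> 2" "max (p - 1) 2 \<ge> p - 1" by auto
    have "2 * (1 - \<delta>) / max (p - 1) 2 \<le> 2 * (1 - \<delta>) / 2"
      using Q \<delta> by (intro divide_left_mono) auto
    then show "0 < \<gamma>" "\<gamma> \<le> 1" using \<delta> Q by (auto simp: \<gamma>)
    have "(1 - \<gamma>) * (p - 1) = 2 * (1 - \<delta>) * ((p - 1) / max (p - 1) 2)" by (simp add: \<gamma>)
    also have "\<dots> \<le> 2 * (1 - \<delta>) * 1" using Q p1 \<delta> by (intro mult_left_mono) (auto simp: divide_le_eq_1)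
    finally show "(1 - \<gamma>) * (p - 1) \<le> 2 * (1 - \<delta>)" by simp
  qed
  \<comment> \<open>In the neck s <= 1, so the barrier is at most rho/4 and falls below x_1/2 once
    x_1 > rho/2.\<close>
  define a where "a = \<rho> / 4"
  have a0: "a > 0" using \<rho>0 by (simp add: a_def)
  define s where "s x = (x $ 1)\<^sup>2 + k * (x $ 2)\<^sup>2" for x :: "real^2"
  define m where "m x = (x $ 1)\<^sup>2 + k\<^sup>2 * (x $ 2)\<^sup>2" for x :: "real^2"
  \<comment> \<open>\<open>z\<close> is half the gradient of \<open>s\<close>, \<open>m\<close> is
    |z|^2, and \<open>y\<close> is half the gradient of \<open>m\<close>.\<close>
  define z where "z x = (vector [x $ 1, k * x $ 2] :: real^2)" for x :: "real^2"
  define y where "y x = (vector [x $ 1, k\<^sup>2 * x $ 2] :: real^2)" for x :: "real^2"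
  define v where "v x = a * s x powr (\<gamma> / 2) - a * (7 * L\<^sup>2) powr (\<gamma> / 2)" for x
  \<comment> \<open>The bound on x_2 separates the neck from the points of the domain above and
    below the two discs.\<close>
  define U where "U = {x. 5 * L\<^sup>2 < s x \<and> 0 < x $ 1 \<and> x $ 1 < \<rho> \<and> (x $ 2)\<^sup>2 < 1 / 4}"
  \<comment> \<open>The gradient of \<open>v\<close> is a gamma s^(gamma/2 - 1) z. The flux is
    homogeneous of degree p - 1, which yields \<open>c\<close> and the exponent
    \<open>\<beta>\<close>, and |z|^(p-2) = m^q.\<close>
  define c where "c = (a * \<gamma>) powr (p - 1)"
  define \<beta> where "\<beta> = (\<gamma> / 2 - 1) * (p - 1)"
  define q where "q = (p - 2) / 2"
  define X where "X x = (c * s x powr \<beta> * m x powr q) *\<^sub>R z x" for x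
  define dX where "dX i x = c * (\<beta> * s x powr (\<beta> - 1) * (2 * z x $ i) * m x powr q * z x $ i
      + s x powr \<beta> * (q * m x powr (q - 1) * (2 * y x $ i)) * z x $ i
      + s x powr \<beta> * m x powr q * (if i = 1 then 1 else k))" for i x
  \<comment> \<open>On \<open>U\<close> both \<open>s\<close> and \<open>m\<close> lie between 5 L^2
    and 2; end values bound their powers whatever the sign of the exponent.\<close>
  define S where "S = min ((5 * L\<^sup>2) powr \<beta>) (2 powr \<beta>) * min ((5 * L\<^sup>2) powr q) (2 powr q)"
  define S' where "S' = max ((5 * L\<^sup>2) powr \<beta>) (2 powr \<beta>) * max ((5 * L\<^sup>2) powr q) (2 powr q)"
  define \<zeta> where "\<zeta> x = smooth_step (s x / L\<^sup>2 - 6) * smooth_step (2 * x $ 1 / L - 1) *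
      smooth_step (3 - 4 * x $ 1 / \<rho>) * smooth_step (2 - 16 * (x $ 2)\<^sup>2)" for x
  have c0: "c > 0" using a0 \<gamma>01 by (simp add: c_def)
  have cont_s: "continuous_on A s" and cont_m: "continuous_on A m" and cont_z: "continuous_on A (\<lambda>x. z x $ i)"
    and cont_y: "continuous_on A (\<lambda>x. y x $ i)" for A i
  proof -
    show "continuous_on A s" "continuous_on A m"
      unfolding s_def m_def by (intro continuous_intros)+
    have "continuous_on A (\<lambda>x. z x $ 1)" "continuous_on A (\<lambda>x. z x $ 2)"
      "continuous_on A (\<lambda>x. y x $ 1)" "continuous_on A (\<lambda>x. y x $ 2)"
      unfolding z_def y_def by (auto intro!: continuous_intros)
    then show "continuous_on A (\<lambda>x. z x $ i)" "continuous_on A (\<lambda>x. y x $ i)"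
      using exhaust_2[of i] by auto
  qed
  have cont_zv: "continuous_on A z" for A
    using continuous_on_vec_lambda[of A "\<lambda>i x. z x $ i"] cont_z by simp
  have open_U: "open U"
    unfolding U_def by (intro open_Collect_conj open_Collect_less continuous_intros cont_s)
  have Uy: "\<bar>x $ 2\<bar> < 1 / 2" if "x \<in> U" for x
    using that abs_le_square_iff[of "1/2" "x $ 2"] by (auto simp: U_def power2_eq_square not_less[symmetric])
  have Ub: "5 * L\<^sup>2 \<le> s x" "s x \<le> 2" "5 * L\<^sup>2 \<le> m x" "m x \<le> 2" if "x \<in> U" for x
  proof -
    have x1: "(x $ 1)\<^sup>2 \<le> 1/4"
      using that \<rho>12 power_mono[of "x $ 1" "1/2" 2] by (auto simp: U_def power2_eq_square)
    have x2: "(x $ 2)\<^sup>2 \<le> 1/4" using that by (auto simp: U_def)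
    have kk: "k \<le> k\<^sup>2" "k\<^sup>2 \<le> 4"
      using k12 power_mono[of k 2 2] by (auto simp: power2_eq_square)
    have "k * (x $ 2)\<^sup>2 \<le> 2 * (1/4)" "k\<^sup>2 * (x $ 2)\<^sup>2 \<le> 4 * (1/4)"
      using mult_mono[OF k12(2) x2] mult_mono[OF kk(2) x2] by auto
    then show "s x \<le> 2" "m x \<le> 2" using x1 by (auto simp: s_def m_def)
    show s5: "5 * L\<^sup>2 \<le> s x" using that by (simp add: U_def)
    have "k * (x $ 2)\<^sup>2 \<le> k\<^sup>2 * (x $ 2)\<^sup>2" using kk by (intro mult_right_mono) auto
    then show "5 * L\<^sup>2 \<le> m x" using s5 by (simp add: s_def m_def)
  qed
  have L25: "5 * L\<^sup>2 > 0" using L0 by simp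
  have pos: "s x > 0" "m x > 0" if "x \<in> U" for x
    using less_le_trans[OF L25 Ub(1)[OF that]] less_le_trans[OF L25 Ub(3)[OF that]] by blast+
  have neck: "\<bar>x $ 2\<bar> \<le> (x $ 1)\<^sup>2" if "x \<in> U" "x \<in> Omega_t \<epsilon>" for x
  proof (rule neck_width[OF eps Omega_t_coords[OF that(2) eps(1)] Uy[OF that(1)] _ k12(2)])
    have "\<epsilon> \<le> \<epsilon> / \<delta>" using \<delta> eps by (simp add: field_simps)
    then show "5 * \<epsilon> \<le> (x $ 1)\<^sup>2 + k * (x $ 2)\<^sup>2" using Ub(1)[OF that(1)] by (simp add: s_def L2)
  qed
  have neck2: "(x $ 2)\<^sup>2 \<le> (x $ 1)\<^sup>2 * (x $ 1)\<^sup>2" if "x \<in> U" "x \<in> Omega_t \<epsilon>" for x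
  proof -
    have "\<bar>x $ 2\<bar> * \<bar>x $ 2\<bar> \<le> (x $ 1)\<^sup>2 * (x $ 1)\<^sup>2" using neck[OF that] by (intro mult_mono) auto
    then show ?thesis by (simp add: power2_eq_square)
  qed
  have ss: "smooth_on A s" for A
  proof -
    have "smooth_on A (\<lambda>x. x $ 1 * x $ 1 + k * (x $ 2 * x $ 2))"
      by (intro smooth_on_mult smooth_on_add smooth_on_const smooth_on_coord)
    then show ?thesis by (simp add: s_def[abs_def] power2_eq_square)
  qed
  have ds: "((\<lambda>t. s (x + t *\<^sub>R axis i 1)) has_real_derivative 2 * z x $ i) (at 0)"
    and dm: "((\<lambda>t. m (x + t *\<^sub>R axis i 1)) has_real_derivative 2 * y x $ i) (at 0)"
    and dz: "((\<lambda>t. z (x + t *\<^sub>R axis i 1) $ i) has_real_derivative (if i = 1 then 1 else k)) (at 0)" for x i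
    using exhaust_2[of i] unfolding s_def m_def z_def y_def
    by (auto intro!: derivative_eq_intros simp: axis_def)
  have dpowr: "((\<lambda>t. f (x + t *\<^sub>R axis i 1) powr b) has_real_derivative b * f x powr (b - 1) * d) (at 0)"
    if "((\<lambda>t. f (x + t *\<^sub>R axis i 1)) has_real_derivative d) (at 0)" "f x > 0" for f :: "real^2 \<Rightarrow> real" and x i b d
    by (rule DERIV_chain2[OF _ that(1)]) (use has_real_derivative_powr[OF that(2)] in simp)
  have gv: "grad v x = (a * \<gamma> * s x powr (\<gamma> / 2 - 1)) *\<^sub>R z x" if "x \<in> U" for x
  proof -
    have "partial_deriv i v x = a * \<gamma> * s x powr (\<gamma> / 2 - 1) * z x $ i" for i
      unfolding v_def
      by (rule partial_derivI, rule DERIV_cong[OF DERIV_diff[OF DERIV_cmult[OF dpowr[OF ds pos(1)[OF that]]] DERIV_const]]) simp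
    then show ?thesis by (simp add: vec_eq_iff)
  qed
  have norm_z: "norm (z x) = sqrt (m x)" for x
    by (simp add: norm_eq_sqrt_inner inner_vec_def sum_2 z_def m_def power2_eq_square mult_ac)
  have Xeq: "X x = pflux p (grad v x)" if x: "x \<in> U" for x
  proof -
    have "pflux p (grad v x) = (a * \<gamma> * s x powr (\<gamma> / 2 - 1)) powr (p - 1) *\<^sub>R pflux p (z x)"
      unfolding gv[OF x] using a0 \<gamma>01 pos[OF x] by (intro pflux_scaleR) auto
    also have "(a * \<gamma> * s x powr (\<gamma> / 2 - 1)) powr (p - 1) = c * s x powr \<beta>"
      using a0 \<gamma>01 pos[OF x] by (simp add: powr_mult powr_powr c_def \<beta>_def)
    also have "pflux p (z x) = m x powr q *\<^sub>R z x"
      using pos[OF x] by (simp add: pflux_def norm_z powr_half_sqrt[symmetric] powr_powr q_def)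
    finally show ?thesis by (simp add: X_def)
  qed
  have dXd: "((\<lambda>t. X (x + t *\<^sub>R axis i 1) $ i) has_real_derivative dX i x) (at 0)" if x: "x \<in> U" for x i
  proof -
    have "((\<lambda>t. c * (s (x + t *\<^sub>R axis i 1) powr \<beta> * m (x + t *\<^sub>R axis i 1) powr q * z (x + t *\<^sub>R axis i 1) $ i))
        has_real_derivative dX i x) (at 0)"
      by (rule DERIV_cong[OF DERIV_cmult[OF DERIV_mult[OF DERIV_mult[OF dpowr[OF ds pos(1)[OF x]] dpowr[OF dm pos(2)[OF x]]] dz]]])
         (simp add: dX_def algebra_simps)
    then show ?thesis by (simp add: X_def mult.assoc)
  qed
  have S0: "S > 0" "S' > 0" using L25 by (auto simp: S_def S'_def less_max_iff_disj)
  have prod_bounds: "S \<le> s x powr \<beta> * m x powr q" "s x powr \<beta> * m x powr q \<le> S'" if x: "x \<in> U" for x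
    unfolding S_def S'_def
    using powr_between[OF L25 Ub(1,2)[OF x]] powr_between[OF L25 Ub(3,4)[OF x]] L25
    by (auto intro!: mult_mono simp: le_max_iff_disj)
  have div: "dX 1 x + dX 2 x = c * (s x powr \<beta> * m x powr q) *
     ((\<gamma> - 2) * (p - 1) * (m x / s x) + (p - 2) * (((x $ 1)\<^sup>2 + k ^ 3 * (x $ 2)\<^sup>2) / m x) + 1 + k)" if x: "x \<in> U" for x
  proof -
    have sb: "s x powr (\<beta> - 1) = s x powr \<beta> / s x" "m x powr (q - 1) = m x powr q / m x"
      using pos[OF x] by (auto simp: powr_diff)
    have "dX 1 x + dX 2 x = c * (s x powr \<beta> * m x powr q) *
        (2 * \<beta> * ((z x $ 1 * z x $ 1 + z x $ 2 * z x $ 2) / s x)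
         + 2 * q * ((y x $ 1 * z x $ 1 + y x $ 2 * z x $ 2) / m x) + 1 + k)"
      unfolding dX_def sb using pos[OF x] by (simp add: field_simps)
    moreover have "z x $ 1 * z x $ 1 + z x $ 2 * z x $ 2 = m x"
      by (simp add: z_def m_def power2_eq_square mult_ac)
    moreover have "y x $ 1 * z x $ 1 + y x $ 2 * z x $ 2 = (x $ 1)\<^sup>2 + k ^ 3 * (x $ 2)\<^sup>2"
      by (simp add: y_def z_def power2_eq_square power3_eq_cube mult_ac)
    moreover have "2 * \<beta> = (\<gamma> - 2) * (p - 1)" "2 * q = p - 2" by (simp_all add: \<beta>_def q_def field_simps)
    ultimately show ?thesis by simp
  qed
  define K where "K = {x. 6 * L\<^sup>2 \<le> s x \<and> L / 2 \<le> x $ 1 \<and> x $ 1 \<le> 3 * \<rho> / 4 \<and> (x $ 2)\<^sup>2 \<le> 1 / 8}"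
  have \<zeta>0: "\<zeta> x = 0" if "x \<notin> K" for x
  proof -
    have "s x / L\<^sup>2 - 6 \<le> 0 \<or> 2 * x $ 1 / L - 1 \<le> 0 \<or> 3 - 4 * x $ 1 / \<rho> \<le> 0 \<or> 2 - 16 * (x $ 2)\<^sup>2 \<le> 0"
      using that L0 \<rho>0 by (auto simp: K_def field_simps)
    then show ?thesis by (auto simp: \<zeta>_def smooth_step_eq_0_iff)
  qed
  have KU: "K \<subseteq> U"
    using L0 \<rho>0 by (auto simp: K_def U_def)
      (smt (verit) L25)
  have K_bound: "norm x \<le> 1" if "x \<in> U" for x
    using norm_le_l1_cart[of x] Uy[OF that] that \<rho>12 by (auto simp: U_def sum_2)
  have K_compact: "compact K"
  proof -
    have "closed K" unfolding K_def by (intro closed_Collect_conj closed_Collect_le continuous_intros cont_s)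
    moreover have "bounded K" using K_bound KU unfolding bounded_iff by blast
    ultimately show ?thesis by (simp add: compact_eq_bounded_closed)
  qed
  have \<zeta>s: "smooth_on UNIV \<zeta>"
  proof -
    have "smooth_on UNIV (\<lambda>x. smooth_step ((1 / L\<^sup>2) * s x - 6) * smooth_step ((2 / L) * x $ 1 - 1) *
      smooth_step (3 - (4 / \<rho>) * x $ 1) * smooth_step (2 - 16 * (x $ 2 * x $ 2)))"
      by (intro smooth_on_mult smooth_on_smooth_step smooth_on_diff smooth_on_const smooth_on_coord ss open_UNIV)
    then show ?thesis by (simp add: \<zeta>_def[abs_def] power2_eq_square)
  qed
  obtain B1 where B1: "\<And>x. norm (grad \<zeta> x) \<le> B1"
    using grad_bounded_of_compact_support[OF \<zeta>s K_compact \<zeta>0] by blast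
  have \<zeta>1: "\<zeta> x = 1" if "7 * L\<^sup>2 \<le> s x" "L \<le> x $ 1" "x $ 1 \<le> \<rho> / 2" "(x $ 2)\<^sup>2 \<le> 1 / 16" for x
  proof -
    have "s x / L\<^sup>2 - 6 \<ge> 1" "2 * x $ 1 / L - 1 \<ge> 1" "3 - 4 * x $ 1 / \<rho> \<ge> 1" "2 - 16 * (x $ 2)\<^sup>2 \<ge> 1"
      using that L0 \<rho>0 by (auto simp: field_simps)
    from this[THEN smooth_step_eq_1_iff[THEN iffD2]] show ?thesis by (simp only: \<zeta>_def mult_1)
  qed
  have "AE x in M. x \<in> U \<longrightarrow> \<zeta> x = 1 \<longrightarrow> v x - h x \<le> \<eta>"
  proof (rule comparison[where X = X and dX = dX and d = "c * S * \<delta>" and B = "max B1 (c * S' * 2)"])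
    show "open U" by fact
    show "U \<subseteq> ball 0 5" using K_bound by fastforce
    show "smooth_on U v" unfolding v_def
      by (intro smooth_on_diff smooth_on_mult smooth_on_const smooth_on_powr ss pos)
    show "smooth_on UNIV \<zeta>" by fact
    show "0 \<le> \<zeta> x" "\<zeta> x \<le> 1" for x
      unfolding \<zeta>_def using smooth_step_bounds by (auto intro!: mult_le_one mult_nonneg_nonneg)
    show "norm (grad \<zeta> x) \<le> max B1 (c * S' * 2)" for x using B1[of x] by simp
    fix x assume x: "x \<in> U"
    show "X x = pflux p (grad v x)" by (rule Xeq[OF x])
    have "norm (z x) \<le> 2"
      unfolding norm_z using Ub(4)[OF x] by (intro real_le_lsqrt) auto
    then have "(s x powr \<beta> * m x powr q) * norm (z x) \<le> S' * 2"
      using prod_bounds(2)[OF x] S0 by (intro mult_mono) auto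
    then have "c * ((s x powr \<beta> * m x powr q) * norm (z x)) \<le> c * (S' * 2)"
      using c0 by (intro mult_left_mono) auto
    then have "norm (X x) \<le> c * S' * 2"
      using c0 by (simp add: X_def abs_mult mult.assoc)
    then show "norm (X x) \<le> max B1 (c * S' * 2)" by simp
    fix i show "((\<lambda>t. X (x + t *\<^sub>R axis i 1) $ i) has_real_derivative dX i x) (at 0)" by (rule dXd[OF x])
  next
    have nz: "\<forall>x\<in>U. s x \<noteq> 0" "\<forall>x\<in>U. m x \<noteq> 0" using pos by fastforce+
    show "continuous_on U X" unfolding X_def
      by (intro continuous_on_scaleR continuous_on_mult continuous_on_powr continuous_on_const cont_s cont_m cont_zv nz)
    show "continuous_on U (dX i)" for i
      unfolding dX_def
      by (intro continuous_on_mult continuous_on_add continuous_on_powr continuous_on_const cont_s cont_m cont_z cont_y nz)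
    show "c * S * \<delta> > 0" using c0 S0 \<delta> by simp
    fix x assume "x \<in> U \<inter> Omega_t \<epsilon>"
    then have x: "x \<in> U" "x \<in> Omega_t \<epsilon>" by auto
    have "\<delta> \<le> (\<gamma> - 2) * (p - 1) * (m x / s x) + (p - 2) * (((x $ 1)\<^sup>2 + k ^ 3 * (x $ 2)\<^sup>2) / m x) + 1 + k"
      unfolding m_def s_def
    proof (rule barrier_divergence_factor[OF p1 \<delta> k])
      show "0 < (x $ 1)\<^sup>2" using x(1) by (auto simp: U_def)
      have "(x $ 1)\<^sup>2 \<le> \<rho>\<^sup>2" using x(1) by (intro power_mono) (auto simp: U_def)
      then have "(x $ 1)\<^sup>2 * (x $ 1)\<^sup>2 \<le> \<rho>\<^sup>2 * (x $ 1)\<^sup>2" by (intro mult_right_mono) auto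
      then show "(x $ 2)\<^sup>2 \<le> \<delta> / (8 * p) * (x $ 1)\<^sup>2" using neck2[OF x] by (simp add: \<rho>2)
    qed (use \<gamma>01 in auto)
    moreover have "c * S \<le> c * (s x powr \<beta> * m x powr q)"
      using prod_bounds(1)[OF x(1)] c0 by (intro mult_left_mono) auto
    ultimately show "c * S * \<delta> \<le> dX 1 x + dX 2 x"
      unfolding div[OF x(1)] using c0 S0 \<delta> by (intro mult_mono) auto
    have "5 * \<epsilon> \<le> \<delta> * ((x $ 1)\<^sup>2 + k * (x $ 2)\<^sup>2)"
      using mult_left_mono[OF Ub(1)[OF x(1)], of \<delta>] \<delta> by (simp add: L2 s_def)
    from neck_outward[OF eps \<delta> k Omega_t_coords[OF x(2) eps(1)] this]
    have o: "k * \<bar>x $ 2\<bar> * (1 + \<epsilon> / 2) \<le> s x" by (simp add: s_def)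
    have "z x \<bullet> (x - upper_center \<epsilon>) = s x - k * x $ 2 * (1 + \<epsilon> / 2)"
      "z x \<bullet> (x - lower_center \<epsilon>) = s x + k * x $ 2 * (1 + \<epsilon> / 2)"
      by (simp_all add: inner_vec_def sum_2 z_def s_def power2_eq_square algebra_simps)
    moreover have "k * x $ 2 * (1 + \<epsilon> / 2) \<le> s x" "- (k * x $ 2 * (1 + \<epsilon> / 2)) \<le> s x"
    proof -
      have "\<bar>k * x $ 2 * (1 + \<epsilon> / 2)\<bar> = k * \<bar>x $ 2\<bar> * (1 + \<epsilon> / 2)"
        using k12 eps by (simp add: abs_mult)
      then have "\<bar>k * x $ 2 * (1 + \<epsilon> / 2)\<bar> \<le> s x" using o by (simp only:)
      then show "k * x $ 2 * (1 + \<epsilon> / 2) \<le> s x" "- (k * x $ 2 * (1 + \<epsilon> / 2)) \<le> s x"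
        by (rule abs_le_D1, rule abs_le_D2)
    qed
    ultimately have "0 \<le> z x \<bullet> (x - upper_center \<epsilon>)" "0 \<le> z x \<bullet> (x - lower_center \<epsilon>)" by linarith+
    then show "0 \<le> X x \<bullet> (x - upper_center \<epsilon>) \<and> 0 \<le> X x \<bullet> (x - lower_center \<epsilon>)"
      using c0 by (simp add: X_def)
  next
    show "\<exists>K. compact K \<and> K \<subseteq> U \<and> (\<forall>x\<in>U - K. \<zeta> x * flat_exp (v x - w k x - \<eta>) = 0)" for k
      by (rule exI[of _ K]) (use K_compact KU \<zeta>0 in auto)
    have "AE x in M. x \<in> Omega_t \<epsilon>" by (rule AE_I2) simp
    with linear_lower_bound show "AE x in M. x \<in> U \<longrightarrow> v x - h x > \<eta> \<longrightarrow> \<zeta> x = 1"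
    proof eventually_elim
      case (elim x)
      show ?case
      proof (intro impI)
        assume x: "x \<in> U" and gt: "v x - h x > \<eta>"
        have x0: "0 < x $ 1" "x $ 1 < \<rho>" using x by (auto simp: U_def)
        have h: "x $ 1 / 2 \<le> h x" using elim x0 by blast
        have vx: "v x > x $ 1 / 2" using gt h \<eta> by linarith
        have "a * (7 * L\<^sup>2) powr (\<gamma> / 2) < a * s x powr (\<gamma> / 2)" using vx x0 by (simp add: v_def)
        then have "(7 * L\<^sup>2) powr (\<gamma> / 2) < s x powr (\<gamma> / 2)" using a0 by simp
        then have s7: "7 * L\<^sup>2 < s x"
          using powr_mono2[of "\<gamma> / 2" "s x" "7 * L\<^sup>2"] \<gamma>01 pos(1)[OF x] by force
        have x14: "(x $ 1)\<^sup>2 \<le> 1 / 4"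
          using x0 \<rho>12 power_mono[of "x $ 1" "1/2" 2] by (auto simp: power2_eq_square)
        have x2: "(x $ 2)\<^sup>2 \<le> (1 / 4) * (x $ 1)\<^sup>2"
          using neck2[OF x elim(2)] mult_right_mono[OF x14, of "(x $ 1)\<^sup>2"] by simp
        have kx: "k * (x $ 2)\<^sup>2 \<le> 2 * (x $ 2)\<^sup>2" using k12 by (intro mult_right_mono) auto
        have sx: "s x \<le> 2 * (x $ 1)\<^sup>2" using x2 kx zero_le_power2[of "x $ 1"] unfolding s_def by linarith
        have "s x \<le> 1" using sx x14 by linarith
        then have "s x powr (\<gamma> / 2) \<le> 1" using pos[OF x] \<gamma>01 by (simp add: powr_le1)
        then have "v x \<le> a" using a0 by (simp add: v_def mult_left_le) (smt (verit) mult_left_le mult_nonneg_nonneg powr_ge_zero)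
        then have x1: "x $ 1 \<le> \<rho> / 2" using vx by (simp add: a_def)
        have "L\<^sup>2 \<le> (x $ 1)\<^sup>2" using s7 sx zero_le_power2[of L] by linarith
        then have xL: "L \<le> x $ 1" using x0 by (simp add: power2_le_iff_abs_le)
        show "\<zeta> x = 1" by (rule \<zeta>1) (use s7 xL x1 x2 x14 in auto)
      qed
    qed
  qed
  then show ?thesis
  proof eventually_elim
    case (elim x)
    show ?case
    proof (intro impI, elim conjE)
      assume *: "7 * L\<^sup>2 \<le> (x $ 1)\<^sup>2 + k * (x $ 2)\<^sup>2" "L \<le> x $ 1" "x $ 1 \<le> \<rho> / 2" "(x $ 2)\<^sup>2 \<le> 1 / 16"
      then have "x \<in> U" using L0 \<rho>0 by (auto simp: U_def s_def) (smt (verit) L25)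
      moreover have "\<zeta> x = 1" by (rule \<zeta>1) (use * in \<open>auto simp: s_def\<close>)
      ultimately have "v x - h x \<le> \<eta>" using elim by blast
      then show "\<rho> / 4 * ((x $ 1)\<^sup>2 + k * (x $ 2)\<^sup>2) powr (\<gamma> / 2) - \<rho> / 4 * (7 * L\<^sup>2) powr (\<gamma> / 2) - h x \<le> \<eta>"
        by (simp add: v_def s_def a_def)
    qed
  qed
qed


lemma neck_lower_bound:
  fixes L k \<gamma> \<rho> \<delta> :: real
  assumes "0 < \<delta>" "\<delta> < 1" "L = sqrt (\<epsilon> / \<delta>)" "k = 2 - \<delta> / 2"
    "\<gamma> = 1 - 2 * (1 - \<delta>) / max (p - 1) 2" "\<rho> = sqrt (\<delta> / (8 * p))"
  shows "AE x in M. 7 * L\<^sup>2 \<le> (x $ 1)\<^sup>2 + k * (x $ 2)\<^sup>2 \<and> L \<le> x $ 1 \<and> x $ 1 \<le> \<rho> / 2 \<and> (x $ 2)\<^sup>2 \<le> 1 / 16 \<longrightarrow>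
     \<rho> / 4 * ((x $ 1)\<^sup>2 + k * (x $ 2)\<^sup>2) powr (\<gamma> / 2) - \<rho> / 4 * (7 * L\<^sup>2) powr (\<gamma> / 2) \<le> h x"
  by (rule AE_le_of_all_pos[OF neck_lower_bound_approx[OF assms]])

text \<open>A bound without smallness of eps: on a square of half-width at most X/8 about distance
  \<open>X\<close> the linear bound gives height at least 7X/16. It serves for delta >= 1 and for
  eps bounded away from 0.\<close>

lemma gradient_ge_const:
  assumes \<delta>: "0 < \<delta>" and g_le: "AE x in M. x \<in> ball 0 (8 * sqrt (\<epsilon> / \<delta>)) \<longrightarrow> norm (g x) \<le> N"
  shows "7 / 16 \<le> N"
proof -
  define L where "L = sqrt (\<epsilon> / \<delta>)"
  have L0: "L > 0" using \<delta> eps by (simp add: L_def)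
  \<comment> \<open>5 L keeps the moving square in the ball of radius 8 L, and 1 keeps it in the
    domain.\<close>
  define X where "X = min (5 * L) 1"
  define r where "r = min \<epsilon> X / 8"
  have X: "0 < X" "X \<le> 1" "X \<le> 5 * L" using L0 by (auto simp: X_def)
  have r: "0 < r" "r \<le> \<epsilon> / 8" "r \<le> X / 8" using X eps by (auto simp: r_def)
  have "7 / 16 * X \<le> N * X"
  proof (rule gradient_ge_slope[OF r(1) _ X(1) _ _ _ g_le])
    show "AE x in M. \<bar>x $ 1 - X\<bar> \<le> r \<and> \<bar>x $ 2\<bar> \<le> r \<longrightarrow> 7 / 16 * X \<le> h x"
      using linear_lower_bound
    proof eventually_elim
      case (elim x)
      show ?case
      proof
        assume "\<bar>x $ 1 - X\<bar> \<le> r \<and> \<bar>x $ 2\<bar> \<le> r"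
        then have "7 / 8 * X \<le> x $ 1" using r(3) by linarith
        moreover from this have "x $ 1 / 2 \<le> h x" using elim X(1) by auto
        ultimately show "7 / 16 * X \<le> h x" by linarith
      qed
    qed
  qed (use r X eps in \<open>auto simp: L_def[symmetric]\<close>)
  then show ?thesis using X(1) by simp
qed

text \<open>On a square around x_1 = 5 L one has s >= (39/8)^2 L^2 > 23 L^2, above the zero level 7
  L^2 of the barrier, so the height is a fixed multiple of L^gamma; the distance 5 L turns it into
  the slope. Since x_1 <= 6 L on the square, \<open>small\<close> places it in the range x_1 <=
  rho/2.\<close>

lemma gradient_ge_neck:
  fixes \<gamma> \<rho> \<delta> :: real
  assumes \<delta>: "0 < \<delta>" "\<delta> < 1"
    and \<gamma>: "\<gamma> = 1 - 2 * (1 - \<delta>) / max (p - 1) 2" and \<rho>: "\<rho> = sqrt (\<delta> / (8 * p))"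
    and small: "12 * sqrt (\<epsilon> / \<delta>) \<le> \<rho>"
    and g_le: "AE x in M. x \<in> ball 0 (8 * sqrt (\<epsilon> / \<delta>)) \<longrightarrow> norm (g x) \<le> N"
  shows "\<rho> / 20 * (23 powr (\<gamma> / 2) - 7 powr (\<gamma> / 2)) * (\<epsilon> / \<delta>) powr ((\<gamma> - 1) / 2) \<le> N"
proof -
  define L where "L = sqrt (\<epsilon> / \<delta>)"
  have L0: "L > 0" using \<delta> eps by (simp add: L_def)
  have L2: "L\<^sup>2 = \<epsilon> / \<delta>" using \<delta> eps by (simp add: L_def)
  have "\<epsilon>\<^sup>2 \<le> \<epsilon>" using eps by (simp add: power2_eq_square)
  also have "\<epsilon> \<le> L\<^sup>2" unfolding L2 using \<delta> eps by (simp add: field_simps)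
  finally have Le: "\<epsilon> \<le> L" using L0 by (simp add: power2_le_iff_abs_le)
  define r where "r = \<epsilon> / 8"
  have r: "0 < r" "r \<le> L / 8" "r < \<epsilon> / 2" "r \<le> 1 / 8" using eps Le by (auto simp: r_def)
  have "\<delta> / (8 * p) \<le> 1" using \<delta> p_gt_1 by (simp add: field_simps)
  then have "\<rho> \<le> 1" unfolding \<rho> by simp
  then have L12: "12 * L \<le> 1" using small by (simp add: L_def)
  have \<rho>0: "\<rho> > 0" using \<delta> p_gt_1 by (simp add: \<rho>)
  have \<gamma>0: "\<gamma> > 0"
  proof -
    have "2 * (1 - \<delta>) / max (p - 1) 2 \<le> 2 * (1 - \<delta>) / 2"
      using \<delta> by (intro divide_left_mono) auto
    then show ?thesis using \<delta> by (simp add: \<gamma>)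
  qed
  define m where "m = \<rho> / 4 * (23 * L\<^sup>2) powr (\<gamma> / 2) - \<rho> / 4 * (7 * L\<^sup>2) powr (\<gamma> / 2)"
  have "m \<le> N * (5 * L)"
  proof (rule gradient_ge_slope[OF r(1) r(3) _ _ _ _ g_le])
    show "AE x in M. \<bar>x $ 1 - 5 * L\<bar> \<le> r \<and> \<bar>x $ 2\<bar> \<le> r \<longrightarrow> m \<le> h x"
      using neck_lower_bound[OF \<delta> L_def refl \<gamma> \<rho>]
    proof eventually_elim
      case (elim x)
      show ?case
      proof (intro impI, elim conjE)
        assume x: "\<bar>x $ 1 - 5 * L\<bar> \<le> r" "\<bar>x $ 2\<bar> \<le> r"
        define s where "s = (x $ 1)\<^sup>2 + (2 - \<delta> / 2) * (x $ 2)\<^sup>2"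
        have x1: "39 / 8 * L \<le> x $ 1" "x $ 1 \<le> 6 * L" using x(1) r(2) L0 by linarith+
        have "(39 / 8 * L)\<^sup>2 \<le> (x $ 1)\<^sup>2" using x1 L0 by (intro power_mono) auto
        moreover have "23 * L\<^sup>2 \<le> (39 / 8 * L)\<^sup>2" by (simp add: power2_eq_square)
        ultimately have "23 * L\<^sup>2 \<le> (x $ 1)\<^sup>2" by (rule order_trans[rotated])
        moreover have "0 \<le> (2 - \<delta> / 2) * (x $ 2)\<^sup>2" using \<delta> by simp
        ultimately have s: "23 * L\<^sup>2 \<le> s" unfolding s_def by linarith
        have s7: "7 * L\<^sup>2 \<le> s" using s by (rule order_trans[rotated]) simp
        have "(x $ 2)\<^sup>2 \<le> (1/4)\<^sup>2" using x(2) r(4) by (intro power2_le_iff_abs_le[THEN iffD2]) auto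
        then have "7 * L\<^sup>2 \<le> s \<and> L \<le> x $ 1 \<and> x $ 1 \<le> \<rho> / 2 \<and> (x $ 2)\<^sup>2 \<le> 1 / 16"
          using s7 x1 L0 small by (simp add: L_def[symmetric] power_divide)
        then have "\<rho> / 4 * s powr (\<gamma> / 2) - \<rho> / 4 * (7 * L\<^sup>2) powr (\<gamma> / 2) \<le> h x"
          using elim unfolding s_def by blast
        moreover have "(23 * L\<^sup>2) powr (\<gamma> / 2) \<le> s powr (\<gamma> / 2)"
          using s \<gamma>0 by (intro powr_mono2) auto
        then have "\<rho> / 4 * (23 * L\<^sup>2) powr (\<gamma> / 2) \<le> \<rho> / 4 * s powr (\<gamma> / 2)"
          using \<rho>0 by (intro mult_left_mono) auto
        ultimately show "m \<le> h x" unfolding m_def by linarith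
      qed
    qed
  qed (use r L0 L12 in \<open>auto simp: L_def[symmetric]\<close>)
  moreover have "m = (\<rho> / 20 * (23 powr (\<gamma> / 2) - 7 powr (\<gamma> / 2)) * (\<epsilon> / \<delta>) powr ((\<gamma> - 1) / 2)) * (5 * L)"
  proof -
    have "(\<epsilon> / \<delta>) powr ((\<gamma> - 1) / 2) * L = (L\<^sup>2) powr ((\<gamma> - 1) / 2) * (L\<^sup>2) powr (1 / 2)"
      using L0 by (simp add: L2[symmetric] powr_half_sqrt)
    also have "\<dots> = (L\<^sup>2) powr (\<gamma> / 2)"
      unfolding powr_add[symmetric] by (simp add: diff_divide_distrib)
    finally have e: "(\<epsilon> / \<delta>) powr ((\<gamma> - 1) / 2) * L = (L\<^sup>2) powr (\<gamma> / 2)" .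
    have "m = \<rho> / 4 * (23 powr (\<gamma> / 2) - 7 powr (\<gamma> / 2)) * (L\<^sup>2) powr (\<gamma> / 2)"
      by (simp add: m_def powr_mult algebra_simps)
    then show ?thesis unfolding e[symmetric] by simp
  qed
  ultimately have "(\<rho> / 20 * (23 powr (\<gamma> / 2) - 7 powr (\<gamma> / 2)) * (\<epsilon> / \<delta>) powr ((\<gamma> - 1) / 2)) * (5 * L)
      \<le> N * (5 * L)" by (simp only:)
  then show ?thesis by (rule mult_right_le_imp_le) (use L0 in simp)
qed

end

text \<open>For delta < 1 the barrier handles 12 sqrt(eps/delta) <= rho. Otherwise eps exceeds delta
  rho^2/144, and as the exponent is at most 0 the power of eps is bounded, so the constant bound
  suffices. For delta >= 1 the exponent is nonnegative and the power of eps is at most 1.\<close>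

lemma uniform_gradient_lower_bound:
  fixes p \<delta> :: real
  assumes p: "p > 1" and \<delta>: "\<delta> > 0"
  shows "\<exists>c>0. \<forall>\<epsilon> g h w N. odd_solution p \<epsilon> g h w \<longrightarrow>
      (AE x in lebesgue_on (Omega_t \<epsilon>). x \<in> ball 0 (8 * sqrt (\<epsilon> / \<delta>)) \<longrightarrow> norm (g x) \<le> N) \<longrightarrow>
      c * \<epsilon> powr ((- 1 + \<delta>) / max (p - 1) 2) \<le> N"
proof (cases "\<delta> < 1")
  case False
  show ?thesis
  proof (intro exI[of _ "7/16"] conjI allI impI)
    fix \<epsilon> g h w N
    assume "odd_solution p \<epsilon> g h w"
      and le: "AE x in lebesgue_on (Omega_t \<epsilon>). x \<in> ball 0 (8 * sqrt (\<epsilon> / \<delta>)) \<longrightarrow> norm (g x) \<le> N"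
    then interpret odd_solution p \<epsilon> g h w by simp
    have "\<epsilon> powr ((- 1 + \<delta>) / max (p - 1) 2) \<le> 1"
      using False eps by (intro powr_le1) (auto intro!: divide_nonneg_pos)
    then show "7/16 * \<epsilon> powr ((- 1 + \<delta>) / max (p - 1) 2) \<le> N"
      using gradient_ge_const[OF \<delta> le] by linarith
  qed simp
next
  case True
  define E where "E = (- 1 + \<delta>) / max (p - 1) 2"
  define \<gamma> where "\<gamma> = 1 - 2 * (1 - \<delta>) / max (p - 1) 2"
  define \<rho> where "\<rho> = sqrt (\<delta> / (8 * p))"
  define \<epsilon>0 where "\<epsilon>0 = \<delta> * \<rho>\<^sup>2 / 144"
  define K1 where "K1 = \<rho> / 20 * (23 powr (\<gamma> / 2) - 7 powr (\<gamma> / 2)) * \<delta> powr (- E)"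
  define K2 where "K2 = 7 / 16 * \<epsilon>0 powr (- E)"
  have \<gamma>E: "(\<gamma> - 1) / 2 = E" by (simp add: \<gamma>_def E_def field_simps)
  have E0: "E \<le> 0" using True unfolding E_def by (intro divide_nonpos_pos) auto
  have \<rho>0: "\<rho> > 0" using \<delta> p by (simp add: \<rho>_def)
  have \<epsilon>00: "\<epsilon>0 > 0" using \<delta> \<rho>0 by (simp add: \<epsilon>0_def)
  have "2 * (1 - \<delta>) / max (p - 1) 2 \<le> 2 * (1 - \<delta>) / 2"
    using True by (intro divide_left_mono) auto
  then have \<gamma>0: "\<gamma> > 0" using \<delta> by (simp add: \<gamma>_def)
  have K1: "K1 > 0" unfolding K1_def
    using \<rho>0 \<delta> \<gamma>0 powr_less_mono2[of "\<gamma> / 2" 7 23] by simp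
  have K2: "K2 > 0" unfolding K2_def using \<epsilon>00 by simp
  show ?thesis unfolding E_def[symmetric]
  proof (intro exI[of _ "min K1 K2"] conjI allI impI)
    show "min K1 K2 > 0" using K1 K2 by simp
    fix \<epsilon> g h w N
    assume "odd_solution p \<epsilon> g h w"
      and le: "AE x in lebesgue_on (Omega_t \<epsilon>). x \<in> ball 0 (8 * sqrt (\<epsilon> / \<delta>)) \<longrightarrow> norm (g x) \<le> N"
    then interpret odd_solution p \<epsilon> g h w by simp
    show "min K1 K2 * \<epsilon> powr E \<le> N"
    proof (cases "12 * sqrt (\<epsilon> / \<delta>) \<le> \<rho>")
      case small: True
      have "(\<epsilon> / \<delta>) powr E = \<delta> powr (- E) * \<epsilon> powr E"
        using eps \<delta> by (simp add: powr_divide powr_minus_divide)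
      then have "K1 * \<epsilon> powr E \<le> N"
        using gradient_ge_neck[OF \<delta> True \<gamma>_def \<rho>_def small le] unfolding \<gamma>E K1_def by (simp add: mult_ac)
      moreover have "min K1 K2 * \<epsilon> powr E \<le> K1 * \<epsilon> powr E" by (intro mult_right_mono) auto
      ultimately show ?thesis by linarith
    next
      case False
      have "\<rho> / 12 \<le> sqrt (\<epsilon> / \<delta>)" using False by simp
      then have "(\<rho> / 12)\<^sup>2 \<le> (sqrt (\<epsilon> / \<delta>))\<^sup>2" using \<rho>0 by (intro power_mono) auto
      then have "\<rho>\<^sup>2 / 144 \<le> \<epsilon> / \<delta>" using eps \<delta> by (simp add: power_divide)
      then have "\<epsilon>0 \<le> \<epsilon>" using \<delta> by (simp add: \<epsilon>0_def field_simps)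
      then have "\<epsilon> powr E \<le> \<epsilon>0 powr E" using \<epsilon>00 E0 by (intro powr_mono2') auto
      then have "K2 * \<epsilon> powr E \<le> K2 * \<epsilon>0 powr E" using K2 by (intro mult_left_mono) auto
      also have "\<dots> = 7 / 16" using \<epsilon>00 by (simp add: K2_def powr_minus)
      also have "\<dots> \<le> N" by (rule gradient_ge_const[OF \<delta> le])
      finally have "K2 * \<epsilon> powr E \<le> N" .
      moreover have "min K1 K2 * \<epsilon> powr E \<le> K2 * \<epsilon> powr E" by (intro mult_right_mono) auto
      ultimately show ?thesis by linarith
    qed
  qed
qed

theorem theorem1p4:
  fixes p \<delta> :: real
  assumes "p > 1" and "\<delta> > 0"
  shows "\<exists>C > 0. \<forall>\<epsilon> u g. 0 < \<epsilon> \<and> \<epsilon> < 1 \<and> is_solution p \<epsilon> u g \<longrightarrow>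
           Linf_norm (Omega_t \<epsilon> \<inter> ball 0 (8 * sqrt (\<epsilon> / \<delta>))) g \<ge>
             ereal (if p \<le> 3 then \<epsilon> powr ((-1 + \<delta>) / 2) / C
                    else \<epsilon> powr ((-1 + \<delta>) / (p - 1)) / C)"
proof -
  obtain c where c: "c > 0" and bound: "\<And>\<epsilon> g h w N. odd_solution p \<epsilon> g h w \<Longrightarrow>
      (AE x in lebesgue_on (Omega_t \<epsilon>). x \<in> ball 0 (8 * sqrt (\<epsilon> / \<delta>)) \<longrightarrow> norm (g x) \<le> N) \<Longrightarrow>
      c * \<epsilon> powr ((- 1 + \<delta>) / max (p - 1) 2) \<le> N"
    using uniform_gradient_lower_bound[OF assms] by blast
  show ?thesis
  proof (intro exI[of _ "1 / c"] conjI allI impI)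
    show "1 / c > 0" using c by simp
    fix \<epsilon> u g
    assume A: "0 < \<epsilon> \<and> \<epsilon> < 1 \<and> is_solution p \<epsilon> u g"
    then obtain h w where sol: "odd_solution p \<epsilon> g h w"
      using odd_solution_exists[OF assms(1)] by blast
    let ?S = "Omega_t \<epsilon> \<inter> ball 0 (8 * sqrt (\<epsilon> / \<delta>))"
    let ?b = "c * \<epsilon> powr ((- 1 + \<delta>) / max (p - 1) 2)"
    have "ereal ?b \<le> Linf_norm ?S g"
    proof (rule ccontr)
      assume "\<not> ereal ?b \<le> Linf_norm ?S g"
      then have "Linf_norm ?S g < ereal ?b" by (simp only: not_le)
      \<comment> \<open>The essential supremum is an extended real; a real \<open>N\<close> strictly
        between it and the target is what \<open>bound\<close> can contradict.\<close>
      from ereal_dense2[OF this] obtain N where N: "Linf_norm ?S g < ereal N" "ereal N < ereal ?b" by blast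
      have S: "?S \<in> sets lebesgue" "Omega_t \<epsilon> \<in> sets lebesgue"
        using open_Omega_t[of \<epsilon>] by auto
      have "AE x in lebesgue_on ?S. ereal (norm (g x)) \<le> Linf_norm ?S g"
        unfolding Linf_norm_def by (rule esssup_AE)
      then have "AE x in lebesgue_on ?S. norm (g x) \<le> N"
        by eventually_elim (use N(1) in \<open>metis ereal_less_eq(3) less_imp_le order_trans\<close>)
      then have "AE x in lebesgue_on (Omega_t \<epsilon>). x \<in> ball 0 (8 * sqrt (\<epsilon> / \<delta>)) \<longrightarrow> norm (g x) \<le> N"
        using S by (simp add: AE_restrict_space_iff imp_conjL)
      from bound[OF sol this] N(2) show False by simp
    qed
    \<comment> \<open>The two regimes are the two values of the maximum of p-1 and 2, and they agree
      at p = 3.\<close>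
    moreover have "(if p \<le> 3 then \<epsilon> powr ((-1 + \<delta>) / 2) / (1 / c)
                    else \<epsilon> powr ((-1 + \<delta>) / (p - 1)) / (1 / c)) = ?b"
      by (auto simp: max_def)
    ultimately show "Linf_norm ?S g \<ge> ereal (if p \<le> 3 then \<epsilon> powr ((-1 + \<delta>) / 2) / (1 / c)
                    else \<epsilon> powr ((-1 + \<delta>) / (p - 1)) / (1 / c))" by simp
  qed
qed

end
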